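(* Let $\mathbb{H}=\{(z_1,z_2)\in\mathbb{C}^2 : |z_1|<|z_2|<1\}$. Let $s'\in\mathbb{R}$, written uniquely as $s'=s+2k$ with $k\in\mathbb{Z}$ and $s\in(0,2]$, and let $\mathcal{B}_{\mathbb{H},s'}$ be the weighted Bergman projection on $\mathbb{H}$ with the weight $\mu(z)=|z_2|^{s'}$, $z\in\mathbb{H}$. Here "$L^p$ bounded" means bounded on $L^p(\mathbb{H},\mu)$. (1) For $s'\in(-2,\infty)$, $\mathcal{B}_{\mathbb{H},s'}$ is $L^p$ bounded if and only if $p\in\left(\frac{s+2k+4}{s+k+2},\frac{s+2k+4}{k+2}\right)$. (2) For $s'\in[-5,-2]$, $\mathcal{B}_{\mathbb{H},s'}$ is $L^p$ bounded for $p\in(1,\infty)$. (3) For $s'\in(-6,-5)$ (so that $k=-3$ and $s\in(0,1)$), $\mathcal{B}_{\mathbb{H},s'}$ is $L^p$ bounded if and only if $p\in\left(2-s,\frac{2-s}{1-s}\right)$. (4) When $s'=-6$, $\mathcal{B}_{\mathbb{H},s'}$ is $L^p$ bounded for $p\in(1,\infty)$. (5) For $s'\in(-\infty,-6)$, $\mathcal{B}_{\mathbb{H},s'}$ is $L^p$ bounded if and only if $p\in\left(\frac{s+2k+4}{k+2},\frac{s+2k+4}{s+k+2}\right)$.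
   Context: For a domain $\Omega\subset\mathbb{C}^n$, a weight on $\Omega$ is a measurable function $\mu$ on $\Omega$ that is positive almost everywhere and locally integrable on $\Omega$. For $p\ge 1$, $L^p(\Omega,\mu)$ is the space of measurable $f$ on $\Omega$ with $\|f\|_{L^p(\Omega,\mu)}=\left(\int_\Omega|f|^p\mu\,dV\right)^{1/p}<\infty$. For $\mu$ continuous and non-vanishing, $A^2(\Omega,\mu)$ is the (closed) subspace of holomorphic functions in $L^2(\Omega,\mu)$, and the weighted Bergman projection on $\Omega$ with the weight $\mu$ is the orthogonal projection from $L^2(\Omega,\mu)$ onto $A^2(\Omega,\mu)$; it is an integral operator $f\mapsto\int_\Omega B_{\Omega,\mu}(z,\zeta)f(\zeta)\mu(\zeta)\,dV(\zeta)$, where $B_{\Omega,\mu}$ is the weighted Bergman kernel. An operator $T$ on $L^2(\Omega,\mu)$ is bounded on $L^p(\Omega,\mu)$ if, as usual, there is a constant $C$ with $\|Tf\|_{L^p(\Omega,\mu)}\le C\|f\|_{L^p(\Omega,\mu)}$ for all $f\in L^p(\Omega,\mu)\cap L^2(\Omega,\mu)$. Throughout, $p\in[1,\infty)$. *)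

theory Defs
  imports "HOL-Analysis.Analysis"
begin

text \<open>
  \<open>\<complex>\<^sup>2\<close> is the type \<^typ>\<open>complex \<times> complex\<close>, whose Euclidean structure is that of \<open>\<real>\<^sup>4\<close>;
  \<open>dV\<close> is Lebesgue measure.
\<close>

definition hartogs_triangle :: "(complex \<times> complex) set" where
  "hartogs_triangle = {(z1, z2). norm z1 < norm z2 \<and> norm z2 < 1}"

text \<open>The measure \<open>\<mu> dV\<close> on \<open>\<Omega>\<close>; functions are only looked at on \<open>\<Omega>\<close>.\<close>

definition weighted_measure :: "'a::euclidean_space set \<Rightarrow> ('a \<Rightarrow> real) \<Rightarrow> 'a measure" where
  "weighted_measure \<Omega> \<mu> = density (lebesgue_on \<Omega>) (\<lambda>z. ennreal (\<mu> z))"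

text \<open>Elements of \<open>L\<^sup>p\<close> are functions, not classes modulo null sets. The exponent is meant to
  satisfy \<open>1 \<le> p < \<infinity>\<close>.\<close>

definition Lp_space :: "real \<Rightarrow> 'a measure \<Rightarrow> ('a \<Rightarrow> complex) set" where
  "Lp_space p M = {f \<in> borel_measurable M. integrable M (\<lambda>z. norm (f z) powr p)}"

definition Lp_norm :: "real \<Rightarrow> 'a measure \<Rightarrow> ('a \<Rightarrow> complex) \<Rightarrow> real" where
  "Lp_norm p M f = (LINT z|M. norm (f z) powr p) powr (1 / p)"

definition L2_inner :: "'a measure \<Rightarrow> ('a \<Rightarrow> complex) \<Rightarrow> ('a \<Rightarrow> complex) \<Rightarrow> complex" where
  "L2_inner M f g = (LINT z|M. f z * cnj (g z))"

text \<open>The library's \<open>holomorphic_on\<close> is for one variable. In two variables: (Frechet)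
  differentiability with a complex-linear derivative, at every point of the open set \<open>\<Omega>\<close>.\<close>

definition holomorphic2_on :: "(complex \<times> complex \<Rightarrow> complex) \<Rightarrow> (complex \<times> complex) set \<Rightarrow> bool" where
  "holomorphic2_on f \<Omega> \<longleftrightarrow>
     (\<forall>z\<in>\<Omega>. \<exists>a b. (f has_derivative (\<lambda>(v, w). a * v + b * w)) (at z))"

definition bergman_space ::
    "(complex \<times> complex) set \<Rightarrow> (complex \<times> complex \<Rightarrow> real) \<Rightarrow> (complex \<times> complex \<Rightarrow> complex) set" where
  "bergman_space \<Omega> \<mu> = {f \<in> Lp_space 2 (weighted_measure \<Omega> \<mu>). holomorphic2_on f \<Omega>}"

text \<open>The element \<open>g\<close> of \<open>V\<close> with \<open>f - g\<close> orthogonal to \<open>V\<close>. As functions are not identified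
  modulo null sets, \<open>g\<close> is determined only almost everywhere.\<close>

definition orthogonal_projection ::
    "'a measure \<Rightarrow> ('a \<Rightarrow> complex) set \<Rightarrow> ('a \<Rightarrow> complex) \<Rightarrow> ('a \<Rightarrow> complex)" where
  "orthogonal_projection M V f =
     (SOME g. g \<in> V \<and> (\<forall>h\<in>V. L2_inner M (\<lambda>z. f z - g z) h = 0))"

definition bergman_projection ::
    "(complex \<times> complex) set \<Rightarrow> (complex \<times> complex \<Rightarrow> real)
      \<Rightarrow> (complex \<times> complex \<Rightarrow> complex) \<Rightarrow> (complex \<times> complex \<Rightarrow> complex)" where
  "bergman_projection \<Omega> \<mu> =
     orthogonal_projection (weighted_measure \<Omega> \<mu>) (bergman_space \<Omega> \<mu>)"

definition Lp_bounded ::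
    "real \<Rightarrow> 'a measure \<Rightarrow> (('a \<Rightarrow> complex) \<Rightarrow> ('a \<Rightarrow> complex)) \<Rightarrow> bool" where
  "Lp_bounded p M T \<longleftrightarrow>
     (\<exists>C::real. \<forall>f \<in> Lp_space p M \<inter> Lp_space 2 M.
        T f \<in> Lp_space p M \<and> Lp_norm p M (T f) \<le> C * Lp_norm p M f)"

definition hartogs_weight :: "real \<Rightarrow> complex \<times> complex \<Rightarrow> real" where
  "hartogs_weight s' = (\<lambda>(z1, z2). norm z2 powr s')"

definition hartogs_projection_bounded :: "real \<Rightarrow> real \<Rightarrow> bool" where
  "hartogs_projection_bounded s' p \<longleftrightarrow>
     Lp_bounded p (weighted_measure hartogs_triangle (hartogs_weight s'))
       (bergman_projection hartogs_triangle (hartogs_weight s'))"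

end

theory Submission
  imports Defs "HOL-Complex_Analysis.Complex_Analysis"
begin

text \<open>
  With \<open>n = k + 2\<close>, the map \<open>(u, w) \<mapsto> (u w, w)\<close> carries the measure
  \<open>|w|\<^sup>2\<^sup>n |w|\<^sup>s\<^sup>-\<^sup>2 dV\<close> on (disc) \<open>\<times>\<close> (punctured disc) to \<open>|z\<^sub>2|\<^sup>s\<^sup>' dV\<close> on the Hartogs triangle, and
  \<open>h \<mapsto> h(u w, w) w\<^sup>n\<close> maps the Bergman space into the functions that are square integrable for
  \<open>|w|\<^sup>s\<^sup>-\<^sup>2 dV\<close>; as \<open>s \<le> 2\<close> these extend holomorphically across \<open>w = 0\<close>. The Bergman kernel is therefore
  \<open>z\<^sub>2\<close>, \<open>\<zeta>\<^sub>2\<close> to the power \<open>-n\<close> (the latter conjugated) times the product of two explicit kernels of the disc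
  with the radial weights \<open>1\<close> and \<open>|w|\<^sup>s\<^sup>-\<^sup>2\<close>. Each of them is bounded by a multiple of \<open>|1 - x|\<^sup>-\<^sup>2\<close>.

  Put \<open>e(z) = z\<^sub>2\<close> to the power \<open>-n\<close>. Schur's test with weights
  \<open>|z\<^sub>2|\<^sup>-\<^sup>a ((1 - |z\<^sub>1/z\<^sub>2|\<^sup>2) (1 - |z\<^sub>2|\<^sup>2))\<^sup>-\<^sup>b\<close> gives boundedness as soon as \<open>e\<close> lies in \<open>L\<^sup>p\<close> and in
  the dual space, that is, \<open>p n < s + 2 n < p (n + s)\<close>. Conversely the projection maps
  \<open>e(z) |z\<^sub>2|\<^sup>-\<^sup>s 1{|z\<^sub>2| > \<epsilon>}\<close> to a multiple of \<open>e\<close> that is unbounded as \<open>\<epsilon> \<rightarrow> 0\<close>, which violates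
  boundedness if either inequality fails.
\<close>

section \<open>Lebesgue measure on the complex plane\<close>

text \<open>Two points shape the proof. The Bergman projection is specified by choice, so nothing is
  known about its values until some function meets the specification. The integral of
  \<open>f\<close> against the explicit kernel does: the case p = 2 of the Schur test, where both
  inequalities reduce to 0 < s, puts it into the Bergman space, and the reproducing property with
  Fubini's theorem gives orthogonality. Projection and integral operator then agree almost
  everywhere, which is enough for norms.

  In the test functions, |z_2|^-s is borderline: against |w|^(s-2) dV its integral diverges
  logarithmically. If p (n + s) \<le> s + 2 n, the p-th power of the norm of the test function grows
  at most linearly in the multiple of \<open>e\<close> that it produces, and this contradicts
  boundedness for p > 1 only. For p = 1 and n > 0 the test functions stay bounded in L^1. The
  remaining case p = 1 with n \<le> 0 < s + n is left open by the argument; it lies in the range of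
  s' where the theorem speaks of p > 1 only.\<close>

lemma borel_measurable_cnj [measurable (raw)]:
  "f \<in> borel_measurable M \<Longrightarrow> (\<lambda>x. cnj (f x)) \<in> borel_measurable M"
  by (rule borel_measurable_continuous_on[OF continuous_on_cnj[OF continuous_on_id]])

text \<open>Both sides agree on open boxes, which determines Lebesgue measure. This opens the plane
  to Fubini's theorem in real and imaginary parts.\<close>

lemma lborel_complex_eq_distr:
  "(lborel :: complex measure) = distr (lborel \<Otimes>\<^sub>M lborel) borel (\<lambda>(x, y). Complex x y)"
proof (rule lborel_eqI)
  have meas: "(\<lambda>(x, y). Complex x y) \<in> borel_measurable (lborel \<Otimes>\<^sub>M lborel)"
    unfolding Complex_eq split_def by measurable
  fix l u :: complex
  assume lu: "\<And>b. b \<in> Basis \<Longrightarrow> l \<bullet> b \<le> u \<bullet> b"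
  have le: "Re l \<le> Re u" "Im l \<le> Im u"
    using lu[of 1] lu[of \<i>] by (auto simp: Basis_complex_def)
  have vim: "(\<lambda>(x, y). Complex x y) -` box l u = {Re l<..<Re u} \<times> {Im l<..<Im u}"
    by (auto simp: box_def Basis_complex_def)
  show "emeasure (distr (lborel \<Otimes>\<^sub>M lborel) borel (\<lambda>(x, y). Complex x y)) (box l u)
      = (\<Prod>b\<in>Basis. (u - l) \<bullet> b)"
    using le
    by (subst emeasure_distr[OF meas])
       (auto simp: vim space_pair_measure lborel.emeasure_pair_measure_Times Basis_complex_def
          ennreal_mult)
qed simp

lemma nn_integral_lborel_complex:
  assumes [measurable]: "F \<in> borel_measurable borel"
  shows "(\<integral>\<^sup>+z. F z \<partial>(lborel :: complex measure)) = (\<integral>\<^sup>+y. \<integral>\<^sup>+x. F (Complex x y) \<partial>lborel \<partial>lborel)"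
    "(\<integral>\<^sup>+z. F z \<partial>(lborel :: complex measure)) = (\<integral>\<^sup>+x. \<integral>\<^sup>+y. F (Complex x y) \<partial>lborel \<partial>lborel)"
proof -
  have meas [measurable]: "(\<lambda>(x, y). Complex x y) \<in> borel_measurable (lborel \<Otimes>\<^sub>M lborel)"
    unfolding Complex_eq split_def by measurable
  have "(\<integral>\<^sup>+z. F z \<partial>(lborel :: complex measure))
      = (\<integral>\<^sup>+p. F (case p of (x, y) \<Rightarrow> Complex x y) \<partial>(lborel \<Otimes>\<^sub>M lborel))"
    by (subst lborel_complex_eq_distr, subst nn_integral_distr[OF meas]) auto
  also have "\<dots> = (\<integral>\<^sup>+p. (\<lambda>(x, y). F (Complex x y)) p \<partial>(lborel \<Otimes>\<^sub>M lborel))"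
    by (simp add: split_def)
  finally have *: "(\<integral>\<^sup>+z. F z \<partial>(lborel :: complex measure))
      = (\<integral>\<^sup>+p. (\<lambda>(x, y). F (Complex x y)) p \<partial>(lborel \<Otimes>\<^sub>M lborel))" .
  have m2: "(\<lambda>(x, y). F (Complex x y)) \<in> borel_measurable (lborel \<Otimes>\<^sub>M lborel)"
    using measurable_compose[OF meas assms] by (simp add: split_def)
  show "(\<integral>\<^sup>+z. F z \<partial>(lborel :: complex measure)) = (\<integral>\<^sup>+y. \<integral>\<^sup>+x. F (Complex x y) \<partial>lborel \<partial>lborel)"
    unfolding * using lborel_pair.nn_integral_snd[OF m2] by simp
  show "(\<integral>\<^sup>+z. F z \<partial>(lborel :: complex measure)) = (\<integral>\<^sup>+x. \<integral>\<^sup>+y. F (Complex x y) \<partial>lborel \<partial>lborel)"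
    unfolding * using lborel.nn_integral_fst[OF m2] by simp
qed

text \<open>Multiplication by \<open>w\<close> with \<open>Re w \<noteq> 0\<close> is a lower times an upper triangular real matrix;
  any other \<open>w \<noteq> 0\<close> is a product of two such numbers.\<close>

lemma nn_integral_lborel_cmult:
  fixes w :: complex
  assumes F: "F \<in> borel_measurable borel" and "w \<noteq> 0"
  shows "(\<integral>\<^sup>+z. F z \<partial>lborel) = ennreal ((norm w)\<^sup>2) * (\<integral>\<^sup>+z. F (w * z) \<partial>lborel)"
proof -
  have main: "(\<integral>\<^sup>+z. F z \<partial>lborel) = ennreal ((norm w)\<^sup>2) * (\<integral>\<^sup>+z. F (w * z) \<partial>lborel)"
    if "Re w \<noteq> 0" and F[measurable]: "F \<in> borel_measurable borel" for w and F :: "complex \<Rightarrow> ennreal"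
  proof -
    \<comment> \<open>With \<open>X = a * x - b * y\<close>, the imaginary part
      \<open>b * x + a * y\<close> of the product is \<open>d * y + b / a * X\<close>. So
      multiplication by \<open>w\<close> is \<open>(x, y) \<mapsto> (X, d * y)\<close>, of
      determinant \<open>a * d\<close>, followed by a shear.\<close>
    define a b d where "a = Re w" and "b = Im w" and "d = a + b * b / a"
    have a: "a \<noteq> 0" using that by (simp add: a_def)
    have ad: "a * d = (norm w)\<^sup>2"
      using a by (simp add: d_def cmod_power2 flip: a_def b_def) (simp add: field_simps power2_eq_square)
    then have d: "d \<noteq> 0" using a that(1) by (auto simp: a_def)
    define Q where "Q = (\<lambda>x y. F (Complex x (y + b / a * x)))"
    have Qm[measurable]: "(\<lambda>x. Q x y) \<in> borel_measurable borel"
       "Q x \<in> borel_measurable borel" "case_prod Q \<in> borel_measurable (borel \<Otimes>\<^sub>M borel)" for x y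
      unfolding Q_def Complex_eq split_def by measurable
    have Q: "F (w * Complex x y) = Q (a * x - b * y) (d * y)" for x y
      using a by (auto simp: Q_def a_def b_def d_def field_simps complex_eq_iff intro!: arg_cong[where f=F])
    have "(\<integral>\<^sup>+z. F (w * z) \<partial>lborel) = (\<integral>\<^sup>+y. \<integral>\<^sup>+x. Q (a * x - b * y) (d * y) \<partial>lborel \<partial>lborel)"
      by (subst nn_integral_lborel_complex(1)) (simp_all add: Q)
    also have "ennreal (\<bar>a\<bar>) * \<dots> = (\<integral>\<^sup>+y. ennreal \<bar>a\<bar> * (\<integral>\<^sup>+x. Q (- b * y + a * x) (d * y) \<partial>lborel) \<partial>lborel)"
      by (subst nn_integral_cmult) (auto simp: algebra_simps)
    also have "\<dots> = (\<integral>\<^sup>+y. (\<integral>\<^sup>+x. Q x (d * y) \<partial>lborel) \<partial>lborel)"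
      by (intro nn_integral_cong nn_integral_real_affine[OF _ a, symmetric]) simp
    also have "ennreal \<bar>d\<bar> * \<dots> = (\<integral>\<^sup>+y. (\<integral>\<^sup>+x. Q x y \<partial>lborel) \<partial>lborel)"
      using nn_integral_real_affine[of "\<lambda>y. \<integral>\<^sup>+x. Q x y \<partial>lborel" d 0] d by simp
    also have "\<dots> = (\<integral>\<^sup>+x. (\<integral>\<^sup>+y. Q x y \<partial>lborel) \<partial>lborel)"
      by (rule lborel_pair.Fubini') simp
    also have "\<dots> = (\<integral>\<^sup>+x. (\<integral>\<^sup>+y. F (Complex x y) \<partial>lborel) \<partial>lborel)"
    proof (rule nn_integral_cong)
      fix x
      have [measurable]: "(\<lambda>y. F (Complex x y)) \<in> borel_measurable borel"
        unfolding Complex_eq by measurable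
      show "(\<integral>\<^sup>+y. Q x y \<partial>lborel) = (\<integral>\<^sup>+y. F (Complex x y) \<partial>lborel)"
        using nn_integral_real_affine[of "\<lambda>y. F (Complex x y)" 1 "b / a * x"]
        by (simp add: Q_def add.commute)
    qed
    also have "\<dots> = (\<integral>\<^sup>+z. F z \<partial>lborel)"
      by (rule nn_integral_lborel_complex(2)[symmetric]) simp
    finally have "(\<integral>\<^sup>+z. F z \<partial>lborel) = ennreal (\<bar>d\<bar>) * (ennreal (\<bar>a\<bar>) * (\<integral>\<^sup>+z. F (w * z) \<partial>lborel))"
      by simp
    also have "\<dots> = ennreal (\<bar>d\<bar> * \<bar>a\<bar>) * (\<integral>\<^sup>+z. F (w * z) \<partial>lborel)"
      by (simp add: ennreal_mult mult.assoc)
    also have "\<bar>d\<bar> * \<bar>a\<bar> = (norm w)\<^sup>2"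
      using arg_cong[OF ad, of abs] by (simp add: abs_mult mult.commute)
    finally show ?thesis .
  qed
  show ?thesis
  proof (cases "Re w = 0")
    case True
    define v where "v = w * (1 - \<i>) / 2"
    have vw: "v * (1 + \<i>) = w" by (simp add: v_def complex_eq_iff)
    have "Re v \<noteq> 0" using True \<open>w \<noteq> 0\<close> by (auto simp: v_def complex_eq_iff)
    then have "(\<integral>\<^sup>+z. F z \<partial>lborel) = ennreal ((norm v)\<^sup>2) * (\<integral>\<^sup>+z. F (v * z) \<partial>lborel)"
      by (rule main) fact
    also have "(\<integral>\<^sup>+z. F (v * z) \<partial>lborel) = ennreal ((norm (1 + \<i>))\<^sup>2) * (\<integral>\<^sup>+z. F (v * ((1 + \<i>) * z)) \<partial>lborel)"
    proof (rule main)
      note F[measurable]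
      show "(\<lambda>z. F (v * z)) \<in> borel_measurable borel" by measurable
    qed simp
    also have "(\<lambda>z. v * ((1 + \<i>) * z)) = (\<lambda>z. w * z)"
      by (simp add: vw mult.assoc[symmetric])
    finally show ?thesis
      by (simp add: mult.assoc[symmetric] ennreal_mult'[symmetric] power_mult_distrib[symmetric]
          norm_mult[symmetric] vw)
  next
    case False
    then show ?thesis by (rule main) fact
  qed
qed

lemma power2_powr:
  fixes r :: real
  assumes "r \<ge> 0"
  shows "(r\<^sup>2) powr x = r powr (2 * x)"
  using assms powr_powr[of r 2 x] by (cases "r = 0") auto

lemma emeasure_ball_complex:
  "r \<ge> 0 \<Longrightarrow> emeasure lborel (ball (c::complex) r) = ennreal (pi * r\<^sup>2)"
  by (simp add: emeasure_ball unit_ball_vol_2)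

text \<open>The area of a disc is linear in its squared radius, so squaring the modulus carries area
  on the punctured disc to \<open>pi\<close> times length on the unit interval. Comparing the two
  measures on half lines makes this rigorous and takes the place of polar coordinates.\<close>

lemma nn_integral_radial:
  fixes \<phi> :: "real \<Rightarrow> ennreal"
  assumes [measurable]: "\<phi> \<in> borel_measurable borel"
  shows "(\<integral>\<^sup>+z. \<phi> ((norm z)\<^sup>2) * indicator {z::complex. 0 < norm z \<and> norm z < 1} z \<partial>lborel)
    = ennreal pi * (\<integral>\<^sup>+t. \<phi> t * indicator {0<..<1} t \<partial>lborel)"
proof -
  define A where "A = {z::complex. 0 < norm z \<and> norm z < 1}"
  have A[measurable]: "A \<in> sets borel" unfolding A_def by measurable
  define M where "M = distr (density lborel (indicator A)) borel (\<lambda>z::complex. (norm z)\<^sup>2)"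
  define N where "N = density lborel (\<lambda>t::real. ennreal pi * indicator {0<..<1} t)"
  have em: "emeasure M {x<..} = ennreal (if x < 0 then pi else if x < 1 then pi * (1 - x) else 0)" for x
  proof -
    have "emeasure M {x<..} = emeasure lborel (A \<inter> {z. x < (norm z)\<^sup>2})"
      unfolding M_def by (subst emeasure_distr; (subst emeasure_density)?)
        (auto simp: indicator_inter_arith[symmetric] vimage_def intro!: arg_cong[where f="emeasure lborel"])
    also have "\<dots> = ennreal (if x < 0 then pi else if x < 1 then pi * (1 - x) else 0)"
    proof -
      consider "x < 0" | "0 \<le> x" "x < 1" | "x \<ge> 1" by linarith
      then show ?thesis
      proof cases
        case 1
        have "A \<inter> {z. x < (norm z)\<^sup>2} = ball 0 1 - {0}"
          using 1 by (auto simp: A_def intro: less_le_trans)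
        then show ?thesis using 1 emeasure_ball_complex[of 1 0]
          by (simp add: emeasure_Diff)
      next
        case 2
        have "A \<inter> {z. x < (norm z)\<^sup>2} = ball 0 1 - cball 0 (sqrt x)"
        proof -
          have "x < (norm z)\<^sup>2 \<longleftrightarrow> sqrt x < norm z" for z :: complex
            using real_sqrt_less_iff[of x "(norm z)\<^sup>2"] by simp
          moreover have "sqrt x < norm z \<Longrightarrow> 0 < norm z" for z :: complex
            using 2 le_less_trans[of 0 "sqrt x" "norm z"] by simp
          ultimately show ?thesis using 2 unfolding A_def by (auto simp: not_le)
        qed
        moreover have "emeasure lborel (cball (0::complex) (sqrt x)) = ennreal (pi * x)"
          using 2 by (simp add: emeasure_cball unit_ball_vol_2)
        moreover have "cball (0::complex) (sqrt x) \<subseteq> ball 0 1"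
        proof -
          have "sqrt x < 1" using 2 by simp
          then show ?thesis using le_less_trans[of "norm _" "sqrt x" 1] by auto
        qed
        ultimately have "emeasure lborel (A \<inter> {z. x < (norm z)\<^sup>2}) = ennreal pi - ennreal (pi * x)"
          using emeasure_ball_complex[of 1 0] by (simp add: emeasure_Diff)
        also have "\<dots> = ennreal (pi * (1 - x))"
          using 2 by (simp add: ennreal_minus right_diff_distrib)
        finally show ?thesis using 2 by simp
      next
        case 3
        have "(norm z)\<^sup>2 \<le> x" if "norm z < 1" for z :: complex
          using 3 that power_le_one[of "norm z" 2] by simp
        then have "A \<inter> {z. x < (norm z)\<^sup>2} = {}"
          unfolding A_def using leD by blast
        then show ?thesis using 3 by simp
      qed
    qed
    finally show ?thesis .
  qed
  have "M = N"
  proof (rule measure_eqI_lessThan)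
    fix x :: real
    have "emeasure N {x<..} = ennreal pi * emeasure lborel ({0<..<1} \<inter> {x<..})"
      unfolding N_def by (subst emeasure_density)
        (auto simp: mult.assoc nn_integral_cmult indicator_inter_arith[symmetric])
    also have "{0<..<1} \<inter> {x<..} = {max 0 x<..<1}" by auto
    also have "ennreal pi * emeasure lborel {max 0 x<..<1} = ennreal (if x < 0 then pi else if x < 1 then pi * (1 - x) else 0)"
    proof (cases "x < 1")
      case True
      then have "emeasure lborel {max 0 x<..<1} = ennreal (1 - max 0 x)"
        by (subst emeasure_lborel_Ioo) auto
      then show ?thesis using True by (auto simp: ennreal_mult max_def)
    next
      case False
      then have "{max 0 x<..<1} = {}" by auto
      then show ?thesis using False by simp
    qed
    finally show "emeasure M {x<..} = emeasure N {x<..}" using em by simp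
  qed (simp_all add: em, simp_all add: M_def N_def)
  have "(\<integral>\<^sup>+z. \<phi> ((norm z)\<^sup>2) * indicator A z \<partial>lborel) = (\<integral>\<^sup>+t. \<phi> t \<partial>M)"
    unfolding M_def by (subst nn_integral_distr; (subst nn_integral_density)?) (auto simp: mult.commute)
  also have "\<dots> = (\<integral>\<^sup>+t. ennreal pi * (\<phi> t * indicator {0<..<1} t) \<partial>lborel)"
    unfolding \<open>M = N\<close> N_def by (subst nn_integral_density) (auto simp: mult_ac)
  finally show ?thesis unfolding A_def by (simp add: nn_integral_cmult)
qed

section \<open>Radial measures on the disc\<close>

text \<open>The disc is encoded in the density and not in the space, so integrands are Borel
  functions on the whole plane and need no restriction. For \<open>s = 2\<close> this is area on the
  punctured disc; the total mass is finite for \<open>s > 0\<close>.\<close>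

definition disc_measure :: "real \<Rightarrow> complex measure" where
  "disc_measure s = density lborel
     (\<lambda>z. ennreal (norm z powr (s - 2)) * indicator {z. 0 < norm z \<and> norm z < 1} z)"

lemma sets_disc_measure [simp, measurable_cong]: "sets (disc_measure s) = sets borel"
  and space_disc_measure [simp]: "space (disc_measure s) = UNIV"
  by (auto simp: disc_measure_def)

lemma nn_integral_disc_measure:
  assumes [measurable]: "F \<in> borel_measurable borel"
  shows "(\<integral>\<^sup>+z. F z \<partial>disc_measure s)
    = (\<integral>\<^sup>+z. F z * ennreal (norm z powr (s - 2)) * indicator {z. 0 < norm z \<and> norm z < 1} z \<partial>lborel)"
  unfolding disc_measure_def by (subst nn_integral_density) (auto simp: mult_ac)

lemma AE_disc_measure: "AE z in disc_measure s. 0 < norm z \<and> norm z < 1"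
  unfolding disc_measure_def by (subst AE_density) (auto simp: indicator_def)

lemma nn_integral_disc_measure_radial:
  fixes \<phi> :: "real \<Rightarrow> ennreal"
  assumes [measurable]: "\<phi> \<in> borel_measurable borel"
  shows "(\<integral>\<^sup>+z. \<phi> ((norm z)\<^sup>2) \<partial>disc_measure s)
    = ennreal pi * (\<integral>\<^sup>+t. \<phi> t * ennreal (t powr (s / 2 - 1)) * indicator {0<..<1} t \<partial>lborel)"
proof -
  have eq: "norm z powr (s - 2) = (norm z)\<^sup>2 powr (s / 2 - 1)" for z :: complex
    by (simp add: power2_powr algebra_simps)
  show ?thesis
    using nn_integral_radial[of "\<lambda>t. \<phi> t * ennreal (t powr (s / 2 - 1))"]
    by (simp add: nn_integral_disc_measure eq)
qed

lemma nn_integral_powr_unit_interval: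
  assumes "a > -1"
  shows "(\<integral>\<^sup>+t. ennreal (t powr a) * indicator {0<..<1} t \<partial>lborel) = ennreal (1 / (a + 1))"
proof -
  have "(\<integral>\<^sup>+t. ennreal (t powr a) * indicator {0<..<1} t \<partial>lborel)
      = (\<integral>\<^sup>+t. ennreal (t powr a) * indicator {0..1} t \<partial>lborel)"
    using AE_lborel_singleton[of 0] AE_lborel_singleton[of 1]
    by (intro nn_integral_cong_AE) (auto simp: indicator_def elim: eventually_mono)
  also have "\<dots> = ennreal (1 / (a + 1))"
    using nn_integral_has_integral_lebesgue'[OF _ has_integral_powr_from_0[OF assms, of 1]] by simp
  finally show ?thesis .
qed

lemma nn_integral_inverse_unit_interval:
  "(\<integral>\<^sup>+t. ennreal (inverse t) * indicator {0<..<1} t \<partial>lborel) = \<infinity>"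
proof (rule ccontr)
  assume "\<not> ?thesis"
  then obtain B where B: "(\<integral>\<^sup>+t. ennreal (inverse t) * indicator {0<..<1} t \<partial>lborel) = ennreal B" "B \<ge> 0"
    by (metis ennreal_cases infinity_ennreal_def)
  \<comment> \<open>The integral over \<open>{e..1}\<close> alone is \<open>- ln e\<close>, which
    this choice makes equal to \<open>B + 1\<close>.\<close>
  define e where "e = exp (- (B + 1))"
  have e: "0 < e" "e < 1" using B by (auto simp: e_def)
  have "((\<lambda>t. inverse t) has_integral (ln 1 - ln e)) {e..1}"
    using e by (intro fundamental_theorem_of_calculus)
      (auto intro!: derivative_eq_intros simp: has_real_derivative_iff_has_vector_derivative[symmetric] divide_inverse)
  then have "(\<integral>\<^sup>+t. ennreal (inverse t) * indicator {e..1} t \<partial>lborel) = ennreal (ln 1 - ln e)"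
    using e by (intro nn_integral_has_integral_lebesgue') auto
  also have "ln 1 - ln e = B + 1" by (simp add: e_def)
  finally have "ennreal (B + 1) = (\<integral>\<^sup>+t. ennreal (inverse t) * indicator {e..1} t \<partial>lborel)" by simp
  also have "\<dots> \<le> (\<integral>\<^sup>+t. ennreal (inverse t) * indicator {0<..<1} t \<partial>lborel)"
    using AE_lborel_singleton[of 1] e
    by (intro nn_integral_mono_AE) (auto simp: indicator_def elim!: eventually_mono)
  finally show False using B by simp
qed

text \<open>The source of every threshold for p: in the variable \<open>t = (norm z)\<^sup>2\<close>
  the integrand becomes \<open>t powr ((c + s) / 2 - 1)\<close>, which is integrable near 0 for
  \<open>c + s > 0\<close> and otherwise dominates \<open>1 / t\<close>.\<close>

lemma disc_measure_moment:
  "(\<integral>\<^sup>+z. ennreal (norm z powr c) \<partial>disc_measure s)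
     = (if 0 < c + s then ennreal (2 * pi / (c + s)) else \<infinity>)"
proof -
  have eq: "norm z powr c = (norm z)\<^sup>2 powr (c / 2)" for z :: complex
    by (simp add: power2_powr)
  have *: "(\<integral>\<^sup>+z. ennreal (norm z powr c) \<partial>disc_measure s)
      = ennreal pi * (\<integral>\<^sup>+t. ennreal (t powr ((c + s) / 2 - 1)) * indicator {0<..<1} t \<partial>lborel)"
    unfolding eq
    by (subst nn_integral_disc_measure_radial)
       (auto simp: ennreal_mult[symmetric] powr_add[symmetric] add_divide_distrib algebra_simps
          intro!: arg_cong[where f="\<lambda>x. ennreal pi * x"] nn_integral_cong)
  show ?thesis
  proof (cases "0 < c + s")
    case True
    then show ?thesis unfolding *
      by (subst nn_integral_powr_unit_interval) (auto simp: ennreal_mult'[symmetric] field_simps)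
  next
    case False
    have "(\<integral>\<^sup>+t. ennreal (inverse t) * indicator {0<..<1} t \<partial>lborel)
        \<le> (\<integral>\<^sup>+t. ennreal (t powr ((c + s) / 2 - 1)) * indicator {0<..<1} t \<partial>lborel)"
    proof (rule nn_integral_mono)
      fix t :: real
      show "ennreal (inverse t) * indicator {0<..<1} t \<le> ennreal (t powr ((c + s) / 2 - 1)) * indicator {0<..<1} t"
        using False powr_mono'[of "(c + s) / 2 - 1" "-1" t]
        by (auto simp: indicator_def powr_minus intro!: ennreal_leI)
    qed
    then show ?thesis using False unfolding *
      by (simp add: nn_integral_inverse_unit_interval top.extremum_unique ennreal_mult_top)
  qed
qed

lemma finite_disc_measure: "0 < s \<Longrightarrow> finite_measure (disc_measure s)"
proof (rule finite_measureI)
  assume "0 < s"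
  have "emeasure (disc_measure s) (space (disc_measure s)) = (\<integral>\<^sup>+z. 1 \<partial>disc_measure s)" by simp
  \<comment> \<open>Equality holds only almost everywhere because \<open>0 powr 0\<close> is
    0.\<close>
  also have "\<dots> = (\<integral>\<^sup>+z. ennreal (norm z powr 0) \<partial>disc_measure s)"
    using AE_disc_measure[of s] by (intro nn_integral_cong_AE) (auto elim!: eventually_mono)
  finally show "emeasure (disc_measure s) (space (disc_measure s)) \<noteq> \<infinity>"
    using \<open>0 < s\<close> by (simp only: disc_measure_moment) simp
qed

section \<open>Rotation invariance, orthogonality of monomials and termwise integration\<close>

lemma distr_disc_measure_rotation:
  assumes "norm c = 1"
  shows "distr (disc_measure s) borel ((*) c) = disc_measure s"
proof (rule measure_eqI)
  fix A :: "complex set"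
  assume "A \<in> sets (distr (disc_measure s) borel ((*) c))"
  then have A[measurable]: "A \<in> sets borel" by simp
  have c: "c \<noteq> 0" using assms by auto
  have "emeasure (disc_measure s) A = (\<integral>\<^sup>+z. indicator A z \<partial>disc_measure s)"
    by simp
  also have "\<dots> = (\<integral>\<^sup>+z. indicator A (c * z) \<partial>disc_measure s)"
  proof -
    let ?F = "\<lambda>z. indicator A z * ennreal (norm z powr (s - 2)) * indicator {z. 0 < norm z \<and> norm z < 1} z"
    have "(\<integral>\<^sup>+z. ?F z \<partial>lborel) = (\<integral>\<^sup>+z. ?F (c * z) \<partial>lborel)"
      using nn_integral_lborel_cmult[of ?F c] c assms by simp
    also have "\<dots> = (\<integral>\<^sup>+z. indicator A (c * z) * ennreal (norm z powr (s - 2)) * indicator {z. 0 < norm z \<and> norm z < 1} z \<partial>lborel)"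
      by (intro nn_integral_cong) (use c in \<open>auto simp: assms norm_mult indicator_def\<close>)
    finally show ?thesis
      by (subst (1 2) nn_integral_disc_measure) simp_all
  qed
  also have "\<dots> = (\<integral>\<^sup>+z. indicator A z \<partial>distr (disc_measure s) borel ((*) c))"
    by (subst nn_integral_distr) auto
  finally show "emeasure (distr (disc_measure s) borel ((*) c)) A = emeasure (disc_measure s) A"
    by simp
qed simp

lemma integral_disc_measure_rotation:
  fixes F :: "complex \<Rightarrow> complex"
  assumes [measurable]: "F \<in> borel_measurable borel" and "norm c = 1"
  shows "(LINT z|disc_measure s. F (c * z)) = (LINT z|disc_measure s. F z)"
  using integral_distr[of "(*) c" "disc_measure s" borel F] distr_disc_measure_rotation[OF assms(2)]
  by simp

text \<open>Rotating the variable by \<open>c\<close> multiplies the integral by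
  \<open>c ^ j * cnj c ^ m\<close> without changing its value, and some \<open>c\<close> makes this
  factor different from 1. The argument also covers a divergent integral, which is 0 by
  convention.\<close>

lemma integral_disc_measure_monomials:
  fixes \<psi> :: "real \<Rightarrow> complex"
  assumes [measurable]: "\<psi> \<in> borel_measurable borel" and "j \<noteq> m"
  shows "(LINT z|disc_measure s. \<psi> (norm z) * z ^ j * cnj z ^ m) = 0"
proof -
  define I where "I = (LINT z|disc_measure s. \<psi> (norm z) * z ^ j * cnj z ^ m)"
  \<comment> \<open>The rotation factor is \<open>cis ((j - m) * \<theta>)\<close>, and this angle
    has absolute value strictly between 0 and \<open>pi\<close>, so it is no multiple of
    \<open>2 * pi\<close>.\<close>
  define \<theta> where "\<theta> = pi / real (j + m + 1)"
  define c where "c = cis \<theta>"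
  have "I = (LINT z|disc_measure s. \<psi> (norm (c * z)) * (c * z) ^ j * cnj (c * z) ^ m)"
    unfolding I_def by (rule integral_disc_measure_rotation[symmetric]) (auto simp: c_def)
  also have "\<dots> = (LINT z|disc_measure s. (c ^ j * cnj c ^ m) * (\<psi> (norm z) * z ^ j * cnj z ^ m))"
    by (intro Bochner_Integration.integral_cong) (auto simp: c_def norm_mult power_mult_distrib mult_ac)
  also have "\<dots> = (c ^ j * cnj c ^ m) * I"
    unfolding I_def by simp
  finally have I: "I * (1 - c ^ j * cnj c ^ m) = 0" by (simp add: algebra_simps)
  have "c ^ j * cnj c ^ m \<noteq> 1"
  proof
    assume "c ^ j * cnj c ^ m = 1"
    then have "cis ((real j - real m) * \<theta>) = 1"
      using Complex.DeMoivre[of \<theta> j] Complex.DeMoivre[of "-\<theta>" m]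
      by (simp add: c_def cis_cnj cis_mult left_diff_distrib)
    then obtain k :: int where "(real j - real m) * \<theta> = of_int k * (2 * pi)"
      by (auto simp: cis_conv_exp exp_eq_1 mult_ac)
    then have "pi * (real j - real m) = pi * (real_of_int (2 * k) * real (j + m + 1))"
      by (simp add: \<theta>_def field_simps)
    then have "real_of_int (int j - int m) = real_of_int (2 * k * int (j + m + 1))"
      by simp
    then have k: "int j - int m = 2 * k * int (j + m + 1)"
      by (rule of_int_eq_iff[THEN iffD1])
    then have "k \<noteq> 0" using \<open>j \<noteq> m\<close> by auto
    then have "int (j + m + 1) \<le> \<bar>2 * k * int (j + m + 1)\<bar>"
      by (simp add: abs_mult mult_le_cancel_right1)
    with k show False by linarith
  qed
  with I show ?thesis unfolding I_def by simp
qed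

text \<open>The radius \<open>\<rho>\<close> serves two regimes. For the kernels,
  \<open>\<rho> = 1\<close> and \<open>norm w < 1\<close> ensures convergence. For the Taylor series
  of a holomorphic function, which may fail to converge absolutely up to the boundary,
  \<open>w = 1\<close> and the support of \<open>g\<close> lies in a smaller disc.\<close>

lemma integral_disc_measure_power_series:
  fixes g :: "complex \<Rightarrow> complex"
  assumes g: "integrable (disc_measure s) g" and supp: "AE z in disc_measure s. g z \<noteq> 0 \<longrightarrow> norm z \<le> \<rho>"
    and \<rho>: "0 \<le> \<rho>" and d: "summable (\<lambda>m. norm (d m) * (norm w * \<rho>) ^ m)"
  shows "(\<lambda>m. d m * w ^ m * (LINT z|disc_measure s. g z * cnj z ^ m)) sums
           (LINT z|disc_measure s. (\<Sum>m. d m * (w * cnj z) ^ m) * g z)"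
proof -
  define f where "f = (\<lambda>m z. d m * w ^ m * (g z * cnj z ^ m))"
  have [measurable]: "g \<in> borel_measurable borel"
    using borel_measurable_integrable[OF g] by (simp cong: measurable_cong_sets)
  have bd: "AE z in disc_measure s. norm (g z * cnj z ^ m) \<le> \<rho> ^ m * norm (g z)" for m
    using supp
  proof eventually_elim
    case (elim z)
    then show ?case
      by (cases "g z = 0") (auto simp: norm_mult norm_power mult.commute intro!: mult_right_mono power_mono)
  qed
  have int0: "integrable (disc_measure s) (\<lambda>z. g z * cnj z ^ m)" for m
    by (rule Bochner_Integration.integrable_bound[of _ "\<lambda>z. \<rho> ^ m * norm (g z)"]) (use g bd \<rho> in auto)
  then have int: "integrable (disc_measure s) (f m)" for m unfolding f_def by simp
  have f_le: "norm (f m z) \<le> norm (d m) * (norm w * \<rho>) ^ m * norm (g z)" if "g z \<noteq> 0 \<longrightarrow> norm z \<le> \<rho>" for m z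
  proof (cases "g z = 0")
    case False
    then have "norm z ^ m \<le> \<rho> ^ m" using that by (intro power_mono) auto
    then have "norm (d m) * norm w ^ m * norm (g z) * norm z ^ m \<le> norm (d m) * norm w ^ m * norm (g z) * \<rho> ^ m"
      by (intro mult_left_mono) auto
    then show ?thesis by (simp add: f_def norm_mult norm_power power_mult_distrib mult_ac)
  qed (simp add: f_def)
  have AEs: "AE z in disc_measure s. summable (\<lambda>m. norm (f m z))"
    using supp
  proof eventually_elim
    case (elim z)
    show ?case
      by (rule summable_comparison_test'[OF summable_mult2[OF d, of "norm (g z)"], of 0])
        (use f_le[OF elim] in simp)
  qed
  have sint: "summable (\<lambda>m. LINT z|disc_measure s. norm (f m z))"
  proof (rule summable_comparison_test'[OF summable_mult2[OF d, of "LINT z|disc_measure s. norm (g z)"], of 0])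
    fix m
    have "(LINT z|disc_measure s. norm (f m z)) \<le> (LINT z|disc_measure s. norm (d m) * (norm w * \<rho>) ^ m * norm (g z))"
      using supp by (intro integral_mono_AE integrable_norm int integrable_mult_right g)
        (auto elim!: eventually_mono intro: f_le)
    then show "norm (LINT z|disc_measure s. norm (f m z)) \<le> norm (d m) * (norm w * \<rho>) ^ m * (LINT z|disc_measure s. norm (g z))"
      by simp
  qed
  have "(\<lambda>m. integral\<^sup>L (disc_measure s) (f m)) sums (LINT z|disc_measure s. (\<Sum>m. f m z))"
    by (rule sums_integral[OF int AEs sint])
  also have "(LINT z|disc_measure s. (\<Sum>m. f m z)) = (LINT z|disc_measure s. (\<Sum>m. d m * (w * cnj z) ^ m) * g z)"
  proof (rule integral_cong_AE)
    show "AE z in disc_measure s. (\<Sum>m. f m z) = (\<Sum>m. d m * (w * cnj z) ^ m) * g z"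
      using supp
    proof eventually_elim
      case (elim z)
      show ?case
      proof (cases "g z = 0")
        case False
        then have "norm z \<le> \<rho>" using elim by auto
        then have "summable (\<lambda>m. norm (d m * (w * cnj z) ^ m))"
          by (intro summable_comparison_test'[OF d, of 0])
            (auto simp: norm_mult norm_power intro!: mult_left_mono power_mono)
        then have "summable (\<lambda>m. d m * (w * cnj z) ^ m)" by (rule summable_norm_cancel)
        then show ?thesis
          by (subst suminf_mult2) (auto simp: f_def power_mult_distrib mult_ac)
      qed (simp add: f_def)
    qed
  qed (auto simp: f_def)
  finally show ?thesis by (simp add: f_def)
qed

text \<open>Against a radial function every monomial but the constant one integrates to 0, so only
  the coefficient \<open>d 0\<close> survives.\<close>

lemma integral_disc_measure_mean_value:
  fixes \<psi> :: "real \<Rightarrow> complex"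
  assumes int: "integrable (disc_measure s) (\<lambda>z. \<psi> (norm z))" and [measurable]: "\<psi> \<in> borel_measurable borel"
    and d: "summable (\<lambda>m. norm (d m) * norm w ^ m)"
  shows "(LINT z|disc_measure s. (\<Sum>m. d m * (w * cnj z) ^ m) * \<psi> (norm z))
    = d 0 * (LINT z|disc_measure s. \<psi> (norm z))"
proof -
  have "(\<lambda>m. d m * w ^ m * (LINT z|disc_measure s. \<psi> (norm z) * cnj z ^ m)) sums
          (LINT z|disc_measure s. (\<Sum>m. d m * (w * cnj z) ^ m) * \<psi> (norm z))"
    by (rule integral_disc_measure_power_series[OF int, where \<rho>=1])
      (use d AE_disc_measure[of s] in \<open>auto elim: eventually_mono\<close>)
  moreover have "(\<lambda>m. d m * w ^ m * (LINT z|disc_measure s. \<psi> (norm z) * cnj z ^ m)) sums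
          (d 0 * w ^ 0 * (LINT z|disc_measure s. \<psi> (norm z) * cnj z ^ 0))"
    using integral_disc_measure_monomials[of \<psi> 0 _ s]
    using sums_finite[of "{0}" "\<lambda>m. d m * w ^ m * (LINT z|disc_measure s. \<psi> (norm z) * cnj z ^ m)"]
    by auto
  ultimately show ?thesis by (simp add: sums_iff)
qed

section \<open>Weighted Bergman kernels of the disc\<close>

text \<open>The Bergman kernel of the disc with weight \<open>norm z powr (s - 2)\<close>, as a
  function of the single variable \<open>x = w * cnj z\<close>. For \<open>s = 2\<close> it is the
  classical \<open>1 / (pi * (1 - x)\<^sup>2)\<close>.\<close>

definition disc_kernel :: "real \<Rightarrow> complex \<Rightarrow> complex" where
  "disc_kernel s x = (of_real s + of_real (2 - s) * x) / (of_real (2 * pi) * (1 - x)\<^sup>2)"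

text \<open>The reciprocal of the squared norm \<open>2 * pi / (2 * m + s)\<close> of the monomial
  of degree \<open>m\<close>.\<close>

definition disc_kernel_coeff :: "real \<Rightarrow> nat \<Rightarrow> complex" where
  "disc_kernel_coeff s m = of_real ((2 * real m + s) / (2 * pi))"

lemma borel_measurable_disc_kernel [measurable]: "disc_kernel s \<in> borel_measurable borel"
  unfolding disc_kernel_def by measurable

lemma disc_kernel_cnj: "disc_kernel s (cnj x) = cnj (disc_kernel s x)"
  by (simp add: disc_kernel_def)

lemma disc_kernel_sums:
  assumes "norm x < 1"
  shows "(\<lambda>m. disc_kernel_coeff s m * x ^ m) sums disc_kernel s x"
proof -
  have "x \<noteq> 1" using assms by auto
  \<comment> \<open>The coefficient is split as \<open>(m + 1) / pi + (s - 2) / (2 * pi)\<close>: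
    the differentiated geometric series plus a multiple of the geometric series.\<close>
  have "(\<lambda>m. (1 / of_real pi) * (of_nat (Suc m) * x ^ m) + of_real ((s - 2) / (2 * pi)) * x ^ m)
    sums ((1 / of_real pi) * (1 / (1 - x)\<^sup>2) + of_real ((s - 2) / (2 * pi)) * (1 / (1 - x)))"
    by (intro sums_add sums_mult geometric_deriv_sums geometric_sums assms)
  also have "(\<lambda>m. (1 / of_real pi) * (of_nat (Suc m) * x ^ m) + of_real ((s - 2) / (2 * pi)) * x ^ m)
    = (\<lambda>m. disc_kernel_coeff s m * x ^ m)"
    by (auto simp: disc_kernel_coeff_def fun_eq_iff field_simps)
  also have "(1 / of_real pi) * (1 / (1 - x)\<^sup>2) + of_real ((s - 2) / (2 * pi)) * (1 / (1 - x)) = disc_kernel s x"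
    using \<open>x \<noteq> 1\<close> by (simp add: disc_kernel_def power2_eq_square divide_simps) (simp add: algebra_simps)
  finally show ?thesis .
qed

lemma summable_disc_kernel_coeff:
  assumes "norm (x::complex) < 1" "0 < s"
  shows "summable (\<lambda>m. norm (disc_kernel_coeff s m) * norm x ^ m)"
proof -
  have "(\<lambda>m. disc_kernel_coeff s m * of_real (norm x) ^ m) sums disc_kernel s (of_real (norm x))"
    by (rule disc_kernel_sums) (use assms in simp)
  then have "summable (\<lambda>m. Re (disc_kernel_coeff s m * of_real (norm x) ^ m))"
    by (intro summable_Re sums_summable)
  moreover have "norm (disc_kernel_coeff s m) = (2 * real m + s) / (2 * pi)" for m
    using assms unfolding disc_kernel_coeff_def norm_of_real by simp
  ultimately show ?thesis unfolding disc_kernel_coeff_def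
    by (simp flip: of_real_power of_real_mult del: of_real_divide of_real_add)
qed

text \<open>For \<open>0 < s \<le> 2\<close> the two coefficients of the numerator are nonnegative
  and add up to 2.\<close>

lemma norm_disc_kernel_le:
  assumes "norm x \<le> 1" "0 < s" "s \<le> 2"
  shows "norm (disc_kernel s x) \<le> 1 / (pi * (norm (1 - x))\<^sup>2)"
proof -
  have "norm (of_real s + of_real (2 - s) * x) \<le> s + (2 - s) * norm x"
    using assms norm_triangle_ineq[of "of_real s" "of_real (2 - s) * x"] by (simp add: norm_mult del: of_real_diff)
  also have "\<dots> \<le> s + (2 - s) * 1" using assms by (intro add_left_mono mult_left_mono) auto
  finally have "norm (of_real s + of_real (2 - s) * x) \<le> 2" by simp
  then have "norm (of_real s + of_real (2 - s) * x) / (2 * pi * (norm (1 - x))\<^sup>2) \<le> 2 / (2 * pi * (norm (1 - x))\<^sup>2)"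
    by (intro divide_right_mono) auto
  then show ?thesis by (simp add: disc_kernel_def norm_divide norm_mult norm_power)
qed

text \<open>With \<open>x = w * cnj z\<close>, the Poisson kernel
  \<open>(1 - (norm x)\<^sup>2) / (norm (1 - x))\<^sup>2\<close> equals
  \<open>2 * Re (1 / (1 - x)) - 1\<close>. By the mean value lemma it averages to 1 against any
  radial function. This performs the angular integration of the kernel bound exactly and leaves a
  radial integral.\<close>

lemma integral_disc_measure_poisson:
  fixes \<psi> :: "real \<Rightarrow> real"
  assumes int: "integrable (disc_measure s) (\<lambda>z. \<psi> (norm z))" and [measurable]: "\<psi> \<in> borel_measurable borel"
    and w: "norm w < 1"
  shows "integrable (disc_measure s) (\<lambda>z. \<psi> (norm z) / (norm (1 - w * cnj z))\<^sup>2)"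
    and "(LINT z|disc_measure s. \<psi> (norm z) / (norm (1 - w * cnj z))\<^sup>2)
        = (LINT z|disc_measure s. \<psi> (norm z) / (1 - (norm w)\<^sup>2 * (norm z)\<^sup>2))"
proof -
  \<comment> \<open>The radial factor for which \<open>\<eta>\<close> times the Poisson kernel is
    the integrand in question.\<close>
  define \<eta> where "\<eta> = (\<lambda>r. \<psi> r / (1 - (norm w)\<^sup>2 * r\<^sup>2))"
  have [measurable]: "\<eta> \<in> borel_measurable borel" unfolding \<eta>_def by measurable
  have bd: "norm w ^ 2 * norm z ^ 2 \<le> norm w ^ 2" if "norm z < 1" for z :: complex
    using that by (intro mult_left_le power_le_one) auto
  have w2: "norm w ^ 2 < 1" using w by (simp add: power_less_one_iff)
  have \<eta>_int: "integrable (disc_measure s) (\<lambda>z. \<eta> (norm z))"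
  proof (rule Bochner_Integration.integrable_bound[where f="\<lambda>z. \<psi> (norm z) / (1 - (norm w)\<^sup>2)"])
    show "AE z in disc_measure s. norm (\<eta> (norm z)) \<le> norm (\<psi> (norm z) / (1 - (norm w)\<^sup>2))"
      using AE_disc_measure
    proof eventually_elim
      case (elim z)
      then show ?case unfolding \<eta>_def using bd[of z] w2
        by (auto simp: abs_divide intro!: divide_left_mono)
    qed
  qed (use int in auto)
  define q where "q = (\<lambda>z. \<eta> (norm z) * (2 * Re (1 / (1 - w * cnj z)) - 1))"
  have q: "q z = \<psi> (norm z) / (norm (1 - w * cnj z))\<^sup>2" if "norm z < 1" for z
  proof -
    define x where "x = w * cnj z"
    have nx: "(norm x)\<^sup>2 = (norm w)\<^sup>2 * (norm z)\<^sup>2" by (simp add: x_def norm_mult power_mult_distrib)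
    have x1: "(norm x)\<^sup>2 < 1" using nx bd[OF that] w2 by linarith
    have n1: "norm (1 - x) \<noteq> 0"
      using x1 by (metis abs_norm_cancel abs_square_less_1 eq_iff_diff_eq_0 norm_eq_zero norm_one order_less_irrefl)
    have ne: "(norm (1 - x))\<^sup>2 = 1 - 2 * Re x + (norm x)\<^sup>2"
      unfolding cmod_power2 by (simp add: power2_eq_square algebra_simps)
    have "Re (1 / (1 - x)) = (1 - Re x) / (norm (1 - x))\<^sup>2"
      by (simp add: Re_divide cmod_power2)
    then have "2 * Re (1 / (1 - x)) - 1 = (1 - (norm x)\<^sup>2) / (norm (1 - x))\<^sup>2"
      using n1 by (simp add: field_simps) (simp add: ne)
    then show ?thesis using x1 unfolding q_def \<eta>_def nx[symmetric] x_def[symmetric] by simp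
  qed
  have d: "summable (\<lambda>m. norm (1::complex) * norm w ^ m)" using w by (simp add: summable_geometric)
  have bdd: "norm (1 / (1 - w * cnj z)) \<le> 1 / (1 - norm w)" if "norm z < 1" for z
  proof -
    have "norm (w * cnj z) \<le> norm w" using that by (simp add: norm_mult mult_left_le)
    then have "1 - norm w \<le> norm (1 - w * cnj z)"
      using norm_triangle_ineq2[of 1 "w * cnj z"] by simp
    then show ?thesis using w by (simp add: norm_divide divide_left_mono frac_le)
  qed
  have F_int: "integrable (disc_measure s) (\<lambda>z. 1 / (1 - w * cnj z) * of_real (\<eta> (norm z)))"
  proof (rule Bochner_Integration.integrable_bound[where f="\<lambda>z. 1 / (1 - norm w) * \<eta> (norm z)"])
    show "AE z in disc_measure s. norm (1 / (1 - w * cnj z) * complex_of_real (\<eta> (norm z)))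
        \<le> norm (1 / (1 - norm w) * \<eta> (norm z))"
      using AE_disc_measure
    proof eventually_elim
      case (elim z)
      then show ?case using bdd[of z] w unfolding norm_mult
        by (intro mult_mono) auto
    qed
  qed (use \<eta>_int in auto)
  have "(LINT z|disc_measure s. 1 / (1 - w * cnj z) * of_real (\<eta> (norm z)))
     = (LINT z|disc_measure s. (\<Sum>m. 1 * (w * cnj z) ^ m) * of_real (\<eta> (norm z)))"
  proof (rule integral_cong_AE)
    show "AE z in disc_measure s. 1 / (1 - w * cnj z) * complex_of_real (\<eta> (norm z)) =
       (\<Sum>m. 1 * (w * cnj z) ^ m) * complex_of_real (\<eta> (norm z))"
      using AE_disc_measure
    proof eventually_elim
      case (elim z)
      have "norm (w * cnj z) \<le> norm w" using elim by (simp add: norm_mult mult_left_le)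
      then show ?case using w by (simp add: suminf_geometric)
    qed
  qed auto
  also have "\<dots> = 1 * (LINT z|disc_measure s. of_real (\<eta> (norm z)))"
    by (rule integral_disc_measure_mean_value[OF _ _ d]) (use \<eta>_int in auto)
  finally have E: "(LINT z|disc_measure s. 1 / (1 - w * cnj z) * of_real (\<eta> (norm z)))
     = of_real (LINT z|disc_measure s. \<eta> (norm z))" by simp
  have Re_int: "integrable (disc_measure s) (\<lambda>z. Re (1 / (1 - w * cnj z) * of_real (\<eta> (norm z))))"
    by (rule integrable_Re[OF F_int])
  have Re_times: "Re (v * of_real t) = Re v * t" for v t by simp
  have q2: "q = (\<lambda>z. 2 * Re (1 / (1 - w * cnj z) * of_real (\<eta> (norm z))) - \<eta> (norm z))"
    unfolding q_def fun_eq_iff Re_times by (simp add: right_diff_distrib)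
  have q_int: "integrable (disc_measure s) q"
    unfolding q2 by (intro Bochner_Integration.integrable_diff integrable_mult_right Re_int \<eta>_int)
  have "integral\<^sup>L (disc_measure s) q = 2 * Re (LINT z|disc_measure s. 1 / (1 - w * cnj z) * of_real (\<eta> (norm z)))
     - (LINT z|disc_measure s. \<eta> (norm z))"
    unfolding q2 by (subst Bochner_Integration.integral_diff) (use Re_int \<eta>_int F_int in \<open>auto simp del: Re_complex_div_gt_0 times_complex.sel\<close>)
  also have "\<dots> = (LINT z|disc_measure s. \<eta> (norm z))"
    unfolding E by simp
  finally have I: "integral\<^sup>L (disc_measure s) q = (LINT z|disc_measure s. \<eta> (norm z))" .
  have AEq: "AE z in disc_measure s. q z = \<psi> (norm z) / (norm (1 - w * cnj z))\<^sup>2"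
    using AE_disc_measure by eventually_elim (simp add: q)
  have [measurable]: "q \<in> borel_measurable borel" unfolding q_def by measurable
  show "integrable (disc_measure s) (\<lambda>z. \<psi> (norm z) / (norm (1 - w * cnj z))\<^sup>2)"
    using integrable_cong_AE[THEN iffD1, OF _ _ AEq q_int] by simp
  show "(LINT z|disc_measure s. \<psi> (norm z) / (norm (1 - w * cnj z))\<^sup>2)
        = (LINT z|disc_measure s. \<psi> (norm z) / (1 - (norm w)\<^sup>2 * (norm z)\<^sup>2))"
    using integral_cong_AE[OF _ _ AEq] I by (simp add: \<eta>_def)
qed

text \<open>A radial Forelli-Rudin estimate in \<open>t = (norm z)\<^sup>2\<close>. Away from the
  boundary circle only the singularity at \<open>t = 0\<close> matters, which
  \<open>0 < c + s\<close> controls. Near the circle the range is cut at distance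
  \<open>1 - r\<close>: \<open>b < 1\<close> makes the inner part integrable and
  \<open>0 < b\<close> the outer tail.\<close>

lemma disc_measure_radial_estimate:
  assumes b: "0 < b" "b < 1" and c: "0 < c + s"
  shows "\<exists>C>0. \<forall>r. 0 \<le> r \<longrightarrow> r < 1 \<longrightarrow>
    (\<integral>\<^sup>+z. ennreal (norm z powr c * (1 - (norm z)\<^sup>2) powr - b / (1 - r * (norm z)\<^sup>2)) \<partial>disc_measure s)
      \<le> ennreal (C * (1 - r) powr - b)"
proof -
  define a where "a = (c + s) / 2 - 1"
  have a: "a > -1" using c by (simp add: a_def)
  define A where "A = 2 powr \<bar>a\<bar>"
  \<comment> \<open>The three summands come from \<open>t < 1/2\<close>, from
    \<open>1 - t \<le> \<delta>\<close> and from \<open>1 - t \<ge> \<delta>\<close>. The constant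
    \<open>A\<close> bounds \<open>t powr a\<close> on \<open>t \<ge> 1/2\<close> for either sign of
    \<open>a\<close>.\<close>
  define C where "C = pi * (4 / (a + 1) + A * (2 / (1 - b) + 1 / b))"
  have A0: "A > 0" by (simp add: A_def)
  have C: "C > 0" using a b A0 by (simp add: C_def add_pos_pos)
  show ?thesis
  proof (intro exI[of _ C] conjI allI impI C)
    fix r :: real
    assume r: "0 \<le> r" "r < 1"
    define \<delta> where "\<delta> = 1 - r"
    have \<delta>: "0 < \<delta>" "\<delta> \<le> 1" using r by (auto simp: \<delta>_def)
    \<comment> \<open>A majorant in \<open>x = 1 - t\<close> for \<open>t \<ge> 1/2\<close>. Its
      pieces use \<open>1 - r * t \<ge> \<delta> * t \<ge> \<delta> / 2\<close> close to the circle
      and \<open>1 - r * t \<ge> 1 - t\<close> farther away. Letting the second piece run to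
      infinity keeps its integral explicit.\<close>
    define G where "G = (\<lambda>x. ennreal (2 * A / \<delta>) * (ennreal (x powr - b) * indicator {0..\<delta>} x)
        + ennreal A * (ennreal (x powr (- b - 1)) * indicator {\<delta>..} x))"
    have [measurable]: "G \<in> borel_measurable borel" unfolding G_def by measurable
    have pt: "ennreal (t powr (c/2) * (1 - t) powr - b / (1 - r * t)) * ennreal (t powr (s / 2 - 1)) * indicator {0<..<1} t
      \<le> ennreal 4 * (ennreal (t powr a) * indicator {0<..<1} t) + G (1 - t)" for t
    proof (cases "0 < t \<and> t < 1")
      case True
      have "a = c / 2 + (s / 2 - 1)" by (simp add: a_def field_simps)
      then have eq: "t powr (c/2) * t powr (s / 2 - 1) = t powr a"
        by (metis powr_add)
      then have eq2: "t powr (c/2) * (1 - t) powr - b / (1 - r * t) * t powr (s / 2 - 1)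
          = t powr a * ((1 - t) powr - b / (1 - r * t))"
        by (simp add: mult_ac)
      have "r * t \<le> t" using True r by (simp add: mult_left_le_one_le)
      then have rt1: "1 - t \<le> 1 - r * t" "1 - r * t > 0" using True by linarith+
      have lhs: "ennreal (t powr (c/2) * (1 - t) powr - b / (1 - r * t)) * ennreal (t powr (s / 2 - 1)) * indicator {0<..<1} t
          = ennreal (t powr a * ((1 - t) powr - b / (1 - r * t)))"
        unfolding eq2[symmetric] using True rt1 by (subst ennreal_mult) auto
      have tA: "t powr a \<le> A" if t2: "t \<ge> 1/2"
      proof (cases "a \<ge> 0")
        case True
        then have "t powr a \<le> 1 powr a" using \<open>0 < t \<and> t < 1\<close> by (intro powr_mono2) auto
        also have "\<dots> \<le> A" using True by (simp add: A_def ge_one_powr_ge_zero)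
        finally show ?thesis .
      next
        case False
        then have "t powr a \<le> (1/2) powr a" using t2 by (intro powr_mono2') auto
        also have "\<dots> = (2 powr -1) powr a" by (simp add: powr_minus)
        also have "\<dots> = 2 powr (-1 * a)" by (rule powr_powr)
        also have "\<dots> = A" using False by (simp add: A_def)
        finally show ?thesis .
      qed
      consider "t < 1/2" | "t \<ge> 1/2" "1 - t \<le> \<delta>" | "t \<ge> 1/2" "1 - t \<ge> \<delta>" by linarith
      then show ?thesis
      proof cases
        case 1
        have "(1 - t) powr - b \<le> (1/2) powr - b"
          by (rule powr_mono2') (use 1 b True in auto)
        also have "\<dots> \<le> (1/2) powr -1" by (rule powr_mono') (use b in auto)
        finally have x1: "(1 - t) powr - b \<le> 2" by (simp add: powr_minus)
        have "r * t \<le> 1/2" using 1 r True \<open>r * t \<le> t\<close> by linarith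
        then have "(1 - t) powr - b / (1 - r * t) \<le> 2 / (1/2)"
          using x1 by (intro frac_le) auto
        then have "t powr a * ((1 - t) powr - b / (1 - r * t)) \<le> t powr a * 4"
          by (intro mult_left_mono) auto
        then have "ennreal (t powr a * ((1 - t) powr - b / (1 - r * t))) \<le> ennreal 4 * ennreal (t powr a)"
          by (subst ennreal_mult[symmetric]) (auto simp: mult.commute intro!: ennreal_leI)
        also have "\<dots> \<le> ennreal 4 * (ennreal (t powr a) * indicator {0<..<1} t) + G (1 - t)"
          using True by simp
        finally show ?thesis unfolding lhs .
      next
        case 2
        note tA = tA[OF 2(1)]
        have "\<delta> / 2 \<le> \<delta> * t" using 2 \<delta> by (simp add: field_simps)
        then have "\<delta> / 2 \<le> 1 - r * t" using True by (simp add: \<delta>_def algebra_simps)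
        then have "(1 - t) powr - b / (1 - r * t) \<le> (1 - t) powr - b / (\<delta> / 2)"
          using \<delta> by (intro divide_left_mono) auto
        then have "t powr a * ((1 - t) powr - b / (1 - r * t)) \<le> A * ((1 - t) powr - b / (\<delta> / 2))"
          using tA A0 rt1 by (intro mult_mono) auto
        also have "\<dots> = 2 * A / \<delta> * (1 - t) powr - b" by simp
        finally have "ennreal (t powr a * ((1 - t) powr - b / (1 - r * t))) \<le> ennreal (2 * A / \<delta>) * ennreal ((1 - t) powr - b)"
          using A0 \<delta> by (subst ennreal_mult[symmetric]) (auto intro!: ennreal_leI)
        also have "\<dots> \<le> G (1 - t)" using True 2 by (simp add: G_def)
        also have "\<dots> \<le> ennreal 4 * (ennreal (t powr a) * indicator {0<..<1} t) + G (1 - t)"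
          by simp
        finally show ?thesis unfolding lhs .
      next
        case 3
        note tA = tA[OF 3(1)]
        have "(1 - t) powr - b / (1 - r * t) \<le> (1 - t) powr - b / (1 - t)"
          using True rt1 by (intro divide_left_mono) auto
        also have "\<dots> = (1 - t) powr (- b - 1)" using True by (simp add: powr_diff)
        finally have "t powr a * ((1 - t) powr - b / (1 - r * t)) \<le> A * (1 - t) powr (- b - 1)"
          using tA A0 rt1 by (intro mult_mono) auto
        then have "ennreal (t powr a * ((1 - t) powr - b / (1 - r * t))) \<le> ennreal A * ennreal ((1 - t) powr (- b - 1))"
          using A0 by (subst ennreal_mult[symmetric]) (auto intro!: ennreal_leI)
        also have "\<dots> \<le> G (1 - t)" using True 3 by (simp add: G_def)
        also have "\<dots> \<le> ennreal 4 * (ennreal (t powr a) * indicator {0<..<1} t) + G (1 - t)"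
          by simp
        finally show ?thesis unfolding lhs .
      qed
    qed auto
    have G_int: "(\<integral>\<^sup>+t. G t \<partial>lborel) = ennreal (A * (2 / (1 - b) + 1 / b) * \<delta> powr - b)"
    proof -
      have i1: "(\<integral>\<^sup>+x. ennreal (x powr - b) * indicator {0..\<delta>} x \<partial>lborel) = ennreal (\<delta> powr (- b + 1) / (- b + 1))"
        using b \<delta> by (intro nn_integral_has_integral_lebesgue' has_integral_powr_from_0) auto
      have i2: "(\<integral>\<^sup>+x. ennreal (x powr (- b - 1)) * indicator {\<delta>..} x \<partial>lborel) = ennreal (- (\<delta> powr (- b - 1 + 1)) / (- b - 1 + 1))"
        using b \<delta> by (intro nn_integral_has_integral_lebesgue' has_integral_powr_to_inf) auto
      have "(\<integral>\<^sup>+t. G t \<partial>lborel) = ennreal (2 * A / \<delta>) * ennreal (\<delta> powr (- b + 1) / (- b + 1))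
          + ennreal A * ennreal (- (\<delta> powr (- b - 1 + 1)) / (- b - 1 + 1))"
        unfolding G_def by (subst nn_integral_add; (subst nn_integral_cmult)?; (subst nn_integral_cmult)?) (auto simp: i1 i2)
      also have "\<dots> = ennreal (2 * A / \<delta> * (\<delta> powr (- b + 1) / (- b + 1)) + A * (\<delta> powr - b / b))"
        using A0 \<delta> b by (simp add: ennreal_mult[symmetric] ennreal_plus[symmetric] del: ennreal_plus)
      also have "2 * A / \<delta> * (\<delta> powr (- b + 1) / (- b + 1)) + A * (\<delta> powr - b / b) = A * (2 / (1 - b) + 1 / b) * \<delta> powr - b"
      proof -
        have e: "\<delta> powr (- b + 1) = \<delta> powr - b * \<delta>" using \<delta> powr_add[of \<delta> "-b" 1] by simp
        show ?thesis unfolding e using \<delta> b by (simp add: field_simps)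
      qed
      finally show ?thesis .
    qed
    have "(\<integral>\<^sup>+z. ennreal (norm z powr c * (1 - (norm z)\<^sup>2) powr - b / (1 - r * (norm z)\<^sup>2)) \<partial>disc_measure s)
       = (\<integral>\<^sup>+z. ennreal (((norm z)\<^sup>2) powr (c/2) * (1 - (norm z)\<^sup>2) powr - b / (1 - r * (norm z)\<^sup>2)) \<partial>disc_measure s)"
      by (simp add: power2_powr)
    also have "\<dots> = ennreal pi * (\<integral>\<^sup>+t. ennreal (t powr (c/2) * (1 - t) powr - b / (1 - r * t)) * ennreal (t powr (s / 2 - 1)) * indicator {0<..<1} t \<partial>lborel)"
      by (rule nn_integral_disc_measure_radial) simp
    also have "\<dots> \<le> ennreal pi * (\<integral>\<^sup>+t. ennreal 4 * (ennreal (t powr a) * indicator {0<..<1} t) + G (1 - t) \<partial>lborel)"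
      by (intro mult_left_mono nn_integral_mono pt) auto
    also have "(\<integral>\<^sup>+t. ennreal 4 * (ennreal (t powr a) * indicator {0<..<1} t) + G (1 - t) \<partial>lborel)
        = ennreal 4 * ennreal (1 / (a + 1)) + (\<integral>\<^sup>+t. G (1 - t) \<partial>lborel)"
      by (subst nn_integral_add; (subst nn_integral_cmult)?) (auto simp: nn_integral_powr_unit_interval[OF a])
    also have "(\<integral>\<^sup>+t. G (1 - t) \<partial>lborel) = (\<integral>\<^sup>+t. G t \<partial>lborel)"
      using nn_integral_real_affine[of G "-1" 1] by simp
    also have "ennreal pi * (ennreal 4 * ennreal (1 / (a + 1)) + (\<integral>\<^sup>+t. G t \<partial>lborel))
       = ennreal (pi * (4 * (1 / (a + 1)) + A * (2 / (1 - b) + 1 / b) * \<delta> powr - b))"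
    proof -
      have "ennreal 4 * ennreal (1 / (a + 1)) = ennreal (4 * (1 / (a + 1)))"
        using a by (subst ennreal_mult[symmetric]) auto
      moreover have "0 \<le> 4 * (1 / (a + 1))" "0 \<le> A * (2 / (1 - b) + 1 / b) * \<delta> powr - b"
        using a b A0 by auto
      ultimately show ?thesis unfolding G_int
        by (simp only: ennreal_plus[symmetric] ennreal_mult'[symmetric] pi_ge_zero)
    qed
    also have "\<dots> \<le> ennreal (C * (1 - r) powr - b)"
    proof (rule ennreal_leI)
      have "1 powr - b \<le> \<delta> powr - b" using \<delta> b by (intro powr_mono2') auto
      then have "4 * (1 / (a + 1)) * 1 \<le> 4 / (a + 1) * \<delta> powr - b"
        using a by (intro mult_mono) auto
      then have "pi * (4 * (1 / (a + 1)) + A * (2 / (1 - b) + 1 / b) * \<delta> powr - b)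
        \<le> pi * (4 / (a + 1) * \<delta> powr - b + A * (2 / (1 - b) + 1 / b) * \<delta> powr - b)"
        by (intro mult_left_mono add_right_mono) auto
      then show "pi * (4 * (1 / (a + 1)) + A * (2 / (1 - b) + 1 / b) * \<delta> powr - b) \<le> C * (1 - r) powr - b"
        unfolding C_def \<delta>_def[symmetric] by (simp add: algebra_simps)
    qed
    finally show "(\<integral>\<^sup>+z. ennreal (norm z powr c * (1 - (norm z)\<^sup>2) powr - b / (1 - r * (norm z)\<^sup>2)) \<partial>disc_measure s)
      \<le> ennreal (C * (1 - r) powr - b)" .
  qed
qed

text \<open>The kernel is at most \<open>1 / (pi * (norm (1 - w * cnj z))\<^sup>2)\<close>; the
  Poisson identity replaces this denominator by the radial
  \<open>1 - (norm w)\<^sup>2 * (norm z)\<^sup>2\<close>, and the radial estimate applies with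
  \<open>r = (norm w)\<^sup>2\<close>.\<close>

lemma disc_kernel_schur_estimate:
  assumes b: "0 < b" "b < 1" and c: "0 < c + s" and s: "0 < s" "s \<le> 2"
  shows "\<exists>C>0. \<forall>w. norm w < 1 \<longrightarrow>
    (\<integral>\<^sup>+z. ennreal (norm (disc_kernel s (w * cnj z)) * (norm z powr c * (1 - (norm z)\<^sup>2) powr - b)) \<partial>disc_measure s)
      \<le> ennreal (C * (1 - (norm w)\<^sup>2) powr - b)"
proof -
  define \<psi> where "\<psi> = (\<lambda>r::real. r powr c * (1 - r\<^sup>2) powr - b / pi)"
  have [measurable]: "\<psi> \<in> borel_measurable borel" unfolding \<psi>_def by measurable
  obtain C where C: "C > 0" and est: "\<And>r. 0 \<le> r \<Longrightarrow> r < 1 \<Longrightarrow>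
    (\<integral>\<^sup>+z. ennreal (norm z powr c * (1 - (norm z)\<^sup>2) powr - b / (1 - r * (norm z)\<^sup>2)) \<partial>disc_measure s)
      \<le> ennreal (C * (1 - r) powr - b)"
    using disc_measure_radial_estimate[OF b c] by blast
  have est': "(\<integral>\<^sup>+z. ennreal (\<psi> (norm z) / (1 - r * (norm z)\<^sup>2)) \<partial>disc_measure s) \<le> ennreal (C * (1 - r) powr - b)"
    if "0 \<le> r" "r < 1" for r
  proof (rule order_trans[OF nn_integral_mono_AE est[OF that]])
    show "AE z in disc_measure s. ennreal (\<psi> (norm z) / (1 - r * (norm z)\<^sup>2))
        \<le> ennreal (norm z powr c * (1 - (norm z)\<^sup>2) powr - b / (1 - r * (norm z)\<^sup>2))"
      using AE_disc_measure
    proof eventually_elim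
      case (elim z)
      have "r * (norm z)\<^sup>2 \<le> 1 * 1" using elim that by (intro mult_mono power_le_one) auto
      moreover have "norm z powr c * (1 - (norm z)\<^sup>2) powr - b / pi \<le> norm z powr c * (1 - (norm z)\<^sup>2) powr - b"
        using pi_ge_two mult_left_mono[of 1 pi "norm z powr c * (1 - (norm z)\<^sup>2) powr - b"]
        by (simp add: divide_le_eq)
      ultimately show ?case unfolding \<psi>_def by (intro ennreal_leI divide_right_mono) auto
    qed
  qed
  have psi_int: "integrable (disc_measure s) (\<lambda>z. \<psi> (norm z))"
    unfolding integrable_iff_bounded using est'[of 0]
    by (auto simp: \<psi>_def abs_mult intro: le_less_trans[OF _ ennreal_less_top])
  show ?thesis
  proof (intro exI[of _ C] conjI allI impI C)
    fix w :: complex assume w: "norm w < 1"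
    have w2: "norm w ^ 2 < 1" using w by (simp add: power_less_one_iff)
    note P = integral_disc_measure_poisson[OF psi_int _ w]
    have nn: "AE z in disc_measure s. 0 \<le> \<psi> (norm z) / (1 - (norm w)\<^sup>2 * (norm z)\<^sup>2)"
      using AE_disc_measure
    proof eventually_elim
      case (elim z)
      have "(norm w)\<^sup>2 * (norm z)\<^sup>2 \<le> 1 * 1" using elim w by (intro mult_mono power_le_one) auto
      then show ?case by (auto simp: \<psi>_def)
    qed
    have "(\<integral>\<^sup>+z. ennreal (norm (disc_kernel s (w * cnj z)) * (norm z powr c * (1 - (norm z)\<^sup>2) powr - b)) \<partial>disc_measure s)
       \<le> (\<integral>\<^sup>+z. ennreal (\<psi> (norm z) / (norm (1 - w * cnj z))\<^sup>2) \<partial>disc_measure s)"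
    proof (rule nn_integral_mono_AE)
      show "AE z in disc_measure s. ennreal (norm (disc_kernel s (w * cnj z)) * (norm z powr c * (1 - (norm z)\<^sup>2) powr - b))
          \<le> ennreal (\<psi> (norm z) / (norm (1 - w * cnj z))\<^sup>2)"
        using AE_disc_measure
      proof eventually_elim
        case (elim z)
        have "norm (w * cnj z) \<le> 1" using elim w by (simp add: norm_mult mult_le_one)
        then have "norm (disc_kernel s (w * cnj z)) * (norm z powr c * (1 - (norm z)\<^sup>2) powr - b)
           \<le> 1 / (pi * (norm (1 - w * cnj z))\<^sup>2) * (norm z powr c * (1 - (norm z)\<^sup>2) powr - b)"
          by (intro mult_right_mono norm_disc_kernel_le s) auto
        then show ?case by (intro ennreal_leI) (simp add: \<psi>_def)
      qed
    qed
    also have "\<dots> = ennreal (LINT z|disc_measure s. \<psi> (norm z) / (norm (1 - w * cnj z))\<^sup>2)"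
      by (intro nn_integral_eq_integral P) (auto simp: \<psi>_def)
    also have "\<dots> = ennreal (LINT z|disc_measure s. \<psi> (norm z) / (1 - (norm w)\<^sup>2 * (norm z)\<^sup>2))"
      by (subst P) auto
    also have "\<dots> \<le> (\<integral>\<^sup>+z. ennreal (\<psi> (norm z) / (1 - (norm w)\<^sup>2 * (norm z)\<^sup>2)) \<partial>disc_measure s)"
      using nn by (subst integral_eq_nn_integral) (auto simp: ennreal_enn2real_if)
    also have "\<dots> \<le> ennreal (C * (1 - (norm w)\<^sup>2) powr - b)"
      by (rule est') (use w2 in auto)
    finally show "(\<integral>\<^sup>+z. ennreal (norm (disc_kernel s (w * cnj z)) * (norm z powr c * (1 - (norm z)\<^sup>2) powr - b)) \<partial>disc_measure s)
      \<le> ennreal (C * (1 - (norm w)\<^sup>2) powr - b)" .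
  qed
qed

section \<open>The reproducing property\<close>

text \<open>Since \<open>g\<close> is merely integrable, its Taylor series cannot be integrated
  termwise over the whole disc. On \<open>norm z < r\<close> it can, orthogonality leaves the term
  of degree \<open>m\<close>, and dominated convergence lets \<open>r\<close> tend to 1.\<close>

lemma integral_disc_measure_taylor:
  fixes g :: "complex \<Rightarrow> complex"
  assumes hol: "g holomorphic_on ball 0 1" and g: "integrable (disc_measure s) g" and s: "0 < s"
  shows "(LINT z|disc_measure s. g z * cnj z ^ m)
      = (deriv ^^ m) g 0 / fact m * of_real (2 * pi / (2 * real m + s))"
proof -
  define a where "a = (\<lambda>j. (deriv ^^ j) g 0 / fact j)"
  have [measurable]: "g \<in> borel_measurable borel"
    using borel_measurable_integrable[OF g] by (simp cong: measurable_cong_sets)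
  have ser: "(\<lambda>j. a j * z ^ j) sums g z" if "norm z < 1" for z
    using holomorphic_power_series[OF hol, of z] that by (simp add: a_def)
  interpret finite_measure "disc_measure s" by (rule finite_disc_measure[OF s])
  have trunc: "(LINT z|disc_measure s. indicator {..<r} (norm z) * (g z * cnj z ^ m))
      = a m * (LINT z|disc_measure s. indicator {..<r} (norm z) * (z ^ m * cnj z ^ m))" if r: "0 < r" "r < 1" for r
  proof -
    define \<psi> where "\<psi> = (\<lambda>x::real. indicator {..<r} x :: complex)"
    have [measurable]: "\<psi> \<in> borel_measurable borel" unfolding \<psi>_def by measurable
    have int_G: "integrable (disc_measure s) (\<lambda>z. \<psi> (norm z) * z ^ m)"
    proof (rule integrable_const_bound)
      show "AE z in disc_measure s. norm (\<psi> (norm z) * z ^ m) \<le> 1"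
        using AE_disc_measure by eventually_elim (auto simp: \<psi>_def norm_mult norm_power indicator_def power_le_one)
    qed simp
    \<comment> \<open>The series converges at the point \<open>(1 + r) / 2\<close> of the disc,
      hence absolutely at the smaller radius \<open>r\<close>.\<close>
    have nr: "norm (of_real ((1 + r) / 2) :: complex) = (1 + r) / 2" "norm (of_real r :: complex) = r"
      using r unfolding norm_of_real by auto
    have "summable (\<lambda>j. norm (a j * of_real r ^ j))"
      by (rule powser_insidea[OF sums_summable[OF ser[of "of_real ((1 + r) / 2)"]]]) (unfold nr, use r in auto)
    then have sr: "summable (\<lambda>j. norm (cnj (a j)) * (norm (1::complex) * r) ^ j)"
      using r by (simp add: norm_mult norm_power)
    \<comment> \<open>Termwise integration is available for series in \<open>cnj z\<close>, so the
      conjugate of the Taylor series is integrated against \<open>z ^ m\<close> and the outcome is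
      conjugated back.\<close>
    have "(\<lambda>j. cnj (a j) * 1 ^ j * (LINT z|disc_measure s. \<psi> (norm z) * z ^ m * cnj z ^ j)) sums
        (LINT z|disc_measure s. (\<Sum>j. cnj (a j) * (1 * cnj z) ^ j) * (\<psi> (norm z) * z ^ m))"
      by (rule integral_disc_measure_power_series[OF int_G _ _ sr]) (use r in \<open>auto simp: \<psi>_def indicator_def intro!: AE_I2\<close>)
    moreover have "(\<lambda>j. cnj (a j) * 1 ^ j * (LINT z|disc_measure s. \<psi> (norm z) * z ^ m * cnj z ^ j)) sums
        (\<Sum>j\<in>{m}. cnj (a j) * 1 ^ j * (LINT z|disc_measure s. \<psi> (norm z) * z ^ m * cnj z ^ j))"
      by (rule sums_finite) (auto intro!: integral_disc_measure_monomials)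
    ultimately have *: "(LINT z|disc_measure s. (\<Sum>j. cnj (a j) * (1 * cnj z) ^ j) * (\<psi> (norm z) * z ^ m))
        = cnj (a m) * (LINT z|disc_measure s. \<psi> (norm z) * z ^ m * cnj z ^ m)"
      by (simp add: sums_iff)
    have "(LINT z|disc_measure s. (\<Sum>j. cnj (a j) * (1 * cnj z) ^ j) * (\<psi> (norm z) * z ^ m))
        = (LINT z|disc_measure s. cnj (\<psi> (norm z) * (g z * cnj z ^ m)))"
    proof (rule integral_cong_AE)
      show "AE z in disc_measure s. (\<Sum>j. cnj (a j) * (1 * cnj z) ^ j) * (\<psi> (norm z) * z ^ m)
         = cnj (\<psi> (norm z) * (g z * cnj z ^ m))"
        using AE_disc_measure
      proof eventually_elim
        case (elim z)
        have "(\<lambda>j. cnj (a j * z ^ j)) sums cnj (g z)"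
          unfolding sums_cnj by (rule ser) (use elim in simp)
        then have "(\<Sum>j. cnj (a j) * (1 * cnj z) ^ j) = cnj (g z)"
          by (simp add: sums_iff)
        then show ?case by (simp add: \<psi>_def indicator_def)
      qed
    qed auto
    also have "\<dots> = cnj (LINT z|disc_measure s. \<psi> (norm z) * (g z * cnj z ^ m))"
      by (rule Bochner_Integration.integral_cnj)
    finally have "cnj (LINT z|disc_measure s. \<psi> (norm z) * (g z * cnj z ^ m))
        = cnj (a m) * (LINT z|disc_measure s. \<psi> (norm z) * z ^ m * cnj z ^ m)"
      using * by simp
    from arg_cong[OF this, of cnj]
    have "(LINT z|disc_measure s. \<psi> (norm z) * (g z * cnj z ^ m))
        = a m * cnj (LINT z|disc_measure s. \<psi> (norm z) * z ^ m * cnj z ^ m)"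
      by (simp only: complex_cnj_cnj complex_cnj_mult)
    also have "cnj (LINT z|disc_measure s. \<psi> (norm z) * z ^ m * cnj z ^ m)
        = (LINT z|disc_measure s. \<psi> (norm z) * (z ^ m * cnj z ^ m))"
    proof (subst Bochner_Integration.integral_cnj[symmetric], rule Bochner_Integration.integral_cong)
      show "cnj (\<psi> (norm z) * z ^ m * cnj z ^ m) = \<psi> (norm z) * (z ^ m * cnj z ^ m)" for z
        by (simp add: \<psi>_def indicator_def mult_ac)
    qed simp
    finally show ?thesis by (simp add: \<psi>_def)
  qed
  define r where "r = (\<lambda>i::nat. 1 - 1 / real (i + 2))"
  have r: "0 < r i" "r i < 1" for i by (auto simp: r_def field_simps)
  have r_lim: "r \<longlonglongrightarrow> 1"
  proof -
    have "(\<lambda>i. 1 / real (i + 2)) \<longlonglongrightarrow> 0"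
      using LIMSEQ_ignore_initial_segment[OF lim_1_over_n, of 2] by simp
    from tendsto_diff[OF tendsto_const[of 1] this] show ?thesis by (simp add: r_def)
  qed
  have conv: "(\<lambda>i. LINT z|disc_measure s. indicator {..<r i} (norm z) * F z) \<longlonglongrightarrow> (LINT z|disc_measure s. F z)"
    if F: "integrable (disc_measure s) F" for F :: "complex \<Rightarrow> complex"
  proof (rule integral_dominated_convergence[where w="\<lambda>z. norm (F z)"])
    have [measurable]: "F \<in> borel_measurable borel"
      using borel_measurable_integrable[OF F] by (simp cong: measurable_cong_sets)
    show "F \<in> borel_measurable (disc_measure s)" by simp
    show "(\<lambda>z. indicator {..<r i} (norm z) * F z) \<in> borel_measurable (disc_measure s)" for i by simp
    show "AE z in disc_measure s. (\<lambda>i. indicator {..<r i} (norm z) * F z) \<longlonglongrightarrow> F z"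
      using AE_disc_measure
    proof eventually_elim
      case (elim z)
      then have "eventually (\<lambda>i. norm z < r i) sequentially"
        using order_tendstoD(1)[OF r_lim] by blast
      then have "eventually (\<lambda>i. indicator {..<r i} (norm z) * F z = F z) sequentially"
        by eventually_elim simp
      then show ?case by (rule tendsto_eventually)
    qed
  qed (use F in \<open>auto simp: indicator_def\<close>)
  have i1: "integrable (disc_measure s) (\<lambda>z. g z * cnj z ^ m)"
  proof (rule Bochner_Integration.integrable_bound[OF g])
    show "AE z in disc_measure s. norm (g z * cnj z ^ m) \<le> norm (g z)"
      using AE_disc_measure
      by eventually_elim (auto simp: norm_mult norm_power power_le_one mult_left_le)
  qed simp
  have i2: "integrable (disc_measure s) (\<lambda>z. z ^ m * cnj z ^ m)"
  proof (rule integrable_const_bound)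
    show "AE z in disc_measure s. norm (z ^ m * cnj z ^ m) \<le> 1"
      using AE_disc_measure by eventually_elim (auto simp: norm_mult norm_power power_le_one mult_le_one)
  qed simp
  have "(\<lambda>i. a m * (LINT z|disc_measure s. indicator {..<r i} (norm z) * (z ^ m * cnj z ^ m)))
      \<longlonglongrightarrow> a m * (LINT z|disc_measure s. z ^ m * cnj z ^ m)"
    by (intro tendsto_mult_left conv i2)
  moreover have "(\<lambda>i. a m * (LINT z|disc_measure s. indicator {..<r i} (norm z) * (z ^ m * cnj z ^ m)))
      \<longlonglongrightarrow> (LINT z|disc_measure s. g z * cnj z ^ m)"
    using conv[OF i1] by (simp add: trunc r)
  ultimately have "(LINT z|disc_measure s. g z * cnj z ^ m) = a m * (LINT z|disc_measure s. z ^ m * cnj z ^ m)"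
    by (rule LIMSEQ_unique[symmetric])
  also have "(LINT z|disc_measure s. z ^ m * cnj z ^ m) = (LINT z|disc_measure s. of_real (norm z powr (2 * real m)))"
  proof (rule integral_cong_AE)
    show "AE z in disc_measure s. z ^ m * cnj z ^ m = complex_of_real (norm z powr (2 * real m))"
      using AE_disc_measure
    proof eventually_elim
      case (elim z)
      have "z ^ m * cnj z ^ m = of_real ((norm z)\<^sup>2 ^ m)"
        by (simp only: of_real_power[of _ m] complex_norm_square power_mult_distrib)
      also have "(norm z)\<^sup>2 ^ m = norm z powr (2 * real m)"
        using elim powr_realpow[of "norm z" "2 * m"] by (simp add: power_mult)
      finally show ?case .
    qed
  qed auto
  also have "\<dots> = of_real (LINT z|disc_measure s. norm z powr (2 * real m))"
    by simp
  also have "(LINT z|disc_measure s. norm z powr (2 * real m)) = 2 * pi / (2 * real m + s)"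
    using s by (subst integral_eq_nn_integral) (simp_all only: disc_measure_moment, simp_all)
  finally show ?thesis by (simp add: a_def)
qed

text \<open>The kernel coefficients are the reciprocals of the factors in
  \<open>integral_disc_measure_taylor\<close>, so integrating the kernel series termwise returns the
  Taylor series of \<open>g\<close> at \<open>w\<close>.\<close>

lemma disc_kernel_reproducing:
  fixes g :: "complex \<Rightarrow> complex"
  assumes hol: "g holomorphic_on ball 0 1" and g: "integrable (disc_measure s) g" and s: "0 < s"
    and w: "norm w < 1"
  shows "(LINT z|disc_measure s. disc_kernel s (w * cnj z) * g z) = g w"
proof -
  have [measurable]: "g \<in> borel_measurable borel"
    using borel_measurable_integrable[OF g] by (simp cong: measurable_cong_sets)
  have "(\<lambda>m. disc_kernel_coeff s m * w ^ m * (LINT z|disc_measure s. g z * cnj z ^ m)) sums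
      (LINT z|disc_measure s. (\<Sum>m. disc_kernel_coeff s m * (w * cnj z) ^ m) * g z)"
    by (rule integral_disc_measure_power_series[OF g, where \<rho>=1])
      (use AE_disc_measure[of s] summable_disc_kernel_coeff[OF w s] in \<open>auto elim: eventually_mono\<close>)
  also have "(\<lambda>m. disc_kernel_coeff s m * w ^ m * (LINT z|disc_measure s. g z * cnj z ^ m))
      = (\<lambda>m. (deriv ^^ m) g 0 / fact m * w ^ m)"
  proof
    fix m
    define c where "c = complex_of_real (2 * pi / (2 * real m + s))"
    have c: "disc_kernel_coeff s m * c = 1"
      unfolding disc_kernel_coeff_def c_def of_real_mult[symmetric] using s by simp
    have "disc_kernel_coeff s m * w ^ m * ((deriv ^^ m) g 0 / fact m * c)
        = (disc_kernel_coeff s m * c) * ((deriv ^^ m) g 0 / fact m * w ^ m)"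
      by (simp add: mult_ac)
    then show "disc_kernel_coeff s m * w ^ m * (LINT z|disc_measure s. g z * cnj z ^ m) = (deriv ^^ m) g 0 / fact m * w ^ m"
      by (simp only: integral_disc_measure_taylor[OF hol g s] c_def[symmetric] c mult_1)
  qed
  also have "(LINT z|disc_measure s. (\<Sum>m. disc_kernel_coeff s m * (w * cnj z) ^ m) * g z)
     = (LINT z|disc_measure s. disc_kernel s (w * cnj z) * g z)"
  proof (rule integral_cong_AE)
    show "AE z in disc_measure s. (\<Sum>m. disc_kernel_coeff s m * (w * cnj z) ^ m) * g z = disc_kernel s (w * cnj z) * g z"
      using AE_disc_measure
    proof eventually_elim
      case (elim z)
      have "norm (w * cnj z) \<le> norm w" using elim by (simp add: norm_mult mult_left_le)
      then show ?case using disc_kernel_sums[of "w * cnj z" s] w by (simp add: sums_iff)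
    qed
  qed auto
  finally have "(\<lambda>m. (deriv ^^ m) g 0 / fact m * w ^ m) sums (LINT z|disc_measure s. disc_kernel s (w * cnj z) * g z)" .
  moreover have "(\<lambda>m. (deriv ^^ m) g 0 / fact m * w ^ m) sums g w"
    using holomorphic_power_series[OF hol, of w] w by simp
  ultimately show ?thesis by (rule sums_unique2)
qed

text \<open>The mean value property over a ball, applied to \<open>G\<^sup>2\<close>.\<close>

lemma norm_square_le_nn_integral_ball:
  fixes G :: "complex \<Rightarrow> complex"
  assumes hol: "G holomorphic_on cball w r" and r: "0 < r"
  shows "ennreal (pi * r\<^sup>2 * (norm (G w))\<^sup>2) \<le> (\<integral>\<^sup>+z. ennreal ((norm (G z))\<^sup>2) * indicator (ball w r) z \<partial>lborel)"
proof -
  define g where "g = (\<lambda>z. indicator (ball 0 1) z *\<^sub>R (G (w + of_real r * z))\<^sup>2)"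
  have sub: "w + of_real r * z \<in> cball w r" if "norm z \<le> 1" for z
    using that r by (simp add: dist_norm norm_mult mult_left_le)
  have hol': "(\<lambda>z. (G (w + of_real r * z))\<^sup>2) holomorphic_on cball 0 1"
    using sub by (intro holomorphic_on_power holomorphic_on_compose_gen[OF _ hol, unfolded o_def])
      (auto intro!: holomorphic_intros)
  then have cont: "continuous_on (cball 0 1) (\<lambda>z. (G (w + of_real r * z))\<^sup>2)"
    by (rule holomorphic_on_imp_continuous_on)
  then have cont_ball: "continuous_on (ball 0 1) (\<lambda>z. (G (w + of_real r * z))\<^sup>2)"
    by (rule continuous_on_subset) auto
  have [measurable]: "g \<in> borel_measurable borel"
    unfolding g_def by (rule borel_measurable_continuous_on_indicator[OF _ cont_ball]) simp
  have "bounded ((\<lambda>z. (G (w + of_real r * z))\<^sup>2) ` cball 0 1)"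
    by (intro compact_imp_bounded compact_continuous_image cont compact_cball)
  then obtain B where "\<forall>z\<in>cball 0 1. norm ((G (w + of_real r * z))\<^sup>2) \<le> B"
    unfolding bounded_iff by auto
  then have B: "\<And>z. norm z \<le> 1 \<Longrightarrow> norm ((G (w + of_real r * z))\<^sup>2) \<le> B"
    by simp
  interpret finite_measure "disc_measure 2" by (rule finite_disc_measure) simp
  have int: "integrable (disc_measure 2) g"
  proof (rule integrable_const_bound)
    show "AE z in disc_measure 2. norm (g z) \<le> B"
      using AE_disc_measure by eventually_elim (auto simp: g_def intro!: B)
  qed simp
  have holg: "g holomorphic_on ball 0 1"
    using holomorphic_on_subset[OF hol' ball_subset_cball]
    by (rule holomorphic_transform) (simp add: g_def)
  \<comment> \<open>At the centre the kernel for \<open>s = 2\<close> is the constant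
    \<open>1 / pi\<close>, and the reproducing formula is the mean value property over the unit
    disc.\<close>
  have "(LINT z|disc_measure 2. disc_kernel 2 (0 * cnj z) * g z) = g 0"
    by (rule disc_kernel_reproducing[OF holg int]) auto
  then have "g 0 = (LINT z|disc_measure 2. g z) / pi" by (simp add: disc_kernel_def)
  then have "norm (g 0) * pi = norm (LINT z|disc_measure 2. g z)"
    by (simp add: norm_divide)
  then have "ennreal (norm (g 0) * pi) = ennreal (norm (LINT z|disc_measure 2. g z))" by simp
  also have "\<dots> \<le> (\<integral>\<^sup>+z. ennreal (norm (g z)) \<partial>disc_measure 2)"
    using integral_norm_bound_ennreal[OF int] .
  also have "\<dots> \<le> (\<integral>\<^sup>+z. ennreal (norm (g z)) \<partial>lborel)"
    by (subst nn_integral_disc_measure) (auto intro!: nn_integral_mono simp: indicator_def)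
  finally have 1: "ennreal (norm (g 0) * pi) \<le> (\<integral>\<^sup>+z. ennreal (norm (g z)) \<partial>lborel)" .
  define F where "F = (\<lambda>z. ennreal ((norm (G z))\<^sup>2) * indicator (ball w r) z)"
  have F_eq: "F = (\<lambda>z. ennreal (norm (indicator (ball w r) z *\<^sub>R (G z)\<^sup>2)))"
    by (auto simp: F_def indicator_def norm_power fun_eq_iff)
  have contG: "continuous_on (ball w r) (\<lambda>z. (G z)\<^sup>2)"
    by (intro continuous_intros continuous_on_subset[OF holomorphic_on_imp_continuous_on[OF hol]] ball_subset_cball)
  have "(\<lambda>z. indicator (ball w r) z *\<^sub>R (G z)\<^sup>2) \<in> borel_measurable borel"
    by (rule borel_measurable_continuous_on_indicator[OF _ contG]) simp
  from measurable_compose[OF measurable_compose[OF this borel_measurable_norm] measurable_ennreal]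
  have [measurable]: "F \<in> borel_measurable borel" unfolding F_eq .
  have g_eq: "ennreal (norm (g z)) = F (w + of_real r * z)" for z
    using r by (auto simp: g_def F_def indicator_def norm_power dist_norm norm_mult)
  have "(\<integral>\<^sup>+z. F z \<partial>lborel) = (\<integral>\<^sup>+z. F (w + z) \<partial>lborel)"
    by (subst (1) lborel_distr_plus[of w, symmetric], subst nn_integral_distr) auto
  also have "\<dots> = ennreal (r\<^sup>2) * (\<integral>\<^sup>+z. F (w + of_real r * z) \<partial>lborel)"
    using nn_integral_lborel_cmult[of "\<lambda>z. F (w + z)" "of_real r"] r by simp
  finally have 2: "(\<integral>\<^sup>+z. F z \<partial>lborel) = ennreal (r\<^sup>2) * (\<integral>\<^sup>+z. ennreal (norm (g z)) \<partial>lborel)"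
    by (simp add: g_eq)
  have "ennreal (pi * r\<^sup>2 * (norm (G w))\<^sup>2) = ennreal (r\<^sup>2) * ennreal (norm (g 0) * pi)"
    by (subst ennreal_mult[symmetric]) (auto simp: g_def norm_power mult_ac)
  also have "\<dots> \<le> ennreal (r\<^sup>2) * (\<integral>\<^sup>+z. ennreal (norm (g z)) \<partial>lborel)"
    by (rule mult_left_mono[OF 1]) simp
  also have "\<dots> = (\<integral>\<^sup>+z. F z \<partial>lborel)" using 2 by simp
  finally show ?thesis by (simp add: F_def)
qed

text \<open>Square integrability excludes a pole because the weight is at least \<open>1\<close> for \<open>s \<le> 2\<close>.\<close>

lemma holomorphic_extension_disc_measure:
  fixes G :: "complex \<Rightarrow> complex"
  assumes hol: "G holomorphic_on ball 0 1 - {0}" and [measurable]: "G \<in> borel_measurable borel"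
    and fin: "(\<integral>\<^sup>+z. ennreal ((norm (G z))\<^sup>2) \<partial>disc_measure s) < \<infinity>" and s: "s \<le> 2"
  shows "\<exists>g. g holomorphic_on ball 0 1 \<and> (\<forall>z\<in>ball 0 1 - {0}. g z = G z)"
proof (rule holomorphic_on_extend_lim[THEN iffD2, OF hol])
  show "(0::complex) \<in> interior (ball 0 1)" by simp
  define F where "F = (\<lambda>z. (norm (G z))\<^sup>2 * indicator {z. 0 < norm z \<and> norm z < 1} z)"
  have [measurable]: "F \<in> borel_measurable borel" unfolding F_def by measurable
  have F_int: "integrable lborel F"
  proof -
    have "(\<integral>\<^sup>+z. ennreal (F z) \<partial>lborel) \<le> (\<integral>\<^sup>+z. ennreal ((norm (G z))\<^sup>2) \<partial>disc_measure s)"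
    proof (subst nn_integral_disc_measure, measurable, rule nn_integral_mono)
      fix z :: complex
      show "ennreal (F z) \<le> ennreal ((norm (G z))\<^sup>2) * ennreal (norm z powr (s - 2)) * indicator {z. 0 < norm z \<and> norm z < 1} z"
      proof (cases "0 < norm z \<and> norm z < 1")
        case True
        have "1 = norm z powr 0" using True by simp
        also have "\<dots> \<le> norm z powr (s - 2)" using True s by (intro powr_mono') auto
        finally have "(norm (G z))\<^sup>2 * 1 \<le> (norm (G z))\<^sup>2 * norm z powr (s - 2)" by (intro mult_left_mono) auto
        then show ?thesis using True by (auto simp: F_def ennreal_mult[symmetric] intro!: ennreal_leI)
      qed (simp add: F_def)
    qed
    with fin have "(\<integral>\<^sup>+z. ennreal (F z) \<partial>lborel) < \<infinity>" by (rule order.strict_trans1[rotated])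
    then show ?thesis by (auto simp: integrable_iff_bounded F_def)
  qed
  \<comment> \<open>The mean value estimate on the ball of radius \<open>norm w / 2\<close> about
    \<open>w\<close> gives the factor \<open>4 / pi\<close>. The ball avoids 0 and lies in
    \<open>norm z < 2 * norm w\<close>. As \<open>w\<close> tends to 0 these discs shrink to a
    point, so the right-hand side tends to 0 and \<open>w * G w\<close> with it: the singularity is
    removable.\<close>
  have bound: "(norm (w * G w))\<^sup>2 \<le> 4 / pi * (LINT z|lborel. F z * indicator {z. norm z < 2 * norm w} z)"
    if w: "0 < norm w" "norm w < 1/2" for w
  proof -
    define r where "r = norm w / 2"
    have r: "0 < r" using w by (simp add: r_def)
    have sub: "0 < norm z \<and> norm z < 1 \<and> norm z < 2 * norm w" if "z \<in> cball w r" for z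
    proof -
      have "norm (w - z) \<le> norm w / 2" using that by (simp add: r_def dist_norm)
      moreover have "norm w \<le> norm (w - z) + norm z" "norm z \<le> norm w + norm (w - z)"
        using norm_triangle_ineq[of "w - z" z] norm_triangle_ineq4[of w "w - z"] by auto
      ultimately show ?thesis using w by linarith
    qed
    have "G holomorphic_on cball w r"
      by (rule holomorphic_on_subset[OF hol]) (use sub in force)
    then have "ennreal (pi * r\<^sup>2 * (norm (G w))\<^sup>2) \<le> (\<integral>\<^sup>+z. ennreal ((norm (G z))\<^sup>2) * indicator (ball w r) z \<partial>lborel)"
      by (rule norm_square_le_nn_integral_ball[OF _ r])
    also have "\<dots> \<le> (\<integral>\<^sup>+z. ennreal (F z * indicator {z. norm z < 2 * norm w} z) \<partial>lborel)"
      using sub by (intro nn_integral_mono) (auto simp: F_def indicator_def)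
    also have "\<dots> = ennreal (LINT z|lborel. F z * indicator {z. norm z < 2 * norm w} z)"
      by (intro nn_integral_eq_integral integrable_real_mult_indicator F_int) (auto simp: F_def)
    finally have "pi * r\<^sup>2 * (norm (G w))\<^sup>2 \<le> (LINT z|lborel. F z * indicator {z. norm z < 2 * norm w} z)"
      by (subst (asm) ennreal_le_iff) (auto intro!: Bochner_Integration.integral_nonneg simp: F_def)
    then show ?thesis by (simp add: r_def norm_mult field_simps power_mult_distrib)
  qed
  have "((\<lambda>w. norm (w * G w)) \<longlongrightarrow> 0) (at 0)"
    unfolding tendsto_at_iff_sequentially comp_def
  proof (intro allI impI)
    fix X :: "nat \<Rightarrow> complex"
    assume X0: "\<forall>i. X i \<in> UNIV - {0}" and X: "X \<longlonglongrightarrow> 0"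
    have nX: "(\<lambda>i. norm (X i)) \<longlonglongrightarrow> 0" using X by (simp add: tendsto_norm_zero)
    have "(\<lambda>i. LINT z|lborel. F z * indicator {z. norm z < 2 * norm (X i)} z) \<longlonglongrightarrow> (LINT z|(lborel::complex measure). 0)"
    proof (rule integral_dominated_convergence[where w=F])
      show "AE z in lborel. (\<lambda>i. F z * indicator {z. norm z < 2 * norm (X i)} z) \<longlonglongrightarrow> 0"
      proof (rule AE_I2)
        fix z :: complex
        show "(\<lambda>i. F z * indicator {z. norm z < 2 * norm (X i)} z) \<longlonglongrightarrow> 0"
        proof (cases "z = 0")
          case False
          then have "eventually (\<lambda>i. norm (X i) < norm z / 2) sequentially"
            using order_tendstoD(2)[OF nX, of "norm z / 2"] by simp
          then have "eventually (\<lambda>i. F z * indicator {z. norm z < 2 * norm (X i)} z = 0) sequentially"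
            by eventually_elim (simp add: indicator_def)
          then show ?thesis by (rule tendsto_eventually)
        qed (simp add: F_def)
      qed
    qed (use F_int in \<open>auto simp: F_def indicator_def\<close>)
    then have lim: "(\<lambda>i. 4 / pi * (LINT z|lborel. F z * indicator {z. norm z < 2 * norm (X i)} z)) \<longlonglongrightarrow> 0"
      by (auto intro: tendsto_mult_right_zero)
    have "(\<lambda>i. (norm (X i * G (X i)))\<^sup>2) \<longlonglongrightarrow> 0"
    proof (rule tendsto_sandwich[OF _ _ tendsto_const lim])
      have "eventually (\<lambda>i. norm (X i) < 1/2) sequentially"
        using order_tendstoD(2)[OF nX, of "1/2"] by simp
      then show "eventually (\<lambda>i. (norm (X i * G (X i)))\<^sup>2 \<le> 4 / pi * (LINT z|lborel. F z * indicator {z. norm z < 2 * norm (X i)} z)) sequentially"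
        by eventually_elim (rule bound, use X0 in auto)
    qed simp
    then have "(\<lambda>i. sqrt ((norm (X i * G (X i)))\<^sup>2)) \<longlonglongrightarrow> sqrt 0"
      by (rule tendsto_real_sqrt)
    then show "(\<lambda>i. norm (X i * G (X i))) \<longlonglongrightarrow> 0" by simp
  qed
  then show "((\<lambda>z. (z - 0) * G z) \<longlongrightarrow> 0) (at 0)"
    by (simp add: tendsto_norm_zero_iff)
qed

lemma disc_kernel_reproducing_punctured:
  fixes G :: "complex \<Rightarrow> complex"
  assumes hol: "G holomorphic_on ball 0 1 - {0}" and [measurable]: "G \<in> borel_measurable borel"
    and fin: "(\<integral>\<^sup>+z. ennreal ((norm (G z))\<^sup>2) \<partial>disc_measure s) < \<infinity>" and s: "0 < s" "s \<le> 2"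
    and w: "0 < norm w" "norm w < 1"
  shows "(LINT z|disc_measure s. disc_kernel s (w * cnj z) * G z) = G w"
proof -
  obtain h where h: "h holomorphic_on ball 0 1" "\<And>z. z \<in> ball 0 1 - {0} \<Longrightarrow> h z = G z"
    using holomorphic_extension_disc_measure[OF hol _ fin s(2)] by auto
  \<comment> \<open>The extension \<open>h\<close> is arbitrary outside the disc, so
    \<open>G\<close> is altered at the origin only; this preserves Borel measurability.\<close>
  define g where "g = (\<lambda>z. if z = 0 then h 0 else G z)"
  have [measurable]: "g \<in> borel_measurable borel" unfolding g_def by measurable
  interpret finite_measure "disc_measure s" by (rule finite_disc_measure[OF s(1)])
  have AEg: "AE z in disc_measure s. G z = g z"
    using AE_disc_measure by eventually_elim (auto simp: g_def)
  have "integrable (disc_measure s) (\<lambda>z. (norm (G z))\<^sup>2)"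
    using fin by (simp add: integrable_iff_bounded)
  then have "integrable (disc_measure s) (\<lambda>z. (G z)\<^sup>2)"
    by (intro integrable_norm_cancel[where f="\<lambda>z. (G z)\<^sup>2"]) (simp_all add: norm_power)
  then have G_int: "integrable (disc_measure s) G"
    by (rule square_integrable_imp_integrable[rotated]) simp
  have int: "integrable (disc_measure s) g"
    by (rule integrable_cong_AE_imp[OF G_int _ AEg]) simp
  have "g holomorphic_on ball 0 1"
    by (rule holomorphic_transform[OF h(1)]) (use h(2) in \<open>auto simp: g_def\<close>)
  from disc_kernel_reproducing[OF this int s(1) w(2)]
  have "(LINT z|disc_measure s. disc_kernel s (w * cnj z) * g z) = G w" using w by (auto simp: g_def)
  moreover have "(LINT z|disc_measure s. disc_kernel s (w * cnj z) * g z)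
      = (LINT z|disc_measure s. disc_kernel s (w * cnj z) * G z)"
  proof (rule integral_cong_AE)
    show "AE z in disc_measure s. disc_kernel s (w * cnj z) * g z = disc_kernel s (w * cnj z) * G z"
      using AEg by eventually_elim simp
  qed simp_all
  ultimately show ?thesis by simp
qed

section \<open>Schur test, orthogonal projections and integrals with a parameter\<close>

text \<open>Young's inequality for the factors \<open>x * t powr ((1 - p) / p)\<close> and
  \<open>t powr ((p - 1) / p)\<close>, with equality at \<open>t = x\<close>. The free parameter
  \<open>t\<close> is optimised after integration.\<close>

lemma young_scaled:
  fixes x t p :: real
  assumes "x \<ge> 0" "t > 0" "p > 1"
  shows "x \<le> x powr p * t powr (1 - p) / p + t * (p - 1) / p"
proof -
  define q where "q = p / (p - 1)"
  have q: "q > 1" "1 / p + 1 / q = 1" using assms by (auto simp: q_def field_simps)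
  have "x * t powr ((1 - p) / p) * t powr ((p - 1) / p)
      \<le> (x * t powr ((1 - p) / p)) powr p / p + (t powr ((p - 1) / p)) powr q / q"
    using q assms by (intro Youngs_inequality) auto
  also have "x * t powr ((1 - p) / p) * t powr ((p - 1) / p) = x"
    using assms by (simp add: mult.assoc powr_add[symmetric] add_divide_distrib[symmetric])
  also have "(x * t powr ((1 - p) / p)) powr p = x powr p * t powr (1 - p)"
    using assms by (simp add: powr_mult powr_powr)
  also have "(t powr ((p - 1) / p)) powr q / q = t * (p - 1) / p"
    using assms by (simp add: powr_powr q_def)
  finally show ?thesis .
qed

text \<open>Hoelder's inequality for the measure with density \<open>k\<close>, applied to
  \<open>f = (f * H powr ((1 - p) / p)) * H powr ((p - 1) / p)\<close>. It is obtained by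
  integrating the scaled Young inequality for \<open>f / H\<close>.\<close>

lemma nn_integral_kernel_holder:
  fixes k f H :: "'a \<Rightarrow> real"
  assumes [measurable]: "k \<in> borel_measurable M" "f \<in> borel_measurable M" "H \<in> borel_measurable M"
    and nonneg: "\<And>y. y \<in> space M \<Longrightarrow> 0 \<le> k y" "\<And>y. y \<in> space M \<Longrightarrow> 0 \<le> f y"
      "\<And>y. y \<in> space M \<Longrightarrow> 0 < H y"
    and p: "p > 1" and A: "A > 0" "(\<integral>\<^sup>+y. ennreal (k y * H y) \<partial>M) \<le> ennreal A"
    and J: "J \<ge> 0" "(\<integral>\<^sup>+y. ennreal (k y * (f y powr p * H y powr (1 - p))) \<partial>M) = ennreal J"
  shows "(\<integral>\<^sup>+y. ennreal (k y * f y) \<partial>M) \<le> ennreal ((A powr (p - 1) * J) powr (1 / p))"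
proof -
  have main: "(\<integral>\<^sup>+y. ennreal (k y * f y) \<partial>M) \<le> ennreal (t powr (1 - p) / p * J + t * (p - 1) / p * A)"
    if t: "t > 0" for t
  proof -
    have "(\<integral>\<^sup>+y. ennreal (k y * f y) \<partial>M) \<le>
      (\<integral>\<^sup>+y. ennreal (t powr (1 - p) / p) * ennreal (k y * (f y powr p * H y powr (1 - p)))
          + ennreal (t * (p - 1) / p) * ennreal (k y * H y) \<partial>M)"
    proof (rule nn_integral_mono)
      fix y assume y: "y \<in> space M"
      have H: "H y > 0" and f: "f y \<ge> 0" and k: "k y \<ge> 0" using nonneg y by auto
      have "f y / H y \<le> (f y / H y) powr p * t powr (1 - p) / p + t * (p - 1) / p"
        by (rule young_scaled) (use H f t p in auto)
      then have "k y * H y * (f y / H y) \<le> k y * H y * ((f y / H y) powr p * t powr (1 - p) / p + t * (p - 1) / p)"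
        using H k by (intro mult_left_mono) auto
      also have "(f y / H y) powr p = f y powr p * H y powr (1 - p) / H y"
        using H f by (simp add: powr_divide powr_diff)
      finally have "k y * f y \<le> t powr (1 - p) / p * (k y * (f y powr p * H y powr (1 - p))) + t * (p - 1) / p * (k y * H y)"
        using H by (simp add: field_simps)
      then show "ennreal (k y * f y) \<le> ennreal (t powr (1 - p) / p) * ennreal (k y * (f y powr p * H y powr (1 - p)))
          + ennreal (t * (p - 1) / p) * ennreal (k y * H y)"
        using H k t p f by (simp add: ennreal_mult[symmetric] ennreal_plus[symmetric] ennreal_leI del: ennreal_plus)
    qed
    also have "\<dots> = ennreal (t powr (1 - p) / p) * ennreal J + ennreal (t * (p - 1) / p) * (\<integral>\<^sup>+y. ennreal (k y * H y) \<partial>M)"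
      by (subst nn_integral_add, measurable) (subst nn_integral_cmult, measurable, subst nn_integral_cmult, measurable, simp add: J)
    also have "\<dots> \<le> ennreal (t powr (1 - p) / p) * ennreal J + ennreal (t * (p - 1) / p) * ennreal A"
      by (intro add_left_mono mult_left_mono A) auto
    also have "\<dots> = ennreal (t powr (1 - p) / p * J + t * (p - 1) / p * A)"
      using t p A J by (simp add: ennreal_mult[symmetric] ennreal_plus[symmetric] del: ennreal_plus)
    finally show ?thesis .
  qed
  show ?thesis
  proof (cases "J = 0")
    case True
    have "(\<integral>\<^sup>+y. ennreal (k y * f y) \<partial>M) \<le> 0 + ennreal e" if e: "e > 0" for e
    proof -
      \<comment> \<open>With \<open>J = 0\<close> only the second term is left, and this
        \<open>t\<close> makes it equal to \<open>e\<close>.\<close>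
      define t where "t = e * p / ((p - 1) * A)"
      have "t > 0" using e p A by (simp add: t_def)
      from main[OF this] show ?thesis using p A True by (simp add: t_def)
    qed
    then have "(\<integral>\<^sup>+y. ennreal (k y * f y) \<partial>M) \<le> 0"
      by (rule ennreal_le_epsilon)
    then show ?thesis by simp
  next
    case False
    then have J0: "J > 0" using J by simp
    \<comment> \<open>The minimiser of the bound in \<open>t\<close>: it makes
      \<open>t powr (1 - p) * J\<close> and \<open>t * A\<close> equal.\<close>
    define t where "t = (J / A) powr (1 / p)"
    have t: "t > 0" using J0 A by (simp add: t_def)
    have tp: "t powr p = J / A" using J0 A p by (simp add: t_def powr_powr)
    have eq: "t powr (1 - p) * J = t * A"
      using t A J0 by (simp add: powr_diff tp)
    have "t powr (1 - p) / p * J + t * (p - 1) / p * A = (t powr (1 - p) * J) / p + t * A * ((p - 1) / p)"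
      by simp
    also have "\<dots> = t * A * (1 / p + (p - 1) / p)" unfolding eq by (simp add: distrib_left)
    also have "1 / p + (p - 1) / p = 1" using p by (simp add: add_divide_distrib[symmetric])
    finally have "t powr (1 - p) / p * J + t * (p - 1) / p * A = t * A" by simp
    also have "\<dots> = (A powr (p - 1) * J) powr (1 / p)"
    proof -
      have "t * A = (J / A) powr (1 / p) * (A powr p) powr (1 / p)"
        using p A by (simp add: t_def powr_powr)
      also have "\<dots> = (J / A * A powr p) powr (1 / p)"
        using J0 A by (subst powr_mult) auto
      also have "J / A * A powr p = A powr (p - 1) * J"
        using A by (simp add: powr_diff)
      finally show ?thesis .
    qed
    finally show ?thesis using main[OF t] by simp
  qed
qed

text \<open>In terms of the customary Schur function h and the conjugate exponent q,
  \<open>H\<close> is h^q and \<open>H powr (p - 1)\<close> is h^p. Hoelder's inequality bounds the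
  p-th power of the integral by \<open>(C * H x) powr (p - 1)\<close> times \<open>J x\<close>;
  integrating in \<open>x\<close> first and using the second hypothesis removes the weight.
  Finiteness almost everywhere is what makes \<open>enn2real\<close> faithful.\<close>

lemma schur_test:
  fixes k :: "'a \<Rightarrow> 'a \<Rightarrow> real" and f H :: "'a \<Rightarrow> real"
  assumes "sigma_finite_measure M"
    and [measurable]: "(\<lambda>(x, y). k x y) \<in> borel_measurable (M \<Otimes>\<^sub>M M)"
      "f \<in> borel_measurable M" "H \<in> borel_measurable M"
    and nonneg: "\<And>x y. x \<in> space M \<Longrightarrow> y \<in> space M \<Longrightarrow> 0 \<le> k x y" "\<And>y. y \<in> space M \<Longrightarrow> 0 \<le> f y"
      "\<And>y. y \<in> space M \<Longrightarrow> 0 < H y"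
    and p: "p > 1" and C: "C > 0"
    and A1: "\<And>x. x \<in> space M \<Longrightarrow> (\<integral>\<^sup>+y. ennreal (k x y * H y) \<partial>M) \<le> ennreal (C * H x)"
    and A2: "\<And>y. y \<in> space M \<Longrightarrow> (\<integral>\<^sup>+x. ennreal (k x y * H x powr (p - 1)) \<partial>M) \<le> ennreal (C * H y powr (p - 1))"
    and f: "(\<integral>\<^sup>+y. ennreal (f y powr p) \<partial>M) < \<infinity>"
  shows "AE x in M. (\<integral>\<^sup>+y. ennreal (k x y * f y) \<partial>M) < \<infinity>"
    and "(\<integral>\<^sup>+x. ennreal (enn2real (\<integral>\<^sup>+y. ennreal (k x y * f y) \<partial>M) powr p) \<partial>M)
        \<le> ennreal (C powr p) * (\<integral>\<^sup>+y. ennreal (f y powr p) \<partial>M)"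
proof -
  let ?S = "\<lambda>x. \<integral>\<^sup>+y. ennreal (k x y * f y) \<partial>M" and ?F = "\<integral>\<^sup>+y. ennreal (f y powr p) \<partial>M"
  interpret sigma_finite_measure M by fact
  interpret pair_sigma_finite M M ..
  have [measurable]: "(\<lambda>y. k x y) \<in> borel_measurable M" if "x \<in> space M" for x
    using measurable_compose[OF measurable_Pair1' assms(2), OF that] by simp
  have [measurable]: "(\<lambda>x. k x y) \<in> borel_measurable M" if "y \<in> space M" for y
    using measurable_compose[OF measurable_Pair2' assms(2), OF that] by simp
  define J where "J = (\<lambda>x. \<integral>\<^sup>+y. ennreal (k x y * (f y powr p * H y powr (1 - p))) \<partial>M)"
  have [measurable]: "J \<in> borel_measurable M" unfolding J_def by measurable
  have "(\<integral>\<^sup>+x. J x * ennreal (H x powr (p - 1)) \<partial>M)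
      = (\<integral>\<^sup>+x. \<integral>\<^sup>+y. ennreal (k x y * (f y powr p * H y powr (1 - p))) * ennreal (H x powr (p - 1)) \<partial>M \<partial>M)"
    unfolding J_def by (intro nn_integral_cong nn_integral_multc[symmetric]) measurable
  also have "\<dots> = (\<integral>\<^sup>+y. \<integral>\<^sup>+x. ennreal (k x y * (f y powr p * H y powr (1 - p))) * ennreal (H x powr (p - 1)) \<partial>M \<partial>M)"
    by (rule Fubini'[symmetric]) measurable
  also have "\<dots> = (\<integral>\<^sup>+y. ennreal (f y powr p * H y powr (1 - p)) * (\<integral>\<^sup>+x. ennreal (k x y * H x powr (p - 1)) \<partial>M) \<partial>M)"
  proof (rule nn_integral_cong)
    fix y assume y[measurable]: "y \<in> space M"
    have "(\<integral>\<^sup>+x. ennreal (k x y * (f y powr p * H y powr (1 - p))) * ennreal (H x powr (p - 1)) \<partial>M)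
      = (\<integral>\<^sup>+x. ennreal (f y powr p * H y powr (1 - p)) * ennreal (k x y * H x powr (p - 1)) \<partial>M)"
      using nonneg y by (intro nn_integral_cong) (simp add: ennreal_mult[symmetric] mult_ac)
    then show "(\<integral>\<^sup>+x. ennreal (k x y * (f y powr p * H y powr (1 - p))) * ennreal (H x powr (p - 1)) \<partial>M)
      = ennreal (f y powr p * H y powr (1 - p)) * (\<integral>\<^sup>+x. ennreal (k x y * H x powr (p - 1)) \<partial>M)"
      by (subst nn_integral_cmult[symmetric]) simp_all
  qed
  also have "\<dots> \<le> (\<integral>\<^sup>+y. ennreal C * ennreal (f y powr p) \<partial>M)"
  proof (rule nn_integral_mono)
    fix y assume y: "y \<in> space M"
    have "ennreal (f y powr p * H y powr (1 - p)) * (\<integral>\<^sup>+x. ennreal (k x y * H x powr (p - 1)) \<partial>M)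
      \<le> ennreal (f y powr p * H y powr (1 - p)) * ennreal (C * H y powr (p - 1))"
      by (intro mult_left_mono A2 y) auto
    also have "\<dots> = ennreal (f y powr p * H y powr (1 - p) * (C * H y powr (p - 1)))"
      using C by (subst ennreal_mult) auto
    also have "f y powr p * H y powr (1 - p) * (C * H y powr (p - 1)) = C * f y powr p * (H y powr (1 - p) * H y powr (p - 1))"
      by (simp add: mult_ac)
    also have "H y powr (1 - p) * H y powr (p - 1) = 1"
      using nonneg(3)[OF y] by (simp add: powr_add[symmetric])
    finally show "ennreal (f y powr p * H y powr (1 - p)) * (\<integral>\<^sup>+x. ennreal (k x y * H x powr (p - 1)) \<partial>M)
        \<le> ennreal C * ennreal (f y powr p)"
      using C by (simp add: ennreal_mult)
  qed
  also have "\<dots> = ennreal C * ?F"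
    by (rule nn_integral_cmult) simp
  finally have JH: "(\<integral>\<^sup>+x. J x * ennreal (H x powr (p - 1)) \<partial>M) \<le> ennreal C * ?F" .
  also have "\<dots> < \<infinity>" using f by (simp add: ennreal_mult_less_top)
  finally have "(\<integral>\<^sup>+x. J x * ennreal (H x powr (p - 1)) \<partial>M) \<noteq> \<infinity>" by simp
  then have "AE x in M. J x * ennreal (H x powr (p - 1)) \<noteq> \<infinity>"
    by (intro nn_integral_PInf_AE) simp_all
  then have AEJ: "AE x in M. J x < \<infinity>"
    using AE_space
  proof eventually_elim
    case (elim x)
    then show ?case using nonneg(3)[of x] by (auto simp: ennreal_mult_eq_top_iff less_top)
  qed
  have bound: "?S x \<le> ennreal (((C * H x) powr (p - 1) * enn2real (J x)) powr (1 / p))"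
    if x: "x \<in> space M" and fin: "J x < \<infinity>" for x
    using that nonneg C p A1[OF x] by (intro nn_integral_kernel_holder[where H=H]) (auto simp: J_def)
  show "AE x in M. ?S x < \<infinity>"
    using AEJ AE_space
    by eventually_elim (metis bound ennreal_less_top infinity_ennreal_def le_less_trans)
  have "(\<integral>\<^sup>+x. ennreal (enn2real (?S x) powr p) \<partial>M)
    \<le> (\<integral>\<^sup>+x. ennreal (C powr (p - 1)) * (J x * ennreal (H x powr (p - 1))) \<partial>M)"
  proof (rule nn_integral_mono_AE)
    show "AE x in M. ennreal (enn2real (?S x) powr p)
        \<le> ennreal (C powr (p - 1)) * (J x * ennreal (H x powr (p - 1)))"
      using AEJ AE_space
    proof eventually_elim
      case (elim x)
      have H: "H x > 0" using nonneg elim by auto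
      have "enn2real (?S x) \<le> ((C * H x) powr (p - 1) * enn2real (J x)) powr (1 / p)"
        using enn2real_mono[OF bound[OF elim(2,1)]] by simp
      then have "enn2real (?S x) powr p
          \<le> (((C * H x) powr (p - 1) * enn2real (J x)) powr (1 / p)) powr p"
        using p by (intro powr_mono2) auto
      also have "\<dots> = (C * H x) powr (p - 1) * enn2real (J x)"
        using p by (simp add: powr_powr)
      also have "\<dots> = C powr (p - 1) * (enn2real (J x) * H x powr (p - 1))"
        using C H by (simp add: powr_mult)
      finally have "ennreal (enn2real (?S x) powr p)
          \<le> ennreal (C powr (p - 1) * (enn2real (J x) * H x powr (p - 1)))"
        by (rule ennreal_leI)
      also have "\<dots> = ennreal (C powr (p - 1)) * (J x * ennreal (H x powr (p - 1)))"
        using elim by (simp add: ennreal_mult)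
      finally show ?case .
    qed
  qed
  also have "\<dots> = ennreal (C powr (p - 1)) * (\<integral>\<^sup>+x. J x * ennreal (H x powr (p - 1)) \<partial>M)"
    by (rule nn_integral_cmult) simp
  also have "\<dots> \<le> ennreal (C powr (p - 1)) * (ennreal C * ?F)"
    by (intro mult_left_mono JH) simp
  also have "\<dots> = ennreal (C powr p) * ?F"
    using C by (simp add: mult.assoc[symmetric] ennreal_mult[symmetric] powr_diff)
  finally show "(\<integral>\<^sup>+x. ennreal (enn2real (?S x) powr p) \<partial>M)
        \<le> ennreal (C powr p) * ?F" .
qed

section \<open>Spaces of p-integrable functions and orthogonal projections\<close>

lemma Lp_space_iff:
  "f \<in> Lp_space p M \<longleftrightarrow> f \<in> borel_measurable M \<and> (\<integral>\<^sup>+z. ennreal (norm (f z) powr p) \<partial>M) < \<infinity>"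
  unfolding Lp_space_def by (auto simp: integrable_iff_bounded)

lemma Lp_space_2_iff:
  "f \<in> Lp_space 2 M \<longleftrightarrow> f \<in> borel_measurable M \<and> integrable M (\<lambda>z. (norm (f z))\<^sup>2)"
  unfolding Lp_space_def by auto

lemma nn_integral_Lp_norm:
  assumes "f \<in> Lp_space p M" and "p > 0"
  shows "(\<integral>\<^sup>+z. ennreal (norm (f z) powr p) \<partial>M) = ennreal (Lp_norm p M f powr p)"
proof -
  have int: "integrable M (\<lambda>z. norm (f z) powr p)" using assms by (simp add: Lp_space_def)
  have "Lp_norm p M f powr p = (LINT z|M. norm (f z) powr p)"
    using assms(2) by (simp add: Lp_norm_def powr_powr)
  then show ?thesis using nn_integral_eq_integral[OF int] by simp
qed

lemma Lp_norm_nonneg [simp]: "0 \<le> Lp_norm p M f"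
  by (simp add: Lp_norm_def)

lemma Lp_space_normI:
  assumes "f \<in> borel_measurable M" and "p > 0" and "B \<ge> 0"
    and "(\<integral>\<^sup>+z. ennreal (norm (f z) powr p) \<partial>M) \<le> ennreal (B powr p)"
  shows "f \<in> Lp_space p M \<and> Lp_norm p M f \<le> B"
proof -
  have f: "f \<in> Lp_space p M"
    using assms by (auto simp: Lp_space_iff intro: le_less_trans)
  then have "ennreal (Lp_norm p M f powr p) \<le> ennreal (B powr p)"
    using assms nn_integral_Lp_norm[OF f] by simp
  then have "Lp_norm p M f powr p \<le> B powr p" by simp
  then have "Lp_norm p M f \<le> B"
    using powr_less_mono2[OF \<open>p > 0\<close> \<open>B \<ge> 0\<close>, of "Lp_norm p M f"] by fastforce
  then show ?thesis using f by simp
qed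

lemma integrable_L2_product:
  assumes f: "f \<in> Lp_space 2 M" and g: "g \<in> Lp_space 2 M"
  shows "integrable M (\<lambda>z. f z * cnj (g z))"
proof (rule Bochner_Integration.integrable_bound[where f="\<lambda>z. (norm (f z))\<^sup>2 + (norm (g z))\<^sup>2"])
  show "integrable M (\<lambda>z. (norm (f z))\<^sup>2 + (norm (g z))\<^sup>2)"
    using f g by (simp add: Lp_space_2_iff)
  have [measurable]: "f \<in> borel_measurable M" "g \<in> borel_measurable M"
    using f g by (simp_all add: Lp_space_2_iff)
  show "(\<lambda>z. f z * cnj (g z)) \<in> borel_measurable M" by measurable
  show "AE z in M. norm (f z * cnj (g z)) \<le> norm ((norm (f z))\<^sup>2 + (norm (g z))\<^sup>2)"
  proof (rule AE_I2)
    fix z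
    have "2 * (norm (f z) * norm (g z)) \<le> (norm (f z))\<^sup>2 + (norm (g z))\<^sup>2"
      using sum_squares_bound[of "norm (f z)" "norm (g z)"] by (simp add: mult.assoc)
    moreover have "0 \<le> norm (f z) * norm (g z)" by simp
    ultimately have "norm (f z) * norm (g z) \<le> (norm (f z))\<^sup>2 + (norm (g z))\<^sup>2" by linarith
    then show "norm (f z * cnj (g z)) \<le> norm ((norm (f z))\<^sup>2 + (norm (g z))\<^sup>2)"
      by (simp add: norm_mult)
  qed
qed

lemma Lp_space_2_diff:
  assumes f: "f \<in> Lp_space 2 M" and g: "g \<in> Lp_space 2 M"
  shows "(\<lambda>z. f z - g z) \<in> Lp_space 2 M"
  unfolding Lp_space_2_iff
proof
  show "integrable M (\<lambda>z. (norm (f z - g z))\<^sup>2)"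
  proof (rule Bochner_Integration.integrable_bound[where f="\<lambda>z. 2 * (norm (f z))\<^sup>2 + 2 * (norm (g z))\<^sup>2"])
    show "AE z in M. norm ((norm (f z - g z))\<^sup>2) \<le> norm (2 * (norm (f z))\<^sup>2 + 2 * (norm (g z))\<^sup>2)"
    proof (rule AE_I2)
      fix z
      have "(norm (f z - g z))\<^sup>2 \<le> (norm (f z) + norm (g z))\<^sup>2"
        by (intro power_mono norm_triangle_ineq4) auto
      also have "\<dots> \<le> 2 * (norm (f z))\<^sup>2 + 2 * (norm (g z))\<^sup>2"
        using sum_squares_bound[of "norm (f z)" "norm (g z)"] by (simp add: power2_sum)
      finally show "norm ((norm (f z - g z))\<^sup>2) \<le> norm (2 * (norm (f z))\<^sup>2 + 2 * (norm (g z))\<^sup>2)"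
        by simp
    qed
  qed (use f g in \<open>auto simp: Lp_space_2_iff\<close>)
qed (use f g in \<open>auto simp: Lp_space_2_iff\<close>)

text \<open>The projection is picked by \<open>SOME\<close>; the witness \<open>P\<close> makes the
  choice meaningful. The chosen element and \<open>P\<close> differ by an element of
  \<open>V\<close> that is orthogonal to itself, hence vanishes almost everywhere.\<close>

lemma orthogonal_projection_unique:
  assumes f: "f \<in> Lp_space 2 M" and V: "V \<subseteq> Lp_space 2 M"
    and V_diff: "\<And>g h. g \<in> V \<Longrightarrow> h \<in> V \<Longrightarrow> (\<lambda>z. g z - h z) \<in> V"
    and P: "P \<in> V" "\<And>h. h \<in> V \<Longrightarrow> L2_inner M (\<lambda>z. f z - P z) h = 0"
  shows "orthogonal_projection M V f \<in> V"
    and "AE z in M. orthogonal_projection M V f z = P z"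
proof -
  define g where "g = orthogonal_projection M V f"
  have "g \<in> V \<and> (\<forall>h\<in>V. L2_inner M (\<lambda>z. f z - g z) h = 0)"
    unfolding g_def orthogonal_projection_def by (rule someI[where x=P]) (use P in auto)
  then have g: "g \<in> V" "\<And>h. h \<in> V \<Longrightarrow> L2_inner M (\<lambda>z. f z - g z) h = 0" by auto
  show "orthogonal_projection M V f \<in> V" using g(1) by (simp add: g_def)
  define d where "d = (\<lambda>z. g z - P z)"
  have d: "d \<in> V" unfolding d_def by (rule V_diff[OF g(1) P(1)])
  have dL: "d \<in> Lp_space 2 M" using d V by auto
  have "L2_inner M (\<lambda>z. f z - P z) d - L2_inner M (\<lambda>z. f z - g z) d
      = (LINT z|M. (f z - P z) * cnj (d z) - (f z - g z) * cnj (d z))"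
    unfolding L2_inner_def
    using P(1) g(1) V f
    by (intro Bochner_Integration.integral_diff[symmetric] integrable_L2_product[OF _ dL] Lp_space_2_diff) auto
  also have "\<dots> = (LINT z|M. of_real ((norm (d z))\<^sup>2))"
  proof (rule Bochner_Integration.integral_cong)
    fix z
    have "(f z - P z) * cnj (d z) - (f z - g z) * cnj (d z) = d z * cnj (d z)"
      by (simp add: d_def algebra_simps)
    then show "(f z - P z) * cnj (d z) - (f z - g z) * cnj (d z) = of_real ((norm (d z))\<^sup>2)"
      by (simp only: complex_norm_square)
  qed simp
  also have "\<dots> = of_real (LINT z|M. (norm (d z))\<^sup>2)" by (rule integral_complex_of_real)
  finally have "(LINT z|M. (norm (d z))\<^sup>2) = 0"
    using P(2)[OF d] g(2)[OF d] by simp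
  then have "AE z in M. (norm (d z))\<^sup>2 = 0"
    using integral_nonneg_eq_0_iff_AE[of M "\<lambda>z. (norm (d z))\<^sup>2"] dL by (simp add: Lp_space_2_iff)
  then show "AE z in M. orthogonal_projection M V f z = P z"
    by eventually_elim (simp add: d_def g_def)
qed

text \<open>Dominated convergence for the normalised remainders along a sequence: by the mean value
  inequality on the ball, increment and linear part are each at most \<open>G x\<close> times the
  distance, whence the majorant \<open>2 * G x\<close>. The derivative is real linear; complex
  linearity is recovered where the lemma is applied.\<close>

lemma has_derivative_integral_param:
  fixes F :: "'b::real_normed_vector \<Rightarrow> 'a \<Rightarrow> 'c::{banach, second_countable_topology}"
  assumes r: "r > 0"
    and der: "\<And>z x. z \<in> ball z0 r \<Longrightarrow> x \<in> space M \<Longrightarrow> ((\<lambda>z. F z x) has_derivative F' z x) (at z)"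
    and bd: "\<And>z x h. z \<in> ball z0 r \<Longrightarrow> x \<in> space M \<Longrightarrow> norm (F' z x h) \<le> G x * norm h"
    and int: "\<And>z. z \<in> ball z0 r \<Longrightarrow> integrable M (F z)" and G: "integrable M G"
    and meas: "\<And>h. (\<lambda>x. F' z0 x h) \<in> borel_measurable M"
  shows "((\<lambda>z. LINT x|M. F z x) has_derivative (\<lambda>h. LINT x|M. F' z0 x h)) (at z0)"
proof -
  have z0: "z0 \<in> ball z0 r" using r by simp
  note lin = has_derivative_bounded_linear[OF der[OF z0]]
  have int': "integrable M (\<lambda>x. F' z0 x h)" for h
  proof (rule Bochner_Integration.integrable_bound[where f="\<lambda>x. G x * norm h"])
    show "AE x in M. norm (F' z0 x h) \<le> norm (G x * norm h)"
      using bd[OF z0] by (intro AE_I2) (metis abs_ge_self order_trans real_norm_def)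
  qed (use G meas in auto)
  have nG: "norm (LINT x|M. F' z0 x h) \<le> norm h * (LINT x|M. G x)" for h
  proof -
    have "norm (LINT x|M. F' z0 x h) \<le> (LINT x|M. norm (F' z0 x h))" by simp
    also have "\<dots> \<le> (LINT x|M. G x * norm h)"
      using int' G bd[OF z0] by (intro integral_mono) auto
    finally show ?thesis by (simp add: mult.commute)
  qed
  show ?thesis
    unfolding has_derivative_iff_norm
  proof (intro conjI)
    show "bounded_linear (\<lambda>h. LINT x|M. F' z0 x h)"
    proof (rule bounded_linear_intro[OF _ _ nG])
      fix a b :: 'b and c :: real
      have "(LINT x|M. F' z0 x (a + b)) = (LINT x|M. F' z0 x a + F' z0 x b)"
        using lin by (intro Bochner_Integration.integral_cong) (auto simp: linear_simps)
      also have "\<dots> = (LINT x|M. F' z0 x a) + (LINT x|M. F' z0 x b)"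
        by (intro Bochner_Integration.integral_add int')
      finally show "(LINT x|M. F' z0 x (a + b)) = (LINT x|M. F' z0 x a) + (LINT x|M. F' z0 x b)" .
      have "(LINT x|M. F' z0 x (c *\<^sub>R a)) = (LINT x|M. c *\<^sub>R F' z0 x a)"
        using lin by (intro Bochner_Integration.integral_cong) (auto simp: linear_simps)
      then show "(LINT x|M. F' z0 x (c *\<^sub>R a)) = c *\<^sub>R (LINT x|M. F' z0 x a)" by simp
    qed
    show "((\<lambda>y. norm ((LINT x|M. F y x) - (LINT x|M. F z0 x) - (LINT x|M. F' z0 x (y - z0))) / norm (y - z0)) \<longlongrightarrow> 0) (at z0)"
      unfolding tendsto_at_iff_sequentially comp_def
    proof (intro allI impI)
      fix X :: "nat \<Rightarrow> 'b"
      assume X0: "\<forall>i. X i \<in> UNIV - {z0}" and X: "X \<longlonglongrightarrow> z0"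
      have "eventually (\<lambda>i. X i \<in> ball z0 r) sequentially"
        using X r by (simp add: tendsto_iff dist_commute)
      then obtain N where N: "\<And>i. i \<ge> N \<Longrightarrow> X i \<in> ball z0 r" by (auto simp: eventually_sequentially)
      define Y where "Y = (\<lambda>i. X (i + N))"
      have Y: "Y i \<in> ball z0 r" "Y i \<noteq> z0" for i using N X0 by (auto simp: Y_def)
      have Ylim: "Y \<longlonglongrightarrow> z0" unfolding Y_def by (rule LIMSEQ_ignore_initial_segment[OF X])
      define q where "q = (\<lambda>i x. norm (F (Y i) x - F z0 x - F' z0 x (Y i - z0)) / norm (Y i - z0))"
      have q_int: "integrable M (q i)" for i
        unfolding q_def by (intro integrable_divide integrable_norm Bochner_Integration.integrable_diff int int' Y z0)
      have "(\<lambda>i. LINT x|M. q i x) \<longlonglongrightarrow> (LINT x|M. 0)"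
      proof (rule integral_dominated_convergence[where w="\<lambda>x. 2 * G x"])
        show "AE x in M. (\<lambda>i. q i x) \<longlonglongrightarrow> 0"
        proof (rule AE_I2)
          fix x assume "x \<in> space M"
          from der[OF z0 this] have "((\<lambda>y. norm (F y x - F z0 x - F' z0 x (y - z0)) / norm (y - z0)) \<longlongrightarrow> 0) (at z0)"
            by (simp add: has_derivative_iff_norm)
          then show "(\<lambda>i. q i x) \<longlonglongrightarrow> 0"
            unfolding tendsto_at_iff_sequentially comp_def q_def using Y(2) Ylim by auto
        qed
        show "AE x in M. norm (q i x) \<le> 2 * G x" for i
        proof (rule AE_I2)
          fix x assume x: "x \<in> space M"
          have "0 \<le> G x * norm (Y i - z0)"
            by (rule order_trans[OF norm_ge_zero bd[OF z0 x]])
          then have G0: "0 \<le> G x" using Y(2)[of i] by (simp add: zero_le_mult_iff)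
          have "norm (F (Y i) x - F z0 x) \<le> G x * norm (Y i - z0)"
          proof (rule differentiable_bound[of "ball z0 r" "\<lambda>z. F z x" "\<lambda>z. F' z x"])
            show "onorm (F' z x) \<le> G x" if "z \<in> ball z0 r" for z
              using bd[OF that x] G0 by (intro onorm_bound) auto
          qed (use der x Y z0 in \<open>auto intro: has_derivative_at_withinI\<close>)
          moreover have "norm (F' z0 x (Y i - z0)) \<le> G x * norm (Y i - z0)" by (rule bd[OF z0 x])
          ultimately have "norm (F (Y i) x - F z0 x - F' z0 x (Y i - z0)) \<le> 2 * G x * norm (Y i - z0)"
            using norm_triangle_ineq4[of "F (Y i) x - F z0 x" "F' z0 x (Y i - z0)"] by linarith
          then show "norm (q i x) \<le> 2 * G x"
            using Y(2)[of i] by (simp add: q_def divide_le_eq)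
        qed
      qed (use G q_int in auto)
      then have lim: "(\<lambda>i. LINT x|M. q i x) \<longlonglongrightarrow> 0" by simp
      have "(\<lambda>i. norm ((LINT x|M. F (Y i) x) - (LINT x|M. F z0 x) - (LINT x|M. F' z0 x (Y i - z0))) / norm (Y i - z0)) \<longlonglongrightarrow> 0"
      proof (rule tendsto_sandwich[OF _ _ tendsto_const lim])
        have "norm ((LINT x|M. F (Y i) x) - (LINT x|M. F z0 x) - (LINT x|M. F' z0 x (Y i - z0))) / norm (Y i - z0) \<le> (LINT x|M. q i x)" for i
        proof -
          have "(LINT x|M. F (Y i) x) - (LINT x|M. F z0 x) - (LINT x|M. F' z0 x (Y i - z0))
            = (LINT x|M. F (Y i) x - F z0 x - F' z0 x (Y i - z0))"
          proof -
            have "(LINT x|M. F (Y i) x - F z0 x - F' z0 x (Y i - z0))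
                = (LINT x|M. F (Y i) x - F z0 x) - (LINT x|M. F' z0 x (Y i - z0))"
              by (intro Bochner_Integration.integral_diff Bochner_Integration.integrable_diff int int' Y z0)
            also have "(LINT x|M. F (Y i) x - F z0 x) = (LINT x|M. F (Y i) x) - (LINT x|M. F z0 x)"
              by (intro Bochner_Integration.integral_diff int Y z0)
            finally show ?thesis by simp
          qed
          then have "norm ((LINT x|M. F (Y i) x) - (LINT x|M. F z0 x) - (LINT x|M. F' z0 x (Y i - z0)))
            \<le> (LINT x|M. norm (F (Y i) x - F z0 x - F' z0 x (Y i - z0)))" by simp
          then show ?thesis unfolding q_def by (simp add: divide_right_mono)
        qed
        then show "eventually (\<lambda>i. norm ((LINT x|M. F (Y i) x) - (LINT x|M. F z0 x) - (LINT x|M. F' z0 x (Y i - z0))) / norm (Y i - z0) \<le> (LINT x|M. q i x)) sequentially"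
          by (rule always_eventually[OF allI])
      qed simp
      then show "(\<lambda>i. norm ((LINT x|M. F (X i) x) - (LINT x|M. F z0 x) - (LINT x|M. F' z0 x (X i - z0))) / norm (X i - z0)) \<longlonglongrightarrow> 0"
        unfolding Y_def by (rule LIMSEQ_offset)
    qed
  qed
qed

section \<open>The weighted Hartogs triangle\<close>

lemma borel_measurable_power_int [measurable (raw)]:
  fixes f :: "'a \<Rightarrow> 'b::{real_normed_field, second_countable_topology}"
  assumes [measurable]: "f \<in> borel_measurable M"
  shows "(\<lambda>x. f x powi m) \<in> borel_measurable M"
  unfolding power_int_def by measurable

lemma borel_measurable_fst_snd [measurable]:
  "fst \<in> borel_measurable (borel :: ('a::second_countable_topology \<times> 'b::second_countable_topology) measure)"
  "snd \<in> borel_measurable (borel :: ('a::second_countable_topology \<times> 'b::second_countable_topology) measure)"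
  by (simp_all flip: borel_prod)

lemma norm_power_int_eq_powr:
  fixes z :: "'a::real_normed_field"
  assumes "z \<noteq> 0"
  shows "norm (z powi m) = norm z powr of_int m"
  using assms by (simp add: norm_power_int powr_real_of_int')

lemma open_hartogs_triangle: "open hartogs_triangle"
proof -
  have "hartogs_triangle = {z. norm (fst z) < norm (snd z)} \<inter> {z. norm (snd z) < 1}"
    by (auto simp: hartogs_triangle_def)
  moreover have "open {z :: complex \<times> complex. norm (fst z) < norm (snd z)}"
    "open {z :: complex \<times> complex. norm (snd z) < 1}"
    by (intro open_Collect_less continuous_intros)+
  ultimately show ?thesis by (metis open_Int)
qed

lemma borel_hartogs_triangle [measurable]: "hartogs_triangle \<in> sets borel"
  using open_hartogs_triangle by simp

lemma hartogs_triangleD: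
  assumes "z \<in> hartogs_triangle"
  shows "snd z \<noteq> 0" "0 < norm (snd z)" "norm (snd z) < 1" "norm (fst z / snd z) < 1"
proof -
  have *: "norm (fst z) < norm (snd z)" "norm (snd z) < 1"
    using assms by (auto simp: hartogs_triangle_def)
  then show "norm (snd z) < 1" by simp
  show "snd z \<noteq> 0" using * by auto
  then show "0 < norm (snd z)" by simp
  then show "norm (fst z / snd z) < 1" using * by (simp add: norm_divide)
qed

lemma hartogs_triangle_mult_iff: "w \<noteq> 0 \<Longrightarrow> (u * w, w) \<in> hartogs_triangle \<longleftrightarrow> norm u < 1 \<and> norm w < 1"
  by (simp add: hartogs_triangle_def norm_mult)

lemma sigma_finite_lebesgue: "sigma_finite_measure (lebesgue :: 'a::euclidean_space measure)"
proof
  obtain A :: "'a set set" where A: "countable A" "A \<subseteq> sets lborel" "\<Union>A = space lborel" "\<forall>a\<in>A. emeasure lborel a \<noteq> \<infinity>"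
    using lborel.sigma_finite_countable by auto
  have "emeasure lebesgue a \<noteq> \<infinity>" if "a \<in> A" for a
    using A that by (subst emeasure_completion) auto
  then show "\<exists>A. countable A \<and> A \<subseteq> sets (lebesgue :: 'a measure) \<and> \<Union>A = space (lebesgue :: 'a measure)
      \<and> (\<forall>a\<in>A. emeasure lebesgue a \<noteq> \<infinity>)"
    using A by (intro exI[of _ A]) auto
qed

section \<open>The measure on the triangle and its product coordinates\<close>

locale hartogs_weighted =
  fixes s :: real and n :: int
  assumes s_pos: "0 < s" and s_le: "s \<le> 2"
begin

text \<open>The shift by 4 in the exponent has two sources: the Jacobian
  \<open>(norm w)\<^sup>2\<close> of the fibre substitution and the normalisation
  \<open>norm w powr (s - 2)\<close> of the disc measure.\<close>

definition M :: "(complex \<times> complex) measure" where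
  "M = weighted_measure hartogs_triangle (hartogs_weight (s + 2 * of_int n - 4))"

text \<open>The factor \<open>norm w powr (2 * of_int n)\<close> stays in the integrands, so both
  disc measures are finite whatever the sign of \<open>n\<close>.\<close>

definition N :: "(complex \<times> complex) measure" where
  "N = disc_measure 2 \<Otimes>\<^sub>M disc_measure s"

sublocale D2: finite_measure "disc_measure 2" by (rule finite_disc_measure) simp
sublocale Ds: finite_measure "disc_measure s" by (rule finite_disc_measure[OF s_pos])
sublocale D: pair_sigma_finite "disc_measure 2" "disc_measure s" ..

lemma sets_N [simp, measurable_cong]: "sets N = sets (borel \<Otimes>\<^sub>M borel)"
  unfolding N_def by (intro sets_pair_measure_cong) simp_all

lemma borel_measurable_weight [measurable]: "hartogs_weight t \<in> borel_measurable borel"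
  unfolding hartogs_weight_def split_def by measurable

lemma space_M [simp]: "space M = hartogs_triangle"
  by (simp add: M_def weighted_measure_def)

lemma sets_M: "sets M = sets (lebesgue_on hartogs_triangle)"
  by (simp add: M_def weighted_measure_def)

lemma borel_subset_M: "A \<in> sets borel \<Longrightarrow> A \<inter> hartogs_triangle \<in> sets M"
  unfolding sets_M sets_restrict_space by (rule image_eqI[of _ _ A]) (simp_all add: Int_commute)

text \<open>\<open>M\<close> carries the Lebesgue measurable sets, whereas kernels and weights are
  Borel functions; the identity transports them.\<close>

lemma measurable_ident_M: "(\<lambda>x. x) \<in> measurable M borel"
  by (rule measurableI) (auto simp: borel_subset_M Int_commute)

lemma borel_measurable_M: "F \<in> measurable borel L \<Longrightarrow> F \<in> measurable M L"
  by (rule measurable_compose[OF measurable_ident_M])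

lemma borel_measurable_pair_M:
  "fst \<in> borel_measurable (M \<Otimes>\<^sub>M M)" "snd \<in> borel_measurable (M \<Otimes>\<^sub>M M)"
  by (rule measurable_compose[OF measurable_fst measurable_ident_M]
      measurable_compose[OF measurable_snd measurable_ident_M])+

lemma weight_measurable_lebesgue_on:
  "(\<lambda>z. ennreal (hartogs_weight t z)) \<in> borel_measurable (lebesgue_on hartogs_triangle)"
  by (intro measurable_restrict_space1 measurable_completion) measurable

lemma sigma_finite_M: "sigma_finite_measure M"
  unfolding M_def weighted_measure_def
proof (subst sigma_finite_measure.sigma_finite_iff_density_finite)
  show "sigma_finite_measure (lebesgue_on hartogs_triangle)"
    by (rule sigma_finite_measure_restrict_space) (auto intro: sigma_finite_lebesgue)
qed (use weight_measurable_lebesgue_on in auto)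

lemma nn_integral_M_lborel:
  assumes F[measurable]: "F \<in> borel_measurable borel"
  shows "(\<integral>\<^sup>+z. F z \<partial>M)
    = (\<integral>\<^sup>+z. F z * ennreal (hartogs_weight (s + 2 * of_int n - 4) z) * indicator hartogs_triangle z \<partial>lborel)"
proof -
  have [simp]: "hartogs_triangle \<in> sets lebesgue" by simp
  have F': "F \<in> borel_measurable (lebesgue_on hartogs_triangle)"
    by (intro measurable_restrict_space1 measurable_completion) simp
  have "(\<integral>\<^sup>+z. F z \<partial>M)
     = (\<integral>\<^sup>+z. ennreal (hartogs_weight (s + 2 * of_int n - 4) z) * F z \<partial>lebesgue_on hartogs_triangle)"
    unfolding M_def weighted_measure_def
    by (subst nn_integral_density[OF weight_measurable_lebesgue_on F']) simp
  also have "\<dots> = (\<integral>\<^sup>+z. ennreal (hartogs_weight (s + 2 * of_int n - 4) z) * F z * indicator hartogs_triangle z \<partial>lebesgue)"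
    by (subst nn_integral_restrict_space) simp_all
  finally show ?thesis by (simp add: nn_integral_completion mult.commute)
qed

text \<open>Tonelli followed, on each fibre \<open>w \<noteq> 0\<close>, by the substitution
  \<open>z1 = u * w\<close>, whose Jacobian comes from
  \<open>nn_integral_lborel_cmult\<close>.\<close>

lemma nn_integral_M:
  assumes F[measurable]: "F \<in> borel_measurable borel"
  shows "(\<integral>\<^sup>+z. F z \<partial>M)
    = (\<integral>\<^sup>+w. \<integral>\<^sup>+u. F (u * w, w) * ennreal (norm w powr (2 * of_int n)) \<partial>disc_measure 2 \<partial>disc_measure s)"
proof -
  define G where "G = (\<lambda>z. F z * ennreal (hartogs_weight (s + 2 * of_int n - 4) z) * indicator hartogs_triangle z)"
  have [measurable]: "G \<in> borel_measurable borel" unfolding G_def by measurable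
  have Fm[measurable]: "(\<lambda>p. F (fst p * snd p, snd p)) \<in> borel_measurable (borel \<Otimes>\<^sub>M borel)"
    by measurable
  have Fm2[measurable]: "(\<lambda>u. F (u * w, w)) \<in> borel_measurable borel" for w
    by measurable
  have "(\<integral>\<^sup>+z. F z \<partial>M) = (\<integral>\<^sup>+z. G z \<partial>lborel)"
    by (simp add: nn_integral_M_lborel G_def)
  also have "\<dots> = (\<integral>\<^sup>+z. G z \<partial>(lborel \<Otimes>\<^sub>M lborel))" by (simp add: lborel_prod)
  also have "\<dots> = (\<integral>\<^sup>+w. \<integral>\<^sup>+z1. G (z1, w) \<partial>lborel \<partial>lborel)"
    by (rule lborel_pair.nn_integral_snd[symmetric]) (simp add: lborel_prod)
  also have "\<dots> = (\<integral>\<^sup>+w. (\<integral>\<^sup>+u. F (u * w, w) * ennreal (norm w powr (2 * of_int n)) \<partial>disc_measure 2)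
      * ennreal (norm w powr (s - 2)) * indicator {w. 0 < norm w \<and> norm w < 1} w \<partial>lborel)"
  proof (rule nn_integral_cong)
    fix w :: complex
    show "(\<integral>\<^sup>+z1. G (z1, w) \<partial>lborel) = (\<integral>\<^sup>+u. F (u * w, w) * ennreal (norm w powr (2 * of_int n)) \<partial>disc_measure 2)
      * ennreal (norm w powr (s - 2)) * indicator {w. 0 < norm w \<and> norm w < 1} w"
    proof (cases "w = 0")
      case True
      then have "G (z1, w) = 0" for z1 by (simp add: G_def hartogs_triangle_def)
      then show ?thesis using True by simp
    next
      case False
      have pw: "(norm w)\<^sup>2 * norm w powr (s + 2 * of_int n - 4) = norm w powr (2 * of_int n) * norm w powr (s - 2)"
      proof -
        have "(norm w)\<^sup>2 * norm w powr (s + 2 * of_int n - 4) = norm w powr 2 * norm w powr (s + 2 * of_int n - 4)"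
          using False by simp
        also have "\<dots> = norm w powr (2 * of_int n + (s - 2))"
          unfolding powr_add[symmetric] by (simp add: algebra_simps)
        finally show ?thesis by (simp only: powr_add)
      qed
      have "(\<integral>\<^sup>+z1. G (z1, w) \<partial>lborel) = ennreal ((norm w)\<^sup>2) * (\<integral>\<^sup>+u. G (w * u, w) \<partial>lborel)"
        by (rule nn_integral_lborel_cmult[OF _ False]) measurable
      also have "\<dots> = (\<integral>\<^sup>+u. ennreal ((norm w)\<^sup>2) * G (u * w, w) \<partial>lborel)"
        by (subst nn_integral_cmult[symmetric]) (auto simp: mult.commute)
      also have "\<dots> = (\<integral>\<^sup>+u. (F (u * w, w) * ennreal (norm w powr (2 * of_int n)) * ennreal (norm u powr (2 - 2))
           * indicator {u. 0 < norm u \<and> norm u < 1} u) * (ennreal (norm w powr (s - 2)) * indicator {w. 0 < norm w \<and> norm w < 1} w) \<partial>lborel)"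
      proof (rule nn_integral_cong_AE)
        \<comment> \<open>The fibre of the triangle contains \<open>u = 0\<close>, which
          \<open>disc_measure 2\<close> omits; this is a null set.\<close>
        show "AE u in lborel. ennreal ((norm w)\<^sup>2) * G (u * w, w) =
          (F (u * w, w) * ennreal (norm w powr (2 * of_int n)) * ennreal (norm u powr (2 - 2))
           * indicator {u. 0 < norm u \<and> norm u < 1} u) * (ennreal (norm w powr (s - 2)) * indicator {w. 0 < norm w \<and> norm w < 1} w)"
          using AE_lborel_singleton[of "0::complex"]
        proof eventually_elim
          case (elim u)
          have 1: "ennreal ((norm w)\<^sup>2) * ennreal (hartogs_weight (s + 2 * of_int n - 4) (u * w, w))
              = ennreal (norm w powr (2 * of_int n)) * ennreal (norm w powr (s - 2))"
            by (simp add: hartogs_weight_def ennreal_mult[symmetric] pw)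
          have 2: "indicator hartogs_triangle (u * w, w) = (indicator {u. 0 < norm u \<and> norm u < 1} u
              * indicator {w. 0 < norm w \<and> norm w < 1} w :: ennreal)"
            using False elim by (simp add: indicator_def hartogs_triangle_mult_iff)
          have 3: "ennreal (norm u powr (2 - 2)) = 1" using elim by simp
          have rearrange: "x * (y * m * (i * j)) = y * (x * m) * (i * j)"
            "y * (t * r) * (i * j) = (y * t * 1 * i) * (r * j)" for x y m i j t r :: ennreal
            by (simp_all add: mult_ac)
          show ?case unfolding G_def 2 3 rearrange(1) 1 rearrange(2) by (rule refl)
        qed
      qed
      also have "\<dots> = (\<integral>\<^sup>+u. F (u * w, w) * ennreal (norm w powr (2 * of_int n)) * ennreal (norm u powr (2 - 2))
           * indicator {u. 0 < norm u \<and> norm u < 1} u \<partial>lborel) * (ennreal (norm w powr (s - 2)) * indicator {w. 0 < norm w \<and> norm w < 1} w)"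
        by (rule nn_integral_multc) measurable
      also have "(\<integral>\<^sup>+u. F (u * w, w) * ennreal (norm w powr (2 * of_int n)) * ennreal (norm u powr (2 - 2))
           * indicator {u. 0 < norm u \<and> norm u < 1} u \<partial>lborel)
         = (\<integral>\<^sup>+u. F (u * w, w) * ennreal (norm w powr (2 * of_int n)) \<partial>disc_measure 2)"
        by (rule nn_integral_disc_measure[symmetric]) measurable
      finally show ?thesis by (simp add: mult.assoc)
    qed
  qed
  also have "\<dots> = (\<integral>\<^sup>+w. \<integral>\<^sup>+u. F (u * w, w) * ennreal (norm w powr (2 * of_int n)) \<partial>disc_measure 2 \<partial>disc_measure s)"
    by (rule nn_integral_disc_measure[symmetric]) measurable
  finally show ?thesis .
qed

text \<open>Pushing \<open>M\<close> forward along the identity restricts it to Borel sets. On these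
  the change of variables is an equality of measures, and Bochner integrals of Borel functions
  follow it.\<close>

lemma distr_M:
  "distr M borel (\<lambda>z. z) = distr (density N (\<lambda>p. ennreal (norm (snd p) powr (2 * of_int n)))) borel
      (\<lambda>p. (fst p * snd p, snd p))"
proof (rule measure_eqI)
  fix A assume "A \<in> sets (distr M borel (\<lambda>z. z))"
  then have [measurable]: "A \<in> sets borel" by simp
  have [measurable]: "(\<lambda>p. indicator A (fst p * snd p, snd p) :: ennreal) \<in> borel_measurable (borel \<Otimes>\<^sub>M borel)"
    by measurable
  have "emeasure (distr M borel (\<lambda>z. z)) A = (\<integral>\<^sup>+z. indicator A z \<partial>distr M borel (\<lambda>z. z))"
    by simp
  also have "\<dots> = (\<integral>\<^sup>+z. indicator A z \<partial>M)"
    by (rule nn_integral_distr[OF measurable_ident_M]) simp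
  also have "\<dots> = (\<integral>\<^sup>+w. \<integral>\<^sup>+u. indicator A (u * w, w) * ennreal (norm w powr (2 * of_int n)) \<partial>disc_measure 2 \<partial>disc_measure s)"
    by (rule nn_integral_M) simp
  also have "\<dots> = (\<integral>\<^sup>+p. indicator A (fst p * snd p, snd p) * ennreal (norm (snd p) powr (2 * of_int n)) \<partial>N)"
    unfolding N_def by (subst D.nn_integral_snd[symmetric]) simp_all
  also have "\<dots> = (\<integral>\<^sup>+p. indicator A (fst p * snd p, snd p) \<partial>density N (\<lambda>p. ennreal (norm (snd p) powr (2 * of_int n))))"
    by (subst nn_integral_density) (simp_all add: mult.commute)
  also have "\<dots> = (\<integral>\<^sup>+z. indicator A z \<partial>distr (density N (\<lambda>p. ennreal (norm (snd p) powr (2 * of_int n)))) borel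
      (\<lambda>p. (fst p * snd p, snd p)))"
    by (rule nn_integral_distr[symmetric]) simp_all
  finally show "emeasure (distr M borel (\<lambda>z. z)) A = emeasure (distr (density N (\<lambda>p. ennreal (norm (snd p) powr (2 * of_int n)))) borel
      (\<lambda>p. (fst p * snd p, snd p))) A"
    by simp
qed simp

lemma
  fixes F :: "complex \<times> complex \<Rightarrow> complex"
  assumes F[measurable]: "F \<in> borel_measurable borel"
  shows integrable_M_iff: "integrable M F \<longleftrightarrow>
      integrable N (\<lambda>p. norm (snd p) powr (2 * of_int n) *\<^sub>R F (fst p * snd p, snd p))"
    and integral_M: "(LINT z|M. F z) = (LINT p|N. norm (snd p) powr (2 * of_int n) *\<^sub>R F (fst p * snd p, snd p))"
proof -
  have [measurable]: "(\<lambda>p. F (fst p * snd p, snd p)) \<in> borel_measurable (borel \<Otimes>\<^sub>M borel)"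
    by measurable
  let ?D = "density N (\<lambda>p. ennreal (norm (snd p) powr (2 * of_int n)))"
  have T: "(\<lambda>p. (fst p * snd p, snd p)) \<in> measurable ?D borel" by simp
  show "integrable M F \<longleftrightarrow> integrable N (\<lambda>p. norm (snd p) powr (2 * of_int n) *\<^sub>R F (fst p * snd p, snd p))"
  proof -
    have "integrable M F \<longleftrightarrow> integrable (distr M borel (\<lambda>z. z)) F"
      by (subst integrable_distr_eq[OF measurable_ident_M]) simp_all
    also have "\<dots> \<longleftrightarrow> integrable ?D (\<lambda>p. F (fst p * snd p, snd p))"
      unfolding distr_M by (subst integrable_distr_eq[OF T]) simp_all
    also have "\<dots> \<longleftrightarrow> integrable N (\<lambda>p. norm (snd p) powr (2 * of_int n) *\<^sub>R F (fst p * snd p, snd p))"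
      by (subst integrable_density) simp_all
    finally show ?thesis .
  qed
  have "(LINT z|M. F z) = (LINT z|distr M borel (\<lambda>z. z). F z)"
    by (subst integral_distr[OF measurable_ident_M]) simp_all
  also have "\<dots> = (LINT p|?D. F (fst p * snd p, snd p))"
    unfolding distr_M by (subst integral_distr[OF T]) simp_all
  also have "\<dots> = (LINT p|N. norm (snd p) powr (2 * of_int n) *\<^sub>R F (fst p * snd p, snd p))"
    by (subst integral_density) simp_all
  finally show "(LINT z|M. F z) = (LINT p|N. norm (snd p) powr (2 * of_int n) *\<^sub>R F (fst p * snd p, snd p))" .
qed

section \<open>The kernel and its Schur weights\<close>

definition e :: "complex \<times> complex \<Rightarrow> complex" where
  "e z = snd z powi (- n)"

definition K :: "complex \<times> complex \<Rightarrow> complex \<times> complex \<Rightarrow> complex" where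
  "K z \<zeta> = e z * cnj (e \<zeta>) * disc_kernel 2 (fst z / snd z * cnj (fst \<zeta> / snd \<zeta>))
      * disc_kernel s (snd z * cnj (snd \<zeta>))"

lemma borel_measurable_e [measurable]: "e \<in> borel_measurable borel"
  unfolding e_def by measurable

lemma borel_measurable_K [measurable (raw)]:
  assumes [measurable]: "f \<in> borel_measurable L" "g \<in> borel_measurable L"
  shows "(\<lambda>x. K (f x) (g x)) \<in> borel_measurable L"
  unfolding K_def by measurable

lemma K_cnj: "K \<zeta> z = cnj (K z \<zeta>)"
  by (simp add: K_def disc_kernel_cnj[symmetric] mult_ac)

lemma norm_e: "snd z \<noteq> 0 \<Longrightarrow> norm (e z) = norm (snd z) powr (- of_int n)"
  unfolding e_def using norm_power_int_eq_powr[of "snd z" "-n"] by simp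

definition W :: "real \<Rightarrow> real \<Rightarrow> complex \<times> complex \<Rightarrow> real" where
  "W a b z = norm (snd z) powr (- a) * ((1 - (norm (fst z / snd z))\<^sup>2) powr (- b) * (1 - (norm (snd z))\<^sup>2) powr (- b))"

lemma borel_measurable_W [measurable]: "W a b \<in> borel_measurable borel"
  unfolding W_def by measurable

lemma W_pos: "z \<in> hartogs_triangle \<Longrightarrow> 0 < W a b z"
  using hartogs_triangleD[of z] power_less_one_iff[of "norm (fst z / snd z)" 2]
    power_less_one_iff[of "norm (snd z)" 2]
  unfolding W_def by (intro mult_pos_pos) simp_all

lemma W_powr: "z \<in> hartogs_triangle \<Longrightarrow> W a b z powr q = W (a * q) (b * q) z"
  unfolding W_def using hartogs_triangleD[of z]
  by (simp add: powr_mult powr_powr power_le_one)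

text \<open>In product coordinates the integral factorises. The powers of
  \<open>norm \<omega>\<close> combine as \<open>- n - a + 2 * n = n - a\<close>, so the second disc
  estimate needs \<open>a < n + s\<close>. What remains outside is \<open>norm w powr (- n)\<close>,
  which \<open>n \<le> a\<close> and \<open>norm w < 1\<close> bound by
  \<open>norm w powr (- a)\<close>.\<close>

lemma kernel_weight_estimate:
  assumes b: "0 < b" "b < 1" and a: "of_int n \<le> a" "a < of_int n + s"
  shows "\<exists>C>0. \<forall>z\<in>hartogs_triangle. (\<integral>\<^sup>+\<zeta>. ennreal (norm (K z \<zeta>) * W a b \<zeta>) \<partial>M) \<le> ennreal (C * W a b z)"
proof -
  obtain C2 where C2: "C2 > 0" and est2: "\<And>w. norm w < 1 \<Longrightarrow>
    (\<integral>\<^sup>+z. ennreal (norm (disc_kernel 2 (w * cnj z)) * (norm z powr 0 * (1 - (norm z)\<^sup>2) powr - b)) \<partial>disc_measure 2)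
      \<le> ennreal (C2 * (1 - (norm w)\<^sup>2) powr - b)"
    using disc_kernel_schur_estimate[OF b, of 0 2] by auto
  obtain C1 where C1: "C1 > 0" and est1: "\<And>w. norm w < 1 \<Longrightarrow>
    (\<integral>\<^sup>+z. ennreal (norm (disc_kernel s (w * cnj z)) * (norm z powr (of_int n - a) * (1 - (norm z)\<^sup>2) powr - b)) \<partial>disc_measure s)
      \<le> ennreal (C1 * (1 - (norm w)\<^sup>2) powr - b)"
    using disc_kernel_schur_estimate[OF b, of "of_int n - a" s] a s_pos s_le by auto
  show ?thesis
  proof (intro exI[of _ "C1 * C2"] conjI ballI)
    show "0 < C1 * C2" using C1 C2 by simp
    fix z assume z: "z \<in> hartogs_triangle"
    note zD = hartogs_triangleD[OF z]
    define u w where "u = fst z / snd z" and "w = snd z"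
    define g2 where "g2 = (\<lambda>\<eta>. norm (disc_kernel 2 (u * cnj \<eta>)) * (norm \<eta> powr 0 * (1 - (norm \<eta>)\<^sup>2) powr - b))"
    define g1 where "g1 = (\<lambda>\<omega>. norm (disc_kernel s (w * cnj \<omega>)) * (norm \<omega> powr (of_int n - a) * (1 - (norm \<omega>)\<^sup>2) powr - b))"
    have [measurable]: "g1 \<in> borel_measurable borel" "g2 \<in> borel_measurable borel"
      unfolding g1_def g2_def by measurable
    have g0: "g1 x \<ge> 0" "g2 x \<ge> 0" for x unfolding g1_def g2_def by auto
    have u: "norm u < 1" and w: "0 < norm w" "norm w < 1" using zD by (auto simp: u_def w_def)
    have [measurable]: "(\<lambda>\<zeta>. norm (K z \<zeta>) * W a b \<zeta>) \<in> borel_measurable borel" by measurable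
    have "(\<integral>\<^sup>+\<zeta>. ennreal (norm (K z \<zeta>) * W a b \<zeta>) \<partial>M)
      = (\<integral>\<^sup>+\<omega>. \<integral>\<^sup>+\<eta>. ennreal (norm (K z (\<eta> * \<omega>, \<omega>)) * W a b (\<eta> * \<omega>, \<omega>)) * ennreal (norm \<omega> powr (2 * of_int n)) \<partial>disc_measure 2 \<partial>disc_measure s)"
      by (rule nn_integral_M) simp
    also have "\<dots> = (\<integral>\<^sup>+\<omega>. \<integral>\<^sup>+\<eta>. ennreal (norm w powr (- of_int n) * g1 \<omega>) * ennreal (g2 \<eta>) \<partial>disc_measure 2 \<partial>disc_measure s)"
    proof (rule nn_integral_cong_AE)
      show "AE \<omega> in disc_measure s. (\<integral>\<^sup>+\<eta>. ennreal (norm (K z (\<eta> * \<omega>, \<omega>)) * W a b (\<eta> * \<omega>, \<omega>)) * ennreal (norm \<omega> powr (2 * of_int n)) \<partial>disc_measure 2)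
        = (\<integral>\<^sup>+\<eta>. ennreal (norm w powr (- of_int n) * g1 \<omega>) * ennreal (g2 \<eta>) \<partial>disc_measure 2)"
        using AE_disc_measure
      proof eventually_elim
        case (elim \<omega>)
        show ?case
        proof (rule nn_integral_cong_AE)
          show "AE \<eta> in disc_measure 2. ennreal (norm (K z (\<eta> * \<omega>, \<omega>)) * W a b (\<eta> * \<omega>, \<omega>)) * ennreal (norm \<omega> powr (2 * of_int n))
            = ennreal (norm w powr (- of_int n) * g1 \<omega>) * ennreal (g2 \<eta>)"
            using AE_disc_measure
          proof eventually_elim
            case \<eta>: (elim \<eta>)
            have \<omega>0: "\<omega> \<noteq> 0" using elim by auto
            have "norm (K z (\<eta> * \<omega>, \<omega>)) = norm w powr (- of_int n) * norm \<omega> powr (- of_int n)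
                * norm (disc_kernel 2 (u * cnj \<eta>)) * norm (disc_kernel s (w * cnj \<omega>))"
              using \<omega>0 zD by (simp add: K_def norm_mult norm_e u_def w_def)
            moreover have "W a b (\<eta> * \<omega>, \<omega>) = norm \<omega> powr - a * ((1 - (norm \<eta>)\<^sup>2) powr - b * (1 - (norm \<omega>)\<^sup>2) powr - b)"
              using \<omega>0 by (simp add: W_def)
            moreover have "norm \<omega> powr (- of_int n) * norm \<omega> powr - a * norm \<omega> powr (2 * of_int n) = norm \<omega> powr (of_int n - a)"
              by (simp add: powr_add[symmetric])
            moreover have "norm \<eta> powr 0 = 1" using \<eta> by simp
            ultimately have "norm (K z (\<eta> * \<omega>, \<omega>)) * W a b (\<eta> * \<omega>, \<omega>) * norm \<omega> powr (2 * of_int n)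
                = norm w powr (- of_int n) * g1 \<omega> * g2 \<eta>"
              unfolding g1_def g2_def by (simp only: mult_1) (simp add: mult_ac)
            then show ?case
              using g0 by (subst (1 2) ennreal_mult[symmetric]) (auto simp: W_def)
          qed
        qed
      qed
    qed
    also have "\<dots> = (\<integral>\<^sup>+\<omega>. ennreal (norm w powr (- of_int n) * g1 \<omega>) * (\<integral>\<^sup>+\<eta>. ennreal (g2 \<eta>) \<partial>disc_measure 2) \<partial>disc_measure s)"
      by (intro nn_integral_cong nn_integral_cmult) simp
    also have "\<dots> = (\<integral>\<^sup>+\<omega>. ennreal (norm w powr (- of_int n)) * ennreal (g1 \<omega>) \<partial>disc_measure s) * (\<integral>\<^sup>+\<eta>. ennreal (g2 \<eta>) \<partial>disc_measure 2)"
      by (subst nn_integral_multc) (auto simp: ennreal_mult g0)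
    also have "\<dots> = ennreal (norm w powr (- of_int n)) * (\<integral>\<^sup>+\<omega>. ennreal (g1 \<omega>) \<partial>disc_measure s) * (\<integral>\<^sup>+\<eta>. ennreal (g2 \<eta>) \<partial>disc_measure 2)"
      by (subst nn_integral_cmult) simp_all
    also have "\<dots> \<le> ennreal (norm w powr - a) * ennreal (C1 * (1 - (norm w)\<^sup>2) powr - b) * ennreal (C2 * (1 - (norm u)\<^sup>2) powr - b)"
    proof (intro mult_mono)
      show "ennreal (norm w powr (- of_int n)) \<le> ennreal (norm w powr - a)"
        using w a by (intro ennreal_leI powr_mono') auto
    qed (use est1[OF w(2)] est2[OF u] in \<open>simp_all add: g1_def g2_def\<close>)
    also have "\<dots> = ennreal (C1 * C2 * (norm w powr - a * ((1 - (norm u)\<^sup>2) powr - b * (1 - (norm w)\<^sup>2) powr - b)))"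
      using C1 C2 by (simp add: ennreal_mult[symmetric] mult_ac)
    also have "\<dots> = ennreal (C1 * C2 * W a b z)"
      by (simp add: W_def u_def w_def)
    finally show "(\<integral>\<^sup>+\<zeta>. ennreal (norm (K z \<zeta>) * W a b \<zeta>) \<partial>M) \<le> ennreal (C1 * C2 * W a b z)" .
  qed
qed

lemma kernel_Lp_bound:
  assumes p: "p > 1" and p1: "p * of_int n < s + 2 * of_int n" and p2: "s + 2 * of_int n < p * (of_int n + s)"
  shows "\<exists>C>0. \<forall>f\<in>Lp_space p M.
      (AE z in M. (\<integral>\<^sup>+\<zeta>. ennreal (norm (K z \<zeta>) * norm (f \<zeta>)) \<partial>M) < \<infinity>) \<and>
      (\<integral>\<^sup>+z. ennreal (enn2real (\<integral>\<^sup>+\<zeta>. ennreal (norm (K z \<zeta>) * norm (f \<zeta>)) \<partial>M) powr p) \<partial>M)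
        \<le> ennreal (C powr p) * (\<integral>\<^sup>+\<zeta>. ennreal (norm (f \<zeta>) powr p) \<partial>M)"
proof -
  \<comment> \<open>Schur's test asks for both \<open>a\<close> and \<open>a * (p - 1)\<close>
    between \<open>n\<close> (included) and \<open>n + s\<close> (excluded). This is the least
    \<open>a\<close> meeting the two lower bounds; the upper bounds then amount to the two
    hypotheses on \<open>p\<close>. The value \<open>b = 1 / p\<close> puts \<open>b\<close> and
    \<open>b * (p - 1) = 1 - 1 / p\<close> into the open unit interval.\<close>
  define a where "a = max (of_int n) (of_int n / (p - 1))"
  define b where "b = 1 / p"
  have b: "0 < b" "b < 1" "0 < b * (p - 1)" "b * (p - 1) < 1" using p by (auto simp: b_def field_simps)
  have a: "of_int n \<le> a" "a < of_int n + s" "of_int n \<le> a * (p - 1)" "a * (p - 1) < of_int n + s"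
  proof -
    show "of_int n \<le> a" by (simp add: a_def)
    have 1: "of_int n / (p - 1) < of_int n + s" using p p2 by (simp add: divide_less_eq algebra_simps)
    then show "a < of_int n + s" using s_pos by (simp add: a_def)
    have 2: "a * (p - 1) = max (of_int n * (p - 1)) (of_int n)"
      using p by (simp add: a_def max_mult_distrib_right)
    show "of_int n \<le> a * (p - 1)" unfolding 2 by simp
    show "a * (p - 1) < of_int n + s" unfolding 2 using p1 s_pos by (simp add: algebra_simps)
  qed
  obtain C1 where C1: "C1 > 0" "\<And>z. z \<in> hartogs_triangle \<Longrightarrow> (\<integral>\<^sup>+\<zeta>. ennreal (norm (K z \<zeta>) * W a b \<zeta>) \<partial>M) \<le> ennreal (C1 * W a b z)"
    using kernel_weight_estimate[OF b(1,2) a(1,2)] by blast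
  obtain C2 where C2: "C2 > 0" "\<And>z. z \<in> hartogs_triangle \<Longrightarrow>
      (\<integral>\<^sup>+\<zeta>. ennreal (norm (K z \<zeta>) * W (a * (p - 1)) (b * (p - 1)) \<zeta>) \<partial>M) \<le> ennreal (C2 * W (a * (p - 1)) (b * (p - 1)) z)"
    using kernel_weight_estimate[OF b(3,4) a(3,4)] by blast
  define C where "C = max C1 C2"
  have C: "C > 0" using C1 by (simp add: C_def)
  show ?thesis
  proof (intro exI[of _ C] conjI C ballI)
    fix f assume "f \<in> Lp_space p M"
    then have f[measurable]: "f \<in> borel_measurable M" and fin: "(\<integral>\<^sup>+z. ennreal (norm (f z) powr p) \<partial>M) < \<infinity>"
      by (auto simp: Lp_space_iff)
    have W0: "0 < W a b z" if "z \<in> space M" for z using that W_pos by simp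
    have A1: "(\<integral>\<^sup>+\<zeta>. ennreal (norm (K z \<zeta>) * W a b \<zeta>) \<partial>M) \<le> ennreal (C * W a b z)" if "z \<in> space M" for z
      using that W_pos[of z a b] by (intro order_trans[OF C1(2)] ennreal_leI mult_right_mono) (auto simp: C_def)
    have A2: "(\<integral>\<^sup>+z. ennreal (norm (K z \<zeta>) * W a b z powr (p - 1)) \<partial>M) \<le> ennreal (C * W a b \<zeta> powr (p - 1))"
      if "\<zeta> \<in> space M" for \<zeta>
    proof -
      have "(\<integral>\<^sup>+z. ennreal (norm (K z \<zeta>) * W a b z powr (p - 1)) \<partial>M)
          = (\<integral>\<^sup>+z. ennreal (norm (K \<zeta> z) * W (a * (p - 1)) (b * (p - 1)) z) \<partial>M)"
        by (intro nn_integral_cong) (simp add: W_powr K_cnj[of \<zeta>])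
      also have "\<dots> \<le> ennreal (C2 * W (a * (p - 1)) (b * (p - 1)) \<zeta>)"
        using that by (intro C2(2)) simp
      also have "\<dots> \<le> ennreal (C * W (a * (p - 1)) (b * (p - 1)) \<zeta>)"
        using that W_pos[of \<zeta> "a * (p - 1)" "b * (p - 1)"] by (intro ennreal_leI mult_right_mono) (auto simp: C_def)
      finally show ?thesis using that by (simp add: W_powr)
    qed
    have Km: "(\<lambda>(x, y). norm (K x y)) \<in> borel_measurable (M \<Otimes>\<^sub>M M)"
      unfolding split_def by (rule measurable_compose[OF borel_measurable_K[OF borel_measurable_pair_M] borel_measurable_norm])
    have Wm: "W a b \<in> borel_measurable M" by (intro borel_measurable_M) simp
    note S = schur_test[OF sigma_finite_M Km _ Wm _ _ W0 p C A1 A2, of "\<lambda>y. norm (f y)"]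
    show "AE z in M. (\<integral>\<^sup>+\<zeta>. ennreal (norm (K z \<zeta>) * norm (f \<zeta>)) \<partial>M) < \<infinity>"
      by (rule S(1)) (use fin in auto)
    show "(\<integral>\<^sup>+z. ennreal (enn2real (\<integral>\<^sup>+\<zeta>. ennreal (norm (K z \<zeta>) * norm (f \<zeta>)) \<partial>M) powr p) \<partial>M)
        \<le> ennreal (C powr p) * (\<integral>\<^sup>+\<zeta>. ennreal (norm (f \<zeta>) powr p) \<partial>M)"
      by (rule S(2)) (use fin in auto)
  qed
qed

end

section \<open>The Bergman projection as an integral operator\<close>

definition disc_kernel_deriv :: "real \<Rightarrow> complex \<Rightarrow> complex" where
  "disc_kernel_deriv s x = (of_real (2 + s) + of_real (2 - s) * x) / (of_real (2 * pi) * (1 - x) ^ 3)"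

lemma disc_kernel_has_field_derivative:
  assumes "x \<noteq> 1"
  shows "(disc_kernel s has_field_derivative disc_kernel_deriv s x) (at x)"
proof -
  have nz: "1 - x \<noteq> 0" using assms by auto
  have "disc_kernel s = (\<lambda>x. (of_real s + of_real (2 - s) * x) / (of_real (2 * pi) * (1 - x)\<^sup>2))"
    by (simp add: disc_kernel_def fun_eq_iff)
  moreover have "((\<lambda>x. (of_real s + of_real (2 - s) * x) / (of_real (2 * pi) * (1 - x)\<^sup>2)) has_field_derivative
     (of_real (2 - s) * (of_real (2 * pi) * (1 - x)\<^sup>2) - (of_real s + of_real (2 - s) * x) * (of_real (2 * pi) * (2 * (1 - x) * (-1))))
      / ((of_real (2 * pi) * (1 - x)\<^sup>2) * (of_real (2 * pi) * (1 - x)\<^sup>2))) (at x)"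
    using nz by (auto intro!: derivative_eq_intros)
  moreover have "(of_real (2 - s) * (of_real (2 * pi) * (1 - x)\<^sup>2) - (of_real s + of_real (2 - s) * x) * (of_real (2 * pi) * (2 * (1 - x) * (-1))))
      / ((of_real (2 * pi) * (1 - x)\<^sup>2) * (of_real (2 * pi) * (1 - x)\<^sup>2)) = disc_kernel_deriv s x"
  proof -
    define q where "q = complex_of_real (2 * pi)"
    define y where "y = 1 - x"
    have q: "q \<noteq> 0" and y: "y \<noteq> 0" using nz by (auto simp: q_def y_def)
    have x: "x = 1 - y" by (simp add: y_def)
    show ?thesis
      unfolding disc_kernel_deriv_def q_def[symmetric] y_def[symmetric] using q y
      by (simp add: divide_simps power2_eq_square power3_eq_cube) (simp add: x algebra_simps)
  qed
  ultimately show ?thesis by simp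
qed

lemma borel_measurable_disc_kernel_deriv [measurable]: "disc_kernel_deriv s \<in> borel_measurable borel"
  unfolding disc_kernel_deriv_def by measurable

lemma disc_kernel_bounded_compact:
  assumes "r < 1"
  shows "\<exists>B>0. \<forall>x. norm x \<le> r \<longrightarrow> norm (disc_kernel s x) \<le> B \<and> norm (disc_kernel_deriv s x) \<le> B"
proof -
  have nz: "1 - x \<noteq> 0" if "x \<in> cball 0 r" for x :: complex using that assms by auto
  have "continuous_on (cball 0 r) (disc_kernel s)" "continuous_on (cball 0 r) (disc_kernel_deriv s)"
    unfolding disc_kernel_def disc_kernel_deriv_def using nz by (auto intro!: continuous_intros)
  then have "bounded (disc_kernel s ` cball 0 r)" "bounded (disc_kernel_deriv s ` cball 0 r)"
    by (auto intro!: compact_imp_bounded compact_continuous_image)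
  then obtain B1 B2 where "\<forall>x\<in>cball 0 r. norm (disc_kernel s x) \<le> B1" "\<forall>x\<in>cball 0 r. norm (disc_kernel_deriv s x) \<le> B2"
    unfolding bounded_iff by auto
  then show ?thesis
    by (intro exI[of _ "max 1 (max B1 B2)"]) (auto simp: le_max_iff_disj)
qed

text \<open>Turns a real derivative that commutes with complex scalars into the form that
  \<open>holomorphic2_on\<close> demands.\<close>

lemma complex_linear_pair:
  fixes D :: "complex \<times> complex \<Rightarrow> complex"
  assumes D: "bounded_linear D" and hom: "\<And>c v w. D (c * v, c * w) = c * D (v, w)"
  shows "\<exists>a b. D = (\<lambda>(v, w). a * v + b * w)"
proof (intro exI ext)
  fix h :: "complex \<times> complex"
  obtain v w where h: "h = (v, w)" by (cases h)
  have "D h = D ((v, 0) + (0, w))" by (simp add: h)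
  also have "\<dots> = D (v, 0) + D (0, w)" by (rule linear_add[OF bounded_linear.linear[OF D]])
  also have "D (v, 0) = v * D (1, 0)" using hom[of v 1 0] by simp
  also have "D (0, w) = w * D (0, 1)" using hom[of w 0 1] by simp
  finally show "D h = (case h of (v, w) \<Rightarrow> D (1, 0) * v + D (0, 1) * w)" by (simp add: h mult.commute)
qed

lemma holomorphic2_continuous:
  "holomorphic2_on h S \<Longrightarrow> continuous_on S h"
  unfolding holomorphic2_on_def
  by (metis continuous_at_imp_continuous_on has_derivative_continuous)

context hartogs_weighted
begin

definition P :: "(complex \<times> complex \<Rightarrow> complex) \<Rightarrow> complex \<times> complex \<Rightarrow> complex" where
  "P f z = (LINT \<zeta>|M. K z \<zeta> * f \<zeta>)"

definition V :: "(complex \<times> complex \<Rightarrow> complex) set" where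
  "V = bergman_space hartogs_triangle (hartogs_weight (s + 2 * of_int n - 4))"

lemma V_iff: "f \<in> V \<longleftrightarrow> f \<in> Lp_space 2 M \<and> holomorphic2_on f hartogs_triangle"
  by (simp add: V_def bergman_space_def M_def)

lemma emeasure_disc_measure_2: "emeasure (disc_measure 2) UNIV = ennreal pi"
proof -
  have "emeasure (disc_measure 2) UNIV = (\<integral>\<^sup>+z. 1 \<partial>disc_measure 2)" by simp
  also have "\<dots> = (\<integral>\<^sup>+z. ennreal (norm z powr 0) \<partial>disc_measure 2)"
    using AE_disc_measure[of 2] by (intro nn_integral_cong_AE) (auto elim!: eventually_mono)
  finally show ?thesis by (simp only: disc_measure_moment) simp
qed

lemma nn_integral_M_snd:
  fixes \<phi> :: "complex \<Rightarrow> ennreal"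
  assumes [measurable]: "\<phi> \<in> borel_measurable borel"
  shows "(\<integral>\<^sup>+z. \<phi> (snd z) \<partial>M) = ennreal pi * (\<integral>\<^sup>+w. \<phi> w * ennreal (norm w powr (2 * of_int n)) \<partial>disc_measure s)"
proof -
  have "(\<integral>\<^sup>+z. \<phi> (snd z) \<partial>M)
      = (\<integral>\<^sup>+w. \<integral>\<^sup>+u. \<phi> w * ennreal (norm w powr (2 * of_int n)) \<partial>disc_measure 2 \<partial>disc_measure s)"
    by (subst nn_integral_M) simp_all
  also have "\<dots> = (\<integral>\<^sup>+w. ennreal pi * (\<phi> w * ennreal (norm w powr (2 * of_int n))) \<partial>disc_measure s)"
    by (simp add: emeasure_disc_measure_2 mult_ac)
  also have "\<dots> = ennreal pi * (\<integral>\<^sup>+w. \<phi> w * ennreal (norm w powr (2 * of_int n)) \<partial>disc_measure s)"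
    by (rule nn_integral_cmult) measurable
  finally show ?thesis .
qed

lemma nn_integral_norm_e:
  "(\<integral>\<^sup>+z. ennreal (norm (e z) powr p) \<partial>M)
    = (if 0 < s + 2 * of_int n - p * of_int n then ennreal (pi * (2 * pi / (s + 2 * of_int n - p * of_int n))) else \<infinity>)"
proof -
  have "(\<integral>\<^sup>+z. ennreal (norm (e z) powr p) \<partial>M) = (\<integral>\<^sup>+z. ennreal (norm (snd z) powr (- of_int n * p)) \<partial>M)"
    by (intro nn_integral_cong) (simp add: norm_e hartogs_triangleD powr_powr)
  also have "\<dots> = ennreal pi * (\<integral>\<^sup>+w. ennreal (norm w powr (- of_int n * p)) * ennreal (norm w powr (2 * of_int n)) \<partial>disc_measure s)"
    by (rule nn_integral_M_snd) measurable
  also have "(\<lambda>w::complex. ennreal (norm w powr (- of_int n * p)) * ennreal (norm w powr (2 * of_int n)))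
      = (\<lambda>w. ennreal (norm w powr (2 * of_int n - p * of_int n)))"
    by (simp add: ennreal_mult[symmetric] powr_add[symmetric] algebra_simps)
  also have "(\<integral>\<^sup>+w. ennreal (norm w powr (2 * of_int n - p * of_int n)) \<partial>disc_measure s)
      = (if 0 < 2 * of_int n - p * of_int n + s then ennreal (2 * pi / (2 * of_int n - p * of_int n + s)) else \<infinity>)"
    by (rule disc_measure_moment)
  finally show ?thesis
    by (auto simp: ennreal_mult'[symmetric] ennreal_mult_top algebra_simps)
qed

lemma e_L2: "e \<in> Lp_space 2 M"
  unfolding Lp_space_iff nn_integral_norm_e using s_pos by (auto intro: borel_measurable_M)

lemma integrable_e_product:
  assumes f: "f \<in> Lp_space 2 M"
  shows "integrable M (\<lambda>\<zeta>. norm (e \<zeta>) * norm (f \<zeta>))"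
  using integrable_norm[OF integrable_L2_product[OF f e_L2]] by (simp add: norm_mult mult.commute)

text \<open>For fixed \<open>z\<close> the arguments of both disc kernels stay in compact discs of
  radius \<open>norm (fst z / snd z)\<close> and \<open>norm (snd z)\<close>. Hence the kernel is
  dominated by \<open>e\<close>, which is square integrable, and the integral defining
  \<open>P f z\<close> converges at every point.\<close>

lemma norm_K_le:
  assumes z: "z \<in> hartogs_triangle"
  shows "\<exists>C\<ge>0. \<forall>\<zeta>\<in>hartogs_triangle. norm (K z \<zeta>) \<le> C * norm (e \<zeta>)"
proof -
  define u w where "u = fst z / snd z" and "w = snd z"
  have u: "norm u < 1" and w: "norm w < 1" using hartogs_triangleD[OF z] by (auto simp: u_def w_def)
  obtain B2 where B2: "B2 > 0" "\<And>x. norm x \<le> norm u \<Longrightarrow> norm (disc_kernel 2 x) \<le> B2"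
    using disc_kernel_bounded_compact[OF u, of 2] by blast
  obtain B1 where B1: "B1 > 0" "\<And>x. norm x \<le> norm w \<Longrightarrow> norm (disc_kernel s x) \<le> B1"
    using disc_kernel_bounded_compact[OF w, of s] by blast
  show ?thesis
  proof (intro exI[of _ "norm (e z) * B2 * B1"] conjI ballI)
    fix \<zeta> assume \<zeta>: "\<zeta> \<in> hartogs_triangle"
    note D = hartogs_triangleD[OF \<zeta>]
    have "norm u * norm (fst \<zeta> / snd \<zeta>) \<le> norm u" "norm w * norm (snd \<zeta>) \<le> norm w"
      using D by (auto intro!: mult_left_le)
    then have "norm (u * cnj (fst \<zeta> / snd \<zeta>)) \<le> norm u" "norm (w * cnj (snd \<zeta>)) \<le> norm w"
      by (simp_all only: norm_mult complex_mod_cnj)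
    then have "norm (disc_kernel 2 (u * cnj (fst \<zeta> / snd \<zeta>))) \<le> B2" "norm (disc_kernel s (w * cnj (snd \<zeta>))) \<le> B1"
      using B1 B2 by blast+
    then have "norm (e z) * norm (e \<zeta>) * norm (disc_kernel 2 (u * cnj (fst \<zeta> / snd \<zeta>))) * norm (disc_kernel s (w * cnj (snd \<zeta>)))
        \<le> norm (e z) * norm (e \<zeta>) * B2 * B1"
      using B2(1) by (intro mult_mono) auto
    moreover have "K z \<zeta> = e z * cnj (e \<zeta>) * disc_kernel 2 (u * cnj (fst \<zeta> / snd \<zeta>)) * disc_kernel s (w * cnj (snd \<zeta>))"
      by (simp only: K_def u_def w_def)
    ultimately show "norm (K z \<zeta>) \<le> norm (e z) * B2 * B1 * norm (e \<zeta>)"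
      by (simp only: norm_mult complex_mod_cnj mult_ac)
  qed (use B1 B2 in auto)
qed

lemma borel_measurable_e_M [measurable]: "e \<in> borel_measurable M"
  by (rule borel_measurable_M[OF borel_measurable_e])

lemma borel_measurable_K_M [measurable]: "K z \<in> borel_measurable M"
  by (intro borel_measurable_M borel_measurable_K) simp_all

lemma integrable_K:
  assumes f: "f \<in> Lp_space 2 M" and z: "z \<in> hartogs_triangle"
  shows "integrable M (\<lambda>\<zeta>. K z \<zeta> * f \<zeta>)"
proof -
  obtain C where C: "C \<ge> 0" "\<And>\<zeta>. \<zeta> \<in> hartogs_triangle \<Longrightarrow> norm (K z \<zeta>) \<le> C * norm (e \<zeta>)"
    using norm_K_le[OF z] by blast
  have [measurable]: "f \<in> borel_measurable M" using f by (simp add: Lp_space_2_iff)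
  show ?thesis
  proof (rule Bochner_Integration.integrable_bound[where f="\<lambda>\<zeta>. C * (norm (e \<zeta>) * norm (f \<zeta>))"])
    show "integrable M (\<lambda>\<zeta>. C * (norm (e \<zeta>) * norm (f \<zeta>)))"
      by (intro integrable_mult_right integrable_e_product f)
    show "AE \<zeta> in M. norm (K z \<zeta> * f \<zeta>) \<le> norm (C * (norm (e \<zeta>) * norm (f \<zeta>)))"
    proof (rule AE_I2)
      fix \<zeta> assume "\<zeta> \<in> space M"
      then have "norm (K z \<zeta>) * norm (f \<zeta>) \<le> C * norm (e \<zeta>) * norm (f \<zeta>)"
        using C by (intro mult_right_mono) auto
      then show "norm (K z \<zeta> * f \<zeta>) \<le> norm (C * (norm (e \<zeta>) * norm (f \<zeta>)))"
        using C(1) by (simp add: norm_mult abs_mult mult.assoc)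
    qed
  qed measurable
qed

text \<open>In the coordinates \<open>(z1 / z2, z2)\<close> the kernel is a product of disc kernels
  at holomorphic arguments, apart from the factor \<open>e z\<close>, which is taken out of the
  integral. Differentiation under the integral sign happens in these coordinates; the chain and
  product rules bring the result back.\<close>

lemma P_holomorphic:
  assumes f: "f \<in> Lp_space 2 M"
  shows "holomorphic2_on (P f) hartogs_triangle"
  unfolding holomorphic2_on_def
proof
  fix z0 assume z0: "z0 \<in> hartogs_triangle"
  note zD = hartogs_triangleD[OF z0]
  define p0 where "p0 = (fst z0 / snd z0, snd z0)"
  define m where "m = max (norm (fst p0)) (norm (snd p0))"
  \<comment> \<open>Within distance \<open>r\<close> of \<open>p0\<close> both coordinates stay
    below \<open>m + r = (1 + m) / 2 < 1\<close>, which gives bounds uniform in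
    \<open>\<zeta>\<close>.\<close>
  define r where "r = (1 - m) / 2"
  have m: "m < 1" using zD by (simp add: m_def p0_def)
  have r: "r > 0" "m + r < 1" using m by (auto simp: r_def field_simps)
  obtain B2 where B2: "B2 > 0" "\<And>x. norm x \<le> m + r \<Longrightarrow> norm (disc_kernel 2 x) \<le> B2"
      "\<And>x. norm x \<le> m + r \<Longrightarrow> norm (disc_kernel_deriv 2 x) \<le> B2"
    using disc_kernel_bounded_compact[OF r(2), of 2] by blast
  obtain B1 where B1: "B1 > 0" "\<And>x. norm x \<le> m + r \<Longrightarrow> norm (disc_kernel s x) \<le> B1"
      "\<And>x. norm x \<le> m + r \<Longrightarrow> norm (disc_kernel_deriv s x) \<le> B1"
    using disc_kernel_bounded_compact[OF r(2), of s] by blast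
  have [measurable]: "f \<in> borel_measurable M" using f by (simp add: Lp_space_2_iff)
  define \<alpha> where "\<alpha> = (\<lambda>\<zeta>::complex \<times> complex. cnj (fst \<zeta> / snd \<zeta>))"
  define \<beta> where "\<beta> = (\<lambda>\<zeta>::complex \<times> complex. cnj (snd \<zeta>))"
  define c where "c = (\<lambda>\<zeta>. cnj (e \<zeta>) * f \<zeta>)"
  have [measurable]: "\<alpha> \<in> borel_measurable M" "\<beta> \<in> borel_measurable M"
    unfolding \<alpha>_def \<beta>_def by (rule borel_measurable_M, measurable)+
  have [measurable]: "c \<in> borel_measurable M" unfolding c_def by measurable
  define F where "F = (\<lambda>p \<zeta>. disc_kernel 2 (fst p * \<alpha> \<zeta>) * disc_kernel s (snd p * \<beta> \<zeta>) * c \<zeta>)"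
  define F' where "F' = (\<lambda>p \<zeta> h. (disc_kernel_deriv 2 (fst p * \<alpha> \<zeta>) * (fst h * \<alpha> \<zeta>) * disc_kernel s (snd p * \<beta> \<zeta>)
      + disc_kernel 2 (fst p * \<alpha> \<zeta>) * (disc_kernel_deriv s (snd p * \<beta> \<zeta>) * (snd h * \<beta> \<zeta>))) * c \<zeta>)"
  have arg: "norm (\<alpha> \<zeta>) \<le> 1" "norm (\<beta> \<zeta>) \<le> 1" "norm (fst p * \<alpha> \<zeta>) \<le> m + r" "norm (snd p * \<beta> \<zeta>) \<le> m + r"
    if p: "p \<in> ball p0 r" and \<zeta>: "\<zeta> \<in> space M" for p \<zeta>
  proof -
    show 1: "norm (\<alpha> \<zeta>) \<le> 1" "norm (\<beta> \<zeta>) \<le> 1"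
      using hartogs_triangleD(3,4)[of \<zeta>] \<zeta> unfolding \<alpha>_def \<beta>_def complex_mod_cnj by simp_all
    have "norm (fst p - fst p0) \<le> norm (p - p0)" "norm (snd p - snd p0) \<le> norm (p - p0)"
      using norm_fst_le[of "fst (p - p0)" "snd (p - p0)"] norm_snd_le[of "snd (p - p0)" "fst (p - p0)"]
      unfolding prod.collapse by simp_all
    moreover have "norm (p - p0) < r" using p by (simp add: dist_norm norm_minus_commute)
    moreover have "norm (fst p) \<le> norm (fst p0) + norm (fst p - fst p0)" "norm (snd p) \<le> norm (snd p0) + norm (snd p - snd p0)"
      using norm_triangle_sub by blast+
    moreover have "norm (fst p0) \<le> m" "norm (snd p0) \<le> m" by (simp_all add: m_def)
    ultimately have 2: "norm (fst p) \<le> m + r" "norm (snd p) \<le> m + r" by linarith+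
    have "norm (fst p) * norm (\<alpha> \<zeta>) \<le> norm (fst p)" "norm (snd p) * norm (\<beta> \<zeta>) \<le> norm (snd p)"
      using 1 by (auto intro: mult_left_le)
    with 2 show "norm (fst p * \<alpha> \<zeta>) \<le> m + r" "norm (snd p * \<beta> \<zeta>) \<le> m + r"
      unfolding norm_mult by linarith+
  qed
  have c_int: "integrable M (\<lambda>\<zeta>. norm (c \<zeta>))"
    unfolding c_def norm_mult complex_mod_cnj by (rule integrable_e_product[OF f])
  have F_int: "integrable M (F p)" if p: "p \<in> ball p0 r" for p
  proof (rule Bochner_Integration.integrable_bound[where f="\<lambda>\<zeta>. B2 * B1 * norm (c \<zeta>)"])
    show "integrable M (\<lambda>\<zeta>. B2 * B1 * norm (c \<zeta>))" by (intro integrable_mult_right c_int)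
    show "AE \<zeta> in M. norm (F p \<zeta>) \<le> norm (B2 * B1 * norm (c \<zeta>))"
    proof (rule AE_I2)
      fix \<zeta> assume \<zeta>: "\<zeta> \<in> space M"
      have "norm (F p \<zeta>) \<le> B2 * B1 * norm (c \<zeta>)"
        unfolding F_def norm_mult[of "_ * _" "c _"] norm_mult[of "disc_kernel _ _"]
        using B1(1) B2(1) B2(2)[OF arg(3)[OF p \<zeta>]] B1(2)[OF arg(4)[OF p \<zeta>]] by (intro mult_mono) auto
      then show "norm (F p \<zeta>) \<le> norm (B2 * B1 * norm (c \<zeta>))" using B1(1) B2(1) by simp
    qed
    show "F p \<in> borel_measurable M" unfolding F_def by measurable
  qed
  have der: "((\<lambda>p. F p \<zeta>) has_derivative F' p \<zeta>) (at p)" if p: "p \<in> ball p0 r" and \<zeta>: "\<zeta> \<in> space M" for p \<zeta>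
  proof -
    have ne: "fst p * \<alpha> \<zeta> \<noteq> 1" "snd p * \<beta> \<zeta> \<noteq> 1"
      using arg(3,4)[OF p \<zeta>] r by auto
    have lin: "((\<lambda>p. fst p * \<alpha> \<zeta>) has_derivative (\<lambda>h. fst h * \<alpha> \<zeta>)) (at p)"
      "((\<lambda>p. snd p * \<beta> \<zeta>) has_derivative (\<lambda>h. snd h * \<beta> \<zeta>)) (at p)"
      by (auto intro!: derivative_eq_intros)
    note d1 = has_derivative_compose[OF lin(1) disc_kernel_has_field_derivative[OF ne(1), unfolded has_field_derivative_def], of 2]
    note d2 = has_derivative_compose[OF lin(2) disc_kernel_has_field_derivative[OF ne(2), unfolded has_field_derivative_def], of s]
    show ?thesis unfolding F_def F'_def
      by (rule has_derivative_eq_rhs[OF has_derivative_mult_left[OF has_derivative_mult[OF d1 d2]]])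
        (simp add: fun_eq_iff algebra_simps)
  qed
  have bd: "norm (F' p \<zeta> h) \<le> 2 * B2 * B1 * norm (c \<zeta>) * norm h" if p: "p \<in> ball p0 r" and \<zeta>: "\<zeta> \<in> space M" for p \<zeta> h
  proof -
    note a = arg[OF p \<zeta>]
    have "norm (fst h) * norm (\<alpha> \<zeta>) \<le> norm (fst h)" "norm (snd h) * norm (\<beta> \<zeta>) \<le> norm (snd h)"
      using a(1,2) by (auto intro: mult_left_le)
    then have h: "norm (fst h * \<alpha> \<zeta>) \<le> norm h" "norm (snd h * \<beta> \<zeta>) \<le> norm h"
      using norm_fst_le[of "fst h" "snd h"] norm_snd_le[of "snd h" "fst h"] by (simp_all add: norm_mult)
    have 1: "norm (disc_kernel_deriv 2 (fst p * \<alpha> \<zeta>) * (fst h * \<alpha> \<zeta>) * disc_kernel s (snd p * \<beta> \<zeta>)) \<le> B2 * norm h * B1"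
      unfolding norm_mult[of "_ * _" "disc_kernel _ _"] norm_mult[of "disc_kernel_deriv _ _"]
      using B1(1) B2(1) B2(3)[OF a(3)] B1(2)[OF a(4)] h(1) by (intro mult_mono) auto
    have 2: "norm (disc_kernel 2 (fst p * \<alpha> \<zeta>) * (disc_kernel_deriv s (snd p * \<beta> \<zeta>) * (snd h * \<beta> \<zeta>))) \<le> B2 * (B1 * norm h)"
      unfolding norm_mult[of "disc_kernel _ _"] norm_mult[of "disc_kernel_deriv _ _"]
      using B1(1) B2(1) B2(2)[OF a(3)] B1(3)[OF a(4)] h(2) by (intro mult_mono) auto
    have "norm (disc_kernel_deriv 2 (fst p * \<alpha> \<zeta>) * (fst h * \<alpha> \<zeta>) * disc_kernel s (snd p * \<beta> \<zeta>)
      + disc_kernel 2 (fst p * \<alpha> \<zeta>) * (disc_kernel_deriv s (snd p * \<beta> \<zeta>) * (snd h * \<beta> \<zeta>))) \<le> B2 * norm h * B1 + B2 * (B1 * norm h)"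
      using norm_triangle_mono[OF 1 2] .
    then have "norm (F' p \<zeta> h) \<le> (B2 * norm h * B1 + B2 * (B1 * norm h)) * norm (c \<zeta>)"
      unfolding F'_def norm_mult[of _ "c \<zeta>"] by (rule mult_right_mono) simp
    then show ?thesis by (simp add: algebra_simps)
  qed
  define \<Phi> where "\<Phi> = (\<lambda>p. LINT \<zeta>|M. F p \<zeta>)"
  define D where "D = (\<lambda>h. LINT \<zeta>|M. F' p0 \<zeta> h)"
  have \<Phi>: "(\<Phi> has_derivative D) (at p0)"
    unfolding \<Phi>_def D_def
  proof (rule has_derivative_integral_param[OF r(1) der bd F_int])
    show "integrable M (\<lambda>\<zeta>. 2 * B2 * B1 * norm (c \<zeta>))" by (intro integrable_mult_right c_int)
    show "(\<lambda>x. F' p0 x h) \<in> borel_measurable M" for h unfolding F'_def by measurable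
  qed
  \<comment> \<open>Complex homogeneity passes from each integrand to the integral.\<close>
  have D_hom: "D (a * v, a * w) = a * D (v, w)" for a v w
  proof -
    have "D (a * v, a * w) = (LINT \<zeta>|M. a * F' p0 \<zeta> (v, w))"
      unfolding D_def by (intro Bochner_Integration.integral_cong) (simp_all add: F'_def algebra_simps)
    then show ?thesis unfolding D_def by simp
  qed
  define \<phi> where "\<phi> = (\<lambda>z::complex \<times> complex. (fst z / snd z, snd z))"
  define \<phi>' where "\<phi>' = (\<lambda>h::complex \<times> complex. ((fst h * snd z0 - fst z0 * snd h) / (snd z0 * snd z0), snd h))"
  have \<phi>: "(\<phi> has_derivative \<phi>') (at z0)"
    unfolding \<phi>_def \<phi>'_def
    by (intro has_derivative_Pair has_derivative_divide' has_derivative_fst has_derivative_snd has_derivative_ident zD)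
  have e: "(e has_derivative (\<lambda>h. of_int (- n) * snd z0 powi (- n - 1) * snd h)) (at z0)"
  proof -
    have "((\<lambda>x. x powi (- n)) has_field_derivative (of_int (- n) * snd z0 powi (- n - 1))) (at (snd z0))"
      using zD(1) by (auto intro!: derivative_eq_intros)
    from has_derivative_compose[OF has_derivative_snd[OF has_derivative_ident] this[unfolded has_field_derivative_def]]
    show ?thesis unfolding e_def by simp
  qed
  have comp: "((\<lambda>z. \<Phi> (\<phi> z)) has_derivative (\<lambda>h. D (\<phi>' h))) (at z0)"
    by (rule has_derivative_compose[OF \<phi>]) (use \<Phi> in \<open>simp add: \<phi>_def p0_def\<close>)
  have P_eq: "P f = (\<lambda>z. e z * \<Phi> (\<phi> z))"
  proof
    fix z
    have "P f z = (LINT \<zeta>|M. e z * F (\<phi> z) \<zeta>)"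
      unfolding P_def by (intro Bochner_Integration.integral_cong)
        (simp_all add: K_def F_def \<phi>_def \<alpha>_def \<beta>_def c_def mult_ac)
    then show "P f z = e z * \<Phi> (\<phi> z)" by (simp add: \<Phi>_def)
  qed
  define DP where "DP = (\<lambda>h. e z0 * D (\<phi>' h) + of_int (- n) * snd z0 powi (- n - 1) * snd h * \<Phi> (\<phi> z0))"
  have DP: "(P f has_derivative DP) (at z0)"
    unfolding P_eq DP_def by (rule has_derivative_mult[OF e comp])
  have "DP (a * v, a * w) = a * DP (v, w)" for a v w
  proof -
    have "\<phi>' (a * v, a * w) = (a * fst (\<phi>' (v, w)), a * snd (\<phi>' (v, w)))"
      by (simp add: \<phi>'_def algebra_simps diff_divide_distrib)
    then have "D (\<phi>' (a * v, a * w)) = a * D (\<phi>' (v, w))"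
      using D_hom by simp
    then show ?thesis by (simp add: DP_def algebra_simps)
  qed
  then have "\<exists>a b. DP = (\<lambda>(v, w). a * v + b * w)"
    by (intro complex_linear_pair has_derivative_bounded_linear[OF DP])
  then show "\<exists>a b. (P f has_derivative (\<lambda>(v, w). a * v + b * w)) (at z0)"
    using DP by auto
qed

text \<open>A holomorphic function is arbitrary off the triangle. Cutting it off there produces a
  Borel function on the whole space, to which the change of variables applies.\<close>

lemma borel_measurable_holomorphic2:
  assumes "holomorphic2_on h hartogs_triangle"
  shows "(\<lambda>z. indicator hartogs_triangle z *\<^sub>R h z) \<in> borel_measurable borel" and "h \<in> borel_measurable M"
proof -
  show 1: "(\<lambda>z. indicator hartogs_triangle z *\<^sub>R h z) \<in> borel_measurable borel"
    by (rule borel_measurable_continuous_on_indicator[OF borel_hartogs_triangle holomorphic2_continuous[OF assms]])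
  have "(\<lambda>z. indicator hartogs_triangle z *\<^sub>R h z) \<in> borel_measurable M"
    by (rule borel_measurable_M[OF 1])
  then show "h \<in> borel_measurable M"
    by (rule measurable_cong[THEN iffD1, rotated]) simp
qed

text \<open>If the integrand is not integrable, \<open>P f z\<close> is 0 by convention and the
  bound is trivial.\<close>

lemma norm_P_le:
  "ennreal (norm (P f z)) \<le> (\<integral>\<^sup>+\<zeta>. ennreal (norm (K z \<zeta>) * norm (f \<zeta>)) \<partial>M)"
proof (cases "integrable M (\<lambda>\<zeta>. K z \<zeta> * f \<zeta>)")
  case True
  from integral_norm_bound_ennreal[OF this] show ?thesis by (simp add: P_def norm_mult)
qed (simp add: P_def not_integrable_integral_eq)

lemma P_Lp_bound:
  assumes p: "p > 1" and p1: "p * of_int n < s + 2 * of_int n" and p2: "s + 2 * of_int n < p * (of_int n + s)"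
  shows "\<exists>C>0. \<forall>f\<in>Lp_space p M \<inter> Lp_space 2 M. P f \<in> Lp_space p M \<and> Lp_norm p M (P f) \<le> C * Lp_norm p M f"
proof -
  let ?S = "\<lambda>f z. \<integral>\<^sup>+\<zeta>. ennreal (norm (K z \<zeta>) * norm (f \<zeta>)) \<partial>M"
  obtain C where C: "C > 0" and fin: "\<And>f. f \<in> Lp_space p M \<Longrightarrow> AE z in M. ?S f z < \<infinity>"
    and le: "\<And>f. f \<in> Lp_space p M \<Longrightarrow> (\<integral>\<^sup>+z. ennreal (enn2real (?S f z) powr p) \<partial>M)
        \<le> ennreal (C powr p) * (\<integral>\<^sup>+\<zeta>. ennreal (norm (f \<zeta>) powr p) \<partial>M)"
    using kernel_Lp_bound[OF assms] by blast
  show ?thesis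
  proof (intro exI[of _ C] conjI[OF C] ballI)
    fix f assume "f \<in> Lp_space p M \<inter> Lp_space 2 M"
    then have f: "f \<in> Lp_space p M" and f2: "f \<in> Lp_space 2 M" by auto
    have "P f \<in> borel_measurable M" by (rule borel_measurable_holomorphic2(2)[OF P_holomorphic[OF f2]])
    moreover have "(\<integral>\<^sup>+z. ennreal (norm (P f z) powr p) \<partial>M) \<le> ennreal ((C * Lp_norm p M f) powr p)"
    proof -
      have "(\<integral>\<^sup>+z. ennreal (norm (P f z) powr p) \<partial>M)
          \<le> (\<integral>\<^sup>+z. ennreal (enn2real (?S f z) powr p) \<partial>M)"
      proof (rule nn_integral_mono_AE)
        show "AE z in M. ennreal (norm (P f z) powr p)
            \<le> ennreal (enn2real (?S f z) powr p)"
          using fin[OF f]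
        proof eventually_elim
          case (elim z)
          have "norm (P f z) \<le> enn2real (?S f z)"
            using enn2real_mono[OF norm_P_le[of f z]] elim by simp
          then show ?case using p by (intro ennreal_leI powr_mono2) auto
        qed
      qed
      also have "\<dots> \<le> ennreal (C powr p) * (\<integral>\<^sup>+\<zeta>. ennreal (norm (f \<zeta>) powr p) \<partial>M)" by (rule le[OF f])
      also have "\<dots> = ennreal ((C * Lp_norm p M f) powr p)"
        using p C by (simp add: nn_integral_Lp_norm[OF f] powr_mult ennreal_mult)
      finally show ?thesis .
    qed
    ultimately show "P f \<in> Lp_space p M \<and> Lp_norm p M (P f) \<le> C * Lp_norm p M f"
      using p C by (intro Lp_space_normI) auto
  qed
qed

text \<open>At \<open>p = 2\<close> both inequalities of the Schur bound say
  \<open>0 < s\<close>.\<close>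

lemma P_in_V:
  assumes f: "f \<in> Lp_space 2 M"
  shows "P f \<in> V"
  using P_Lp_bound[of 2] f P_holomorphic[OF f] s_pos by (auto simp: V_iff)

end

section \<open>Reproducing property, orthogonality and the identification with the
  projection\<close>

lemma Lp_cong_AE:
  assumes [measurable]: "f \<in> borel_measurable M" "g \<in> borel_measurable M" and eq: "AE z in M. f z = g z"
  shows "f \<in> Lp_space p M \<longleftrightarrow> g \<in> Lp_space p M" and "Lp_norm p M f = Lp_norm p M g"
proof -
  have "(\<integral>\<^sup>+z. ennreal (norm (f z) powr p) \<partial>M) = (\<integral>\<^sup>+z. ennreal (norm (g z) powr p) \<partial>M)"
    by (rule nn_integral_cong_AE) (use eq in eventually_elim, simp)
  then show "f \<in> Lp_space p M \<longleftrightarrow> g \<in> Lp_space p M" by (simp add: Lp_space_iff)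
  have "(LINT z|M. norm (f z) powr p) = (LINT z|M. norm (g z) powr p)"
  proof (rule integral_cong_AE)
    show "AE z in M. norm (f z) powr p = norm (g z) powr p" using eq by eventually_elim simp
  qed simp_all
  then show "Lp_norm p M f = Lp_norm p M g" by (simp add: Lp_norm_def)
qed

text \<open>The affine line covers the two slices of the triangle: first product coordinate varying
  with the second fixed, and the converse, which is a complex line through the origin.\<close>

lemma holomorphic2_slice:
  assumes h: "holomorphic2_on h S" and S: "\<And>x. x \<in> A \<Longrightarrow> (x * a + b, x * c + d) \<in> S"
  shows "(\<lambda>x. h (x * a + b, x * c + d)) holomorphic_on A"
proof (rule holomorphic_onI)
  fix x assume "x \<in> A"
  then obtain \<alpha> \<beta> where D: "(h has_derivative (\<lambda>(v, w). \<alpha> * v + \<beta> * w)) (at (x * a + b, x * c + d))"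
    using h S unfolding holomorphic2_on_def by blast
  have "((\<lambda>x. (x * a + b, x * c + d)) has_derivative (\<lambda>y. (y * a, y * c))) (at x)"
    by (auto intro!: derivative_eq_intros)
  from has_derivative_compose[OF this D]
  have "((\<lambda>x. h (x * a + b, x * c + d)) has_derivative (\<lambda>y. (\<alpha> * a + \<beta> * c) * y)) (at x)"
    by (simp add: algebra_simps)
  then have "((\<lambda>x. h (x * a + b, x * c + d)) has_field_derivative (\<alpha> * a + \<beta> * c)) (at x)"
    by (simp add: has_field_derivative_def)
  then show "(\<lambda>x. h (x * a + b, x * c + d)) field_differentiable at x within A"
    using field_differentiable_def field_differentiable_at_within by blast
qed

lemma holomorphic2_diff:
  assumes "holomorphic2_on f S" "holomorphic2_on g S"
  shows "holomorphic2_on (\<lambda>z. f z - g z) S"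
  unfolding holomorphic2_on_def
proof
  fix z assume "z \<in> S"
  then obtain a b c d where "(f has_derivative (\<lambda>(v, w). a * v + b * w)) (at z)"
    "(g has_derivative (\<lambda>(v, w). c * v + d * w)) (at z)"
    using assms unfolding holomorphic2_on_def by blast
  from has_derivative_diff[OF this]
  have "((\<lambda>z. f z - g z) has_derivative (\<lambda>(v, w). (a - c) * v + (b - d) * w)) (at z)"
    by (simp add: split_def algebra_simps)
  then show "\<exists>a b. ((\<lambda>z. f z - g z) has_derivative (\<lambda>(v, w). a * v + b * w)) (at z)" by blast
qed

text \<open>The weight cancels the antiholomorphic factor of the kernel and leaves a holomorphic
  power.\<close>

lemma weight_cnj_power_int:
  fixes \<omega> :: complex
  assumes "\<omega> \<noteq> 0"
  shows "of_real (norm \<omega> powr (2 * of_int m)) * cnj (\<omega> powi (- m)) = \<omega> powi m"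
proof -
  have "norm \<omega> powr (2 * of_int m) = ((norm \<omega>)\<^sup>2) powr of_int m"
    by (simp add: power2_powr)
  also have "\<dots> = ((norm \<omega>)\<^sup>2) powi m" using assms by (simp add: powr_real_of_int')
  finally have "of_real (norm \<omega> powr (2 * of_int m)) = (\<omega> * cnj \<omega>) powi m"
    by (simp only: of_real_power_int complex_norm_square)
  then show ?thesis
    using assms by (simp add: power_int_mult_distrib power_int_minus)
qed

context hartogs_weighted
begin

text \<open>Since \<open>norm \<omega> powr (2 * n)\<close> absorbs \<open>cnj (e \<zeta>)\<close>,
  the two disc kernels act one variable at a time on
  \<open>h (\<eta> * \<omega>, \<omega>) * \<omega> powi n\<close>, which is holomorphic on the
  slices if \<open>h\<close> is.\<close>

lemma integral_K_iterated:
  assumes h[measurable]: "h \<in> borel_measurable borel" and int: "integrable M (\<lambda>\<zeta>. K z \<zeta> * h \<zeta>)"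
  shows "(LINT \<zeta>|M. K z \<zeta> * h \<zeta>) = e z * (LINT \<omega>|disc_measure s. disc_kernel s (snd z * cnj \<omega>) *
     (LINT \<eta>|disc_measure 2. disc_kernel 2 (fst z / snd z * cnj \<eta>) * (h (\<eta> * \<omega>, \<omega>) * \<omega> powi n)))"
proof -
  let ?I = "\<lambda>\<omega>. LINT \<eta>|disc_measure 2. disc_kernel 2 (fst z / snd z * cnj \<eta>) * (h (\<eta> * \<omega>, \<omega>) * \<omega> powi n)"
  have m1[measurable]: "(\<lambda>\<zeta>. K z \<zeta> * h \<zeta>) \<in> borel_measurable borel" by measurable
  define G where "G = (\<lambda>\<eta> \<omega>. norm \<omega> powr (2 * of_int n) *\<^sub>R (K z (\<eta> * \<omega>, \<omega>) * h (\<eta> * \<omega>, \<omega>)))"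
  have [measurable]: "(\<lambda>p. h (fst p * snd p, snd p)) \<in> borel_measurable (borel \<Otimes>\<^sub>M borel)"
    "(\<lambda>p. h (snd p * fst p, fst p)) \<in> borel_measurable (borel \<Otimes>\<^sub>M borel)"
    by measurable
  have intG: "integrable (disc_measure 2 \<Otimes>\<^sub>M disc_measure s) (\<lambda>(\<eta>, \<omega>). G \<eta> \<omega>)"
    using integrable_M_iff[OF m1] int by (simp add: G_def N_def split_def)
  have "(LINT \<zeta>|M. K z \<zeta> * h \<zeta>) = (LINT p|(disc_measure 2 \<Otimes>\<^sub>M disc_measure s). (\<lambda>(\<eta>, \<omega>). G \<eta> \<omega>) p)"
    using integral_M[OF m1] by (simp add: G_def N_def split_def)
  also have "\<dots> = (LINT \<omega>|disc_measure s. LINT \<eta>|disc_measure 2. G \<eta> \<omega>)"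
    by (rule D.integral_snd[OF intG, symmetric])
  also have "\<dots> = (LINT \<omega>|disc_measure s. e z * (disc_kernel s (snd z * cnj \<omega>) * ?I \<omega>))"
  proof (rule integral_cong_AE)
    show "(\<lambda>\<omega>. LINT \<eta>|disc_measure 2. G \<eta> \<omega>) \<in> borel_measurable (disc_measure s)"
      unfolding G_def by measurable
    show "(\<lambda>\<omega>. e z * (disc_kernel s (snd z * cnj \<omega>) * ?I \<omega>)) \<in> borel_measurable (disc_measure s)"
      by measurable
    show "AE \<omega> in disc_measure s. (LINT \<eta>|disc_measure 2. G \<eta> \<omega>) = e z * (disc_kernel s (snd z * cnj \<omega>) * ?I \<omega>)"
      using AE_disc_measure
    proof eventually_elim
      case (elim \<omega>)
      have \<omega>: "\<omega> \<noteq> 0" using elim by auto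
      have "G \<eta> \<omega> = (e z * disc_kernel s (snd z * cnj \<omega>)) * (disc_kernel 2 (fst z / snd z * cnj \<eta>) * (h (\<eta> * \<omega>, \<omega>) * \<omega> powi n))" for \<eta>
        unfolding weight_cnj_power_int[OF \<omega>, of n, symmetric] G_def K_def e_def scaleR_conv_of_real
        using \<omega> by (simp add: mult_ac)
      then have "(LINT \<eta>|disc_measure 2. G \<eta> \<omega>) = (LINT \<eta>|disc_measure 2. (e z * disc_kernel s (snd z * cnj \<omega>)) * (disc_kernel 2 (fst z / snd z * cnj \<eta>) * (h (\<eta> * \<omega>, \<omega>) * \<omega> powi n)))"
        by simp
      also have "\<dots> = (e z * disc_kernel s (snd z * cnj \<omega>)) * ?I \<omega>"
        by (rule integral_mult_right_zero)
      finally show ?case by (simp only: mult.assoc)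
    qed
  qed
  also have "\<dots> = e z * (LINT \<omega>|disc_measure s. disc_kernel s (snd z * cnj \<omega>) * ?I \<omega>)"
    by (rule integral_mult_right_zero)
  finally show ?thesis .
qed

text \<open>The inner integral reproduces in the first coordinate, the outer one in the second. Each
  step needs a square integrable slice, which Tonelli supplies for almost every slice only. The
  exceptional \<open>\<omega>\<close> disappear under the outer integral; the exceptional first
  coordinates restrict the conclusion to almost every \<open>z\<close>.\<close>

lemma P_reproducing:
  assumes h: "h \<in> V"
  shows "AE z in M. P h z = h z"
proof -
  have hol: "holomorphic2_on h hartogs_triangle" and hL: "h \<in> Lp_space 2 M" using h by (auto simp: V_iff)
  define h0 where "h0 = (\<lambda>z. indicator hartogs_triangle z *\<^sub>R h z)"
  have h0m[measurable]: "h0 \<in> borel_measurable borel"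
    unfolding h0_def by (rule borel_measurable_holomorphic2(1)[OF hol])
  have h0_eq: "h0 z = h z" if "z \<in> hartogs_triangle" for z using that by (simp add: h0_def)
  define g where "g = (\<lambda>u w. h0 (u * w, w) * w powi n)"
  have gm[measurable]: "case_prod g \<in> borel_measurable (borel \<Otimes>\<^sub>M borel)"
    "(\<lambda>p. g (snd p) (fst p)) \<in> borel_measurable (borel \<Otimes>\<^sub>M borel)"
    "g u \<in> borel_measurable borel" "(\<lambda>u. g u w) \<in> borel_measurable borel" for u w
    unfolding g_def split_def by measurable
  have fin: "(\<integral>\<^sup>+w. \<integral>\<^sup>+u. ennreal ((norm (g u w))\<^sup>2) \<partial>disc_measure 2 \<partial>disc_measure s) < \<infinity>"
  proof -
    have "(\<integral>\<^sup>+w. \<integral>\<^sup>+u. ennreal ((norm (g u w))\<^sup>2) \<partial>disc_measure 2 \<partial>disc_measure s)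
      = (\<integral>\<^sup>+w. \<integral>\<^sup>+u. ennreal ((norm (h0 (u * w, w)))\<^sup>2) * ennreal (norm w powr (2 * of_int n)) \<partial>disc_measure 2 \<partial>disc_measure s)"
    proof (rule nn_integral_cong_AE)
      show "AE w in disc_measure s. (\<integral>\<^sup>+u. ennreal ((norm (g u w))\<^sup>2) \<partial>disc_measure 2)
         = (\<integral>\<^sup>+u. ennreal ((norm (h0 (u * w, w)))\<^sup>2) * ennreal (norm w powr (2 * of_int n)) \<partial>disc_measure 2)"
        using AE_disc_measure
      proof eventually_elim
        case (elim w)
        have "norm w powr (2 * of_int n) = (norm w powr of_int n)\<^sup>2"
          by (simp add: power2_eq_square powr_add[symmetric])
        then have "(norm (g u w))\<^sup>2 = (norm (h0 (u * w, w)))\<^sup>2 * norm w powr (2 * of_int n)" for u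
          using elim by (simp add: g_def norm_mult power_mult_distrib norm_power_int_eq_powr)
        then show ?case by (simp add: ennreal_mult)
      qed
    qed
    also have "\<dots> = (\<integral>\<^sup>+z. ennreal ((norm (h0 z))\<^sup>2) \<partial>M)"
      by (rule nn_integral_M[symmetric]) measurable
    also have "\<dots> = (\<integral>\<^sup>+z. ennreal ((norm (h z))\<^sup>2) \<partial>M)"
      by (intro nn_integral_cong) (simp add: h0_eq)
    also have "\<dots> < \<infinity>"
      using hL unfolding Lp_space_2_iff integrable_iff_bounded by simp
    finally show ?thesis .
  qed
  then have AE1: "AE w in disc_measure s. (\<integral>\<^sup>+u. ennreal ((norm (g u w))\<^sup>2) \<partial>disc_measure 2) \<noteq> \<infinity>"
    by (intro nn_integral_PInf_AE) auto
  have "(\<integral>\<^sup>+u. \<integral>\<^sup>+w. ennreal ((norm (g u w))\<^sup>2) \<partial>disc_measure s \<partial>disc_measure 2)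
      = (\<integral>\<^sup>+w. \<integral>\<^sup>+u. ennreal ((norm (g u w))\<^sup>2) \<partial>disc_measure 2 \<partial>disc_measure s)"
    by (rule D.Fubini'[symmetric]) measurable
  with fin have fin2: "(\<integral>\<^sup>+u. \<integral>\<^sup>+w. ennreal ((norm (g u w))\<^sup>2) \<partial>disc_measure s \<partial>disc_measure 2) \<noteq> \<infinity>"
    by simp
  \<comment> \<open>The first coordinates with a slice that is not square integrable. Their preimage
    in the triangle is shown to be null for \<open>M\<close>.\<close>
  define U where "U = {u. (\<integral>\<^sup>+w. ennreal ((norm (g u w))\<^sup>2) \<partial>disc_measure s) = \<infinity>}"
  have Um: "(\<lambda>u. \<integral>\<^sup>+w. ennreal ((norm (g u w))\<^sup>2) \<partial>disc_measure s) \<in> borel_measurable borel" by measurable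
  have [measurable]: "U \<in> sets borel" unfolding U_def using Um by measurable
  have "AE u in disc_measure 2. (\<integral>\<^sup>+w. ennreal ((norm (g u w))\<^sup>2) \<partial>disc_measure s) \<noteq> \<infinity>"
    by (rule nn_integral_PInf_AE[OF _ fin2]) (use Um in simp)
  then have U0: "AE u in disc_measure 2. u \<notin> U" by (simp add: U_def)
  have "AE z in M. fst z / snd z \<notin> U"
  proof -
    have m: "(\<lambda>z. indicator U (fst z / snd z) :: ennreal) \<in> borel_measurable borel" by measurable
    have "(\<integral>\<^sup>+z. indicator U (fst z / snd z) \<partial>M)
      = (\<integral>\<^sup>+w. \<integral>\<^sup>+u. indicator U (fst (u * w, w) / snd (u * w, w)) * ennreal (norm w powr (2 * of_int n)) \<partial>disc_measure 2 \<partial>disc_measure s)"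
      by (rule nn_integral_M[OF m])
    also have "\<dots> = (\<integral>\<^sup>+w. 0 \<partial>disc_measure s)"
    proof (rule nn_integral_cong_AE)
      show "AE w in disc_measure s. (\<integral>\<^sup>+u. indicator U (fst (u * w, w) / snd (u * w, w)) * ennreal (norm w powr (2 * of_int n)) \<partial>disc_measure 2) = 0"
        using AE_disc_measure
      proof eventually_elim
        case (elim w)
        have "(\<integral>\<^sup>+u. indicator U (fst (u * w, w) / snd (u * w, w)) * ennreal (norm w powr (2 * of_int n)) \<partial>disc_measure 2)
          = (\<integral>\<^sup>+u. 0 \<partial>disc_measure 2)"
        proof (rule nn_integral_cong_AE)
          show "AE u in disc_measure 2. indicator U (fst (u * w, w) / snd (u * w, w)) * ennreal (norm w powr (2 * of_int n)) = 0"
            using U0 by eventually_elim (use elim in simp)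
        qed
        then show ?case by simp
      qed
    qed
    finally have "(\<integral>\<^sup>+z. indicator U (fst z / snd z) \<partial>M) = 0" by simp
    then have "AE z in M. (indicator U (fst z / snd z) :: ennreal) = 0"
      using nn_integral_0_iff_AE[OF borel_measurable_M[OF m]] by simp
    then show ?thesis by eventually_elim (simp add: indicator_def split: if_splits)
  qed
  then show ?thesis using AE_space
  proof eventually_elim
    case (elim z)
    then have z: "z \<in> hartogs_triangle" by simp
    note zD = hartogs_triangleD[OF z]
    define u w where "u = fst z / snd z" and "w = snd z"
    have u: "norm u < 1" and w: "0 < norm w" "norm w < 1" using zD by (auto simp: u_def w_def)
    have z_eq: "z = (u * w, w)" using zD by (simp add: u_def w_def prod_eq_iff)
    have uU: "(\<integral>\<^sup>+w. ennreal ((norm (g u w))\<^sup>2) \<partial>disc_measure s) < \<infinity>"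
      using elim(1) by (simp add: U_def u_def less_top)
    have int: "integrable M (\<lambda>\<zeta>. K z \<zeta> * h0 \<zeta>)"
      using integrable_K[OF hL z] by (rule Bochner_Integration.integrable_cong[THEN iffD1, rotated 2]) (simp_all add: h0_eq)
    have "P h z = (LINT \<zeta>|M. K z \<zeta> * h0 \<zeta>)"
      unfolding P_def by (intro Bochner_Integration.integral_cong) (simp_all add: h0_eq)
    also have "\<dots> = e z * (LINT \<omega>|disc_measure s. disc_kernel s (w * cnj \<omega>) *
        (LINT \<eta>|disc_measure 2. disc_kernel 2 (u * cnj \<eta>) * g \<eta> \<omega>))"
      unfolding integral_K_iterated[OF h0m int] g_def u_def w_def ..
    also have "(LINT \<omega>|disc_measure s. disc_kernel s (w * cnj \<omega>) *
        (LINT \<eta>|disc_measure 2. disc_kernel 2 (u * cnj \<eta>) * g \<eta> \<omega>)) = (LINT \<omega>|disc_measure s. disc_kernel s (w * cnj \<omega>) * g u \<omega>)"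
    proof (rule integral_cong_AE)
      have "(\<lambda>(x, y). disc_kernel 2 (u * cnj y) * g y x) \<in> borel_measurable (disc_measure s \<Otimes>\<^sub>M disc_measure 2)"
        unfolding split_def by measurable
      from D2.borel_measurable_lebesgue_integral[OF this]
      show "(\<lambda>\<omega>. disc_kernel s (w * cnj \<omega>) * (LINT \<eta>|disc_measure 2. disc_kernel 2 (u * cnj \<eta>) * g \<eta> \<omega>)) \<in> borel_measurable (disc_measure s)"
        by measurable
      show "AE \<omega> in disc_measure s. disc_kernel s (w * cnj \<omega>) * (LINT \<eta>|disc_measure 2. disc_kernel 2 (u * cnj \<eta>) * g \<eta> \<omega>) = disc_kernel s (w * cnj \<omega>) * g u \<omega>"
        using AE1 AE_disc_measure
      proof eventually_elim
        case \<omega>: (elim \<omega>)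
        have \<omega>0: "\<omega> \<noteq> 0" using \<omega> by auto
        have "(\<lambda>\<eta>. h (\<eta> * \<omega> + 0, \<eta> * 0 + \<omega>)) holomorphic_on ball 0 1"
          by (rule holomorphic2_slice[OF hol]) (use \<omega> hartogs_triangle_mult_iff[OF \<omega>0] in simp)
        then have "(\<lambda>\<eta>. h (\<eta> * \<omega>, \<omega>) * \<omega> powi n) holomorphic_on ball 0 1"
          by (intro holomorphic_on_mult) simp_all
        then have holg: "(\<lambda>\<eta>. g \<eta> \<omega>) holomorphic_on ball 0 1"
          by (rule holomorphic_transform) (use \<omega> \<omega>0 in \<open>simp add: g_def h0_eq hartogs_triangle_mult_iff\<close>)
        have "integrable (disc_measure 2) (\<lambda>\<eta>. (norm (g \<eta> \<omega>))\<^sup>2)"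
          using \<omega>(1) by (simp add: integrable_iff_bounded less_top)
        then have "integrable (disc_measure 2) (\<lambda>\<eta>. (g \<eta> \<omega>)\<^sup>2)"
          by (intro integrable_norm_cancel[where f="\<lambda>\<eta>. (g \<eta> \<omega>)\<^sup>2"]) (simp_all add: norm_power)
        then have "integrable (disc_measure 2) (\<lambda>\<eta>. g \<eta> \<omega>)"
          by (rule D2.square_integrable_imp_integrable[rotated]) simp
        from disc_kernel_reproducing[OF holg this _ u] show ?case by simp
      qed
    qed simp
    also have "\<dots> = g u w"
    proof (rule disc_kernel_reproducing_punctured[OF _ _ uU s_pos s_le w])
      have "(\<lambda>\<omega>. h (\<omega> * u + 0, \<omega> * 1 + 0)) holomorphic_on ball 0 1 - {0}"
        by (rule holomorphic2_slice[OF hol]) (use u hartogs_triangle_mult_iff in \<open>auto simp: mult.commute\<close>)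
      then have "(\<lambda>\<omega>. h (\<omega> * u, \<omega>) * \<omega> powi n) holomorphic_on ball 0 1 - {0}"
        by (intro holomorphic_on_mult holomorphic_on_power_int) (auto intro!: holomorphic_intros)
      then show "g u holomorphic_on ball 0 1 - {0}"
      proof (rule holomorphic_transform)
        fix \<omega> :: complex assume \<omega>: "\<omega> \<in> ball 0 1 - {0}"
        then have "(u * \<omega>, \<omega>) \<in> hartogs_triangle"
          using u by (simp add: hartogs_triangle_mult_iff)
        then show "h (\<omega> * u, \<omega>) * \<omega> powi n = g u \<omega>"
          by (simp add: g_def h0_eq mult.commute[of \<omega> u])
      qed
    qed simp
    also have "e z * g u w = h z"
      using w z by (simp add: e_def g_def w_def[symmetric] z_eq[symmetric] h0_eq power_int_minus)
    finally show ?case .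
  qed
qed

text \<open>Justifies Fubini for the adjoint. By the Schur test at \<open>p = 2\<close> the absolute
  integral \<open>S\<close> is square integrable, and \<open>S * norm h\<close> is at most the sum
  of the squares.\<close>

lemma integrable_kernel_pair:
  assumes f: "f \<in> Lp_space 2 M" and h: "h \<in> Lp_space 2 M"
  shows "integrable (M \<Otimes>\<^sub>M M) (\<lambda>(z, \<zeta>). K z \<zeta> * f \<zeta> * cnj (h z))"
  unfolding integrable_iff_bounded
proof
  interpret sigma_finite_measure M by (rule sigma_finite_M)
  interpret pair_sigma_finite M M ..
  have [measurable]: "f \<in> borel_measurable M" "h \<in> borel_measurable M"
    using f h by (simp_all add: Lp_space_2_iff)
  have [measurable]: "(\<lambda>p. K (fst p) (snd p)) \<in> borel_measurable (M \<Otimes>\<^sub>M M)"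
    by (rule borel_measurable_K[OF borel_measurable_pair_M])
  show m: "(\<lambda>(z, \<zeta>). K z \<zeta> * f \<zeta> * cnj (h z)) \<in> borel_measurable (M \<Otimes>\<^sub>M M)"
    unfolding split_def by measurable
  obtain C where fin: "AE z in M. (\<integral>\<^sup>+\<zeta>. ennreal (norm (K z \<zeta>) * norm (f \<zeta>)) \<partial>M) < \<infinity>"
    and le: "(\<integral>\<^sup>+z. ennreal (enn2real (\<integral>\<^sup>+\<zeta>. ennreal (norm (K z \<zeta>) * norm (f \<zeta>)) \<partial>M) powr 2) \<partial>M)
        \<le> ennreal (C powr 2) * (\<integral>\<^sup>+\<zeta>. ennreal (norm (f \<zeta>) powr 2) \<partial>M)"
    using kernel_Lp_bound[of 2] f s_pos by fastforce
  define S where "S = (\<lambda>z. \<integral>\<^sup>+\<zeta>. ennreal (norm (K z \<zeta>) * norm (f \<zeta>)) \<partial>M)"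
  have [measurable]: "S \<in> borel_measurable M" unfolding S_def by measurable
  have "(\<integral>\<^sup>+p. ennreal (norm (case p of (z, \<zeta>) \<Rightarrow> K z \<zeta> * f \<zeta> * cnj (h z))) \<partial>(M \<Otimes>\<^sub>M M))
     = (\<integral>\<^sup>+z. \<integral>\<^sup>+\<zeta>. ennreal (norm (case (z, \<zeta>) of (z, \<zeta>) \<Rightarrow> K z \<zeta> * f \<zeta> * cnj (h z))) \<partial>M \<partial>M)"
    by (rule sigma_finite_measure.nn_integral_fst[OF sigma_finite_M measurable_compose[OF measurable_compose[OF m borel_measurable_norm] measurable_ennreal], symmetric])
  also have "\<dots> = (\<integral>\<^sup>+z. S z * ennreal (norm (h z)) \<partial>M)"
  proof (rule nn_integral_cong)
    fix z
    have "(\<integral>\<^sup>+\<zeta>. ennreal (norm (case (z, \<zeta>) of (z, \<zeta>) \<Rightarrow> K z \<zeta> * f \<zeta> * cnj (h z))) \<partial>M)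
       = (\<integral>\<^sup>+\<zeta>. ennreal (norm (K z \<zeta>) * norm (f \<zeta>)) * ennreal (norm (h z)) \<partial>M)"
      by (simp add: norm_mult ennreal_mult[symmetric])
    also have "\<dots> = S z * ennreal (norm (h z))"
      unfolding S_def by (rule nn_integral_multc) measurable
    finally show "(\<integral>\<^sup>+\<zeta>. ennreal (norm (case (z, \<zeta>) of (z, \<zeta>) \<Rightarrow> K z \<zeta> * f \<zeta> * cnj (h z))) \<partial>M) = S z * ennreal (norm (h z))" .
  qed
  also have "\<dots> \<le> (\<integral>\<^sup>+z. ennreal (enn2real (S z) powr 2) + ennreal (norm (h z) powr 2) \<partial>M)"
  proof (rule nn_integral_mono_AE)
    show "AE z in M. S z * ennreal (norm (h z)) \<le> ennreal (enn2real (S z) powr 2) + ennreal (norm (h z) powr 2)"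
      using fin
    proof eventually_elim
      case (elim z)
      have "2 * (enn2real (S z) * norm (h z)) \<le> (enn2real (S z))\<^sup>2 + (norm (h z))\<^sup>2"
        using sum_squares_bound[of "enn2real (S z)" "norm (h z)"] by (simp add: mult.assoc)
      moreover have "0 \<le> enn2real (S z) * norm (h z)" by (intro mult_nonneg_nonneg) auto
      ultimately have "enn2real (S z) * norm (h z) \<le> (enn2real (S z))\<^sup>2 + (norm (h z))\<^sup>2" by linarith
      then have "enn2real (S z) * norm (h z) \<le> enn2real (S z) powr 2 + norm (h z) powr 2" by simp
      then have "ennreal (enn2real (S z) * norm (h z)) \<le> ennreal (enn2real (S z) powr 2 + norm (h z) powr 2)"
        by (rule ennreal_leI)
      then show ?case using elim by (simp add: ennreal_mult S_def)
    qed
  qed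
  also have "\<dots> = (\<integral>\<^sup>+z. ennreal (enn2real (S z) powr 2) \<partial>M) + (\<integral>\<^sup>+z. ennreal (norm (h z) powr 2) \<partial>M)"
    by (rule nn_integral_add) measurable
  also have "\<dots> < \<infinity>"
  proof -
    have "(\<integral>\<^sup>+z. ennreal (norm (h z) powr 2) \<partial>M) < \<infinity>" "(\<integral>\<^sup>+z. ennreal (norm (f z) powr 2) \<partial>M) < \<infinity>"
      using f h unfolding Lp_space_iff by blast+
    moreover have "(\<integral>\<^sup>+z. ennreal (enn2real (S z) powr 2) \<partial>M) < \<infinity>"
      using le unfolding S_def by (rule order.strict_trans1) (use calculation in \<open>simp add: ennreal_mult_less_top\<close>)
    ultimately show ?thesis by simp
  qed
  finally show "(\<integral>\<^sup>+p. ennreal (norm (case p of (z, \<zeta>) \<Rightarrow> K z \<zeta> * f \<zeta> * cnj (h z))) \<partial>(M \<Otimes>\<^sub>M M)) < \<infinity>" .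
qed

text \<open>The kernel is Hermitian, so P is symmetric, and it fixes \<open>h\<close>: the inner
  product of \<open>P f\<close> with \<open>h\<close> equals that of \<open>f\<close> with
  \<open>P h\<close>, hence with \<open>h\<close>.\<close>

lemma P_orthogonal:
  assumes f: "f \<in> Lp_space 2 M" and h: "h \<in> V"
  shows "L2_inner M (\<lambda>z. f z - P f z) h = 0"
proof -
  interpret sigma_finite_measure M by (rule sigma_finite_M)
  interpret pair_sigma_finite M M ..
  have hL: "h \<in> Lp_space 2 M" using h by (simp add: V_iff)
  have PL: "P f \<in> Lp_space 2 M" using P_in_V[OF f] by (simp add: V_iff)
  have m[measurable]: "f \<in> borel_measurable M" "h \<in> borel_measurable M"
    using f hL by (simp_all add: Lp_space_2_iff)
  have Phm: "P h \<in> borel_measurable M"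
    by (rule borel_measurable_holomorphic2(2)[OF P_holomorphic[OF hL]])
  have "(LINT z|M. P f z * cnj (h z)) = (LINT z|M. LINT \<zeta>|M. K z \<zeta> * f \<zeta> * cnj (h z))"
    unfolding P_def by simp
  also have "\<dots> = (LINT \<zeta>|M. LINT z|M. K z \<zeta> * f \<zeta> * cnj (h z))"
    by (rule Fubini_integral[symmetric]) (rule integrable_kernel_pair[OF f hL])
  also have "\<dots> = (LINT \<zeta>|M. f \<zeta> * cnj (P h \<zeta>))"
  proof (rule Bochner_Integration.integral_cong)
    fix \<zeta>
    have "(LINT z|M. K z \<zeta> * f \<zeta> * cnj (h z)) = (LINT z|M. f \<zeta> * cnj (K \<zeta> z * h z))"
      by (intro Bochner_Integration.integral_cong) (simp_all add: K_cnj[of \<zeta>] mult_ac)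
    also have "\<dots> = f \<zeta> * cnj (P h \<zeta>)"
      unfolding P_def by (simp only: integral_mult_right_zero Bochner_Integration.integral_cnj)
    finally show "(LINT z|M. K z \<zeta> * f \<zeta> * cnj (h z)) = f \<zeta> * cnj (P h \<zeta>)" .
  qed simp
  also have "\<dots> = (LINT \<zeta>|M. f \<zeta> * cnj (h \<zeta>))"
  proof (rule integral_cong_AE)
    show "AE \<zeta> in M. f \<zeta> * cnj (P h \<zeta>) = f \<zeta> * cnj (h \<zeta>)"
      using P_reproducing[OF h] by eventually_elim simp
  qed (use Phm in measurable)
  finally have eq: "(LINT z|M. P f z * cnj (h z)) = (LINT \<zeta>|M. f \<zeta> * cnj (h \<zeta>))" .
  have "L2_inner M (\<lambda>z. f z - P f z) h = (LINT z|M. f z * cnj (h z) - P f z * cnj (h z))"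
    by (simp add: L2_inner_def left_diff_distrib)
  also have "\<dots> = (LINT z|M. f z * cnj (h z)) - (LINT z|M. P f z * cnj (h z))"
    by (intro Bochner_Integration.integral_diff integrable_L2_product f hL PL)
  finally show ?thesis using eq by simp
qed

definition B :: "(complex \<times> complex \<Rightarrow> complex) \<Rightarrow> complex \<times> complex \<Rightarrow> complex" where
  "B = bergman_projection hartogs_triangle (hartogs_weight (s + 2 * of_int n - 4))"

lemma B_eq_P:
  assumes f: "f \<in> Lp_space 2 M"
  shows "B f \<in> borel_measurable M" and "P f \<in> borel_measurable M" and "AE z in M. B f z = P f z"
proof -
  have B: "B f = orthogonal_projection M V f"
    by (simp add: B_def bergman_projection_def V_def M_def)
  have V: "V \<subseteq> Lp_space 2 M" by (auto simp: V_iff)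
  have Vd: "(\<lambda>z. g z - h z) \<in> V" if "g \<in> V" "h \<in> V" for g h
    using that by (auto simp: V_iff intro: Lp_space_2_diff holomorphic2_diff)
  note u = orthogonal_projection_unique[OF f V Vd P_in_V[OF f] P_orthogonal[OF f]]
  show "AE z in M. B f z = P f z" unfolding B by (rule u(2))
  show "B f \<in> borel_measurable M" using u(1) unfolding B V_iff Lp_space_2_iff by blast
  show "P f \<in> borel_measurable M" using P_in_V[OF f] unfolding V_iff Lp_space_2_iff by blast
qed

lemma B_Lp_bounded:
  assumes "p > 1" "p * of_int n < s + 2 * of_int n" "s + 2 * of_int n < p * (of_int n + s)"
  shows "Lp_bounded p M B"
proof -
  obtain C where C: "\<And>f. f \<in> Lp_space p M \<inter> Lp_space 2 M \<Longrightarrow> P f \<in> Lp_space p M \<and> Lp_norm p M (P f) \<le> C * Lp_norm p M f"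
    using P_Lp_bound[OF assms] by blast
  show ?thesis unfolding Lp_bounded_def
  proof (intro exI[of _ C] ballI)
    fix f assume f: "f \<in> Lp_space p M \<inter> Lp_space 2 M"
    then have f2: "f \<in> Lp_space 2 M" by simp
    from C[OF f] Lp_cong_AE[OF B_eq_P[OF f2], of p]
    show "B f \<in> Lp_space p M \<and> Lp_norm p M (B f) \<le> C * Lp_norm p M f" by simp
  qed
qed

end

section \<open>Sharpness\<close>

context hartogs_weighted
begin

text \<open>After the factor \<open>e\<close> is cancelled, what remains is constant in the first
  coordinate and radial in the second. The first kernel reproduces the constant; the second sees
  only its coefficient of degree 0, which is \<open>s / (2 * pi)\<close>.\<close>

lemma P_radial:
  fixes \<psi> :: "real \<Rightarrow> real"
  assumes [measurable]: "\<psi> \<in> borel_measurable borel" and int: "integrable (disc_measure s) (\<lambda>\<omega>. \<psi> (norm \<omega>))"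
    and f: "(\<lambda>z. e z * of_real (\<psi> (norm (snd z)))) \<in> Lp_space 2 M" and z: "z \<in> hartogs_triangle"
  shows "P (\<lambda>z. e z * of_real (\<psi> (norm (snd z)))) z
    = e z * of_real (s / (2 * pi) * (LINT \<omega>|disc_measure s. \<psi> (norm \<omega>)))"
proof -
  define u w where "u = fst z / snd z" and "w = snd z"
  have u: "norm u < 1" and w: "norm w < 1" using hartogs_triangleD[OF z] by (auto simp: u_def w_def)
  let ?f = "\<lambda>z. e z * of_real (\<psi> (norm (snd z)))"
  let ?I = "\<lambda>\<omega>. LINT \<eta>|disc_measure 2. disc_kernel 2 (u * cnj \<eta>) * (?f (\<eta> * \<omega>, \<omega>) * \<omega> powi n)"
  have fm: "?f \<in> borel_measurable borel" by measurable
  have "P ?f z = e z * (LINT \<omega>|disc_measure s. disc_kernel s (w * cnj \<omega>) * ?I \<omega>)"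
    unfolding P_def u_def w_def by (rule integral_K_iterated[OF fm integrable_K[OF f z]])
  also have "(LINT \<omega>|disc_measure s. disc_kernel s (w * cnj \<omega>) * ?I \<omega>)
    = (LINT \<omega>|disc_measure s. (\<Sum>m. disc_kernel_coeff s m * (w * cnj \<omega>) ^ m) * of_real (\<psi> (norm \<omega>)))"
  proof (rule integral_cong_AE)
    have "(\<lambda>(x, y). disc_kernel 2 (u * cnj y) * (?f (y * x, x) * x powi n)) \<in> borel_measurable (disc_measure s \<Otimes>\<^sub>M disc_measure 2)"
      unfolding split_def by measurable
    from D2.borel_measurable_lebesgue_integral[OF this]
    show "(\<lambda>\<omega>. disc_kernel s (w * cnj \<omega>) * ?I \<omega>) \<in> borel_measurable (disc_measure s)"
      by measurable
    show "AE \<omega> in disc_measure s. disc_kernel s (w * cnj \<omega>) * ?I \<omega>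
      = (\<Sum>m. disc_kernel_coeff s m * (w * cnj \<omega>) ^ m) * of_real (\<psi> (norm \<omega>))"
      using AE_disc_measure
    proof eventually_elim
      case (elim \<omega>)
      have "?f (\<eta> * \<omega>, \<omega>) * \<omega> powi n = of_real (\<psi> (norm \<omega>))" for \<eta>
        using elim by (simp add: e_def power_int_minus)
      then have "?I \<omega>
         = (LINT \<eta>|disc_measure 2. disc_kernel 2 (u * cnj \<eta>) * of_real (\<psi> (norm \<omega>)))"
        by (intro Bochner_Integration.integral_cong refl arg_cong2[where f="(*)"])
      also have "\<dots> = of_real (\<psi> (norm \<omega>))"
        by (rule disc_kernel_reproducing[OF _ _ _ u]) simp_all
      finally have 1: "?I \<omega> = of_real (\<psi> (norm \<omega>))" .
      have "norm (w * cnj \<omega>) \<le> norm w" using elim by (simp add: norm_mult mult_left_le)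
      then have "disc_kernel s (w * cnj \<omega>) = (\<Sum>m. disc_kernel_coeff s m * (w * cnj \<omega>) ^ m)"
        using disc_kernel_sums[of "w * cnj \<omega>" s] w by (simp add: sums_iff)
      with 1 show ?case by simp
    qed
  qed simp
  also have "\<dots> = disc_kernel_coeff s 0 * (LINT \<omega>|disc_measure s. of_real (\<psi> (norm \<omega>)))"
    by (rule integral_disc_measure_mean_value) (use int summable_disc_kernel_coeff[OF w s_pos] in auto)
  also have "\<dots> = of_real (s / (2 * pi) * (LINT \<omega>|disc_measure s. \<psi> (norm \<omega>)))"
    by (simp add: disc_kernel_coeff_def)
  finally show ?thesis .
qed

text \<open>The exponent is borderline: against \<open>norm w powr (s - 2)\<close> it leaves
  \<open>norm w powr (- 2)\<close>, whose area integral diverges logarithmically at 0.\<close>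

definition cutoff :: "real \<Rightarrow> real \<Rightarrow> real" where
  "cutoff \<epsilon> r = r powr (- s) * indicator {\<epsilon><..} r"

definition L :: "real \<Rightarrow> real" where
  "L \<epsilon> = (LINT \<omega>|disc_measure s. cutoff \<epsilon> (norm \<omega>))"

definition test :: "real \<Rightarrow> complex \<times> complex \<Rightarrow> complex" where
  "test \<epsilon> z = e z * of_real (cutoff \<epsilon> (norm (snd z)))"

lemma borel_measurable_cutoff [measurable]: "cutoff \<epsilon> \<in> borel_measurable borel"
  unfolding cutoff_def by measurable

lemma cutoff_nonneg: "0 \<le> cutoff \<epsilon> r"
  by (simp add: cutoff_def)

lemma powr_cutoff_le:
  fixes r :: real
  assumes "0 < \<epsilon>" "\<epsilon> < r" "r < 1"
  shows "r powr x \<le> \<epsilon> powr (- \<bar>x\<bar>)"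
proof (cases "x \<ge> 0")
  case True
  then have "r powr x \<le> 1 powr x" using assms by (intro powr_mono2) auto
  also have "1 powr x = 1 powr - \<bar>x\<bar>" by simp
  also have "\<dots> \<le> \<epsilon> powr - \<bar>x\<bar>" using assms by (intro powr_mono2') auto
  finally show ?thesis .
next
  case False
  then have "r powr x \<le> \<epsilon> powr x" using assms by (intro powr_mono2') auto
  with False show ?thesis by simp
qed

lemma nn_integral_truncated_finite:
  assumes "0 < \<epsilon>"
  shows "(\<integral>\<^sup>+\<omega>. ennreal (norm \<omega> powr x * indicator {\<epsilon><..} (norm \<omega>)) \<partial>disc_measure s) < \<infinity>"
proof -
  have "(\<integral>\<^sup>+\<omega>. ennreal (norm \<omega> powr x * indicator {\<epsilon><..} (norm \<omega>)) \<partial>disc_measure s)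
    \<le> (\<integral>\<^sup>+\<omega>. ennreal (\<epsilon> powr (- \<bar>x\<bar>)) \<partial>disc_measure s)"
  proof (rule nn_integral_mono_AE)
    show "AE \<omega> in disc_measure s. ennreal (norm \<omega> powr x * indicator {\<epsilon><..} (norm \<omega>)) \<le> ennreal (\<epsilon> powr (- \<bar>x\<bar>))"
      using AE_disc_measure
      by eventually_elim (use assms powr_cutoff_le in \<open>auto simp: indicator_def intro!: ennreal_leI\<close>)
  qed
  also have "\<dots> < \<infinity>"
  proof -
    have "emeasure (disc_measure s) UNIV < top"
      unfolding less_top[symmetric] by (rule Ds.emeasure_finite)
    then show ?thesis by (simp add: ennreal_mult_less_top)
  qed
  finally show ?thesis .
qed

lemma integrable_cutoff: "0 < \<epsilon> \<Longrightarrow> integrable (disc_measure s) (\<lambda>\<omega>. cutoff \<epsilon> (norm \<omega>))"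
  unfolding integrable_iff_bounded
  using nn_integral_truncated_finite[of \<epsilon> "- s"] by (simp add: cutoff_def abs_mult)

lemma nn_integral_cutoff: "0 < \<epsilon> \<Longrightarrow> (\<integral>\<^sup>+\<omega>. ennreal (cutoff \<epsilon> (norm \<omega>)) \<partial>disc_measure s) = ennreal (L \<epsilon>)"
  unfolding L_def by (intro nn_integral_eq_integral integrable_cutoff) (simp_all add: cutoff_nonneg)

text \<open>By monotone convergence along \<open>\<epsilon> = 1 / Suc i\<close>, the values increase
  to the moment of order \<open>- s\<close>, which is infinite.\<close>

lemma L_unbounded: "\<exists>\<epsilon>>0. L \<epsilon> > Q"
proof (rule ccontr)
  assume "\<not> ?thesis"
  then have le: "L \<epsilon> \<le> Q" if "\<epsilon> > 0" for \<epsilon> using that not_le by blast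
  have "(\<lambda>i. \<integral>\<^sup>+\<omega>. ennreal (cutoff (1 / real (Suc i)) (norm \<omega>)) \<partial>disc_measure s)
      \<longlonglongrightarrow> (\<integral>\<^sup>+\<omega>. ennreal (norm \<omega> powr - s) \<partial>disc_measure s)"
  proof (rule nn_integral_LIMSEQ)
    show "incseq (\<lambda>i \<omega>. ennreal (cutoff (1 / real (Suc i)) (norm (\<omega>::complex))))"
    proof (intro incseq_SucI le_funI)
      fix i :: nat and \<omega> :: complex
      have "1 / real (Suc (Suc i)) \<le> 1 / real (Suc i)" by (simp add: frac_le)
      then show "ennreal (cutoff (1 / real (Suc i)) (norm \<omega>)) \<le> ennreal (cutoff (1 / real (Suc (Suc i))) (norm \<omega>))"
        by (auto simp: cutoff_def indicator_def)
    qed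
    show "(\<lambda>i. ennreal (cutoff (1 / real (Suc i)) (norm \<omega>))) \<longlonglongrightarrow> ennreal (norm \<omega> powr - s)" for \<omega> :: complex
    proof (cases "\<omega> = 0")
      case False
      have "(\<lambda>i. 1 / real (Suc i)) \<longlonglongrightarrow> 0"
        using LIMSEQ_inverse_real_of_nat by (simp add: inverse_eq_divide)
      from order_tendstoD(2)[OF this, of "norm \<omega>"] False
      have "eventually (\<lambda>i. 1 / real (Suc i) < norm \<omega>) sequentially" by simp
      then have "eventually (\<lambda>i. ennreal (cutoff (1 / real (Suc i)) (norm \<omega>)) = ennreal (norm \<omega> powr - s)) sequentially"
        by eventually_elim (simp add: cutoff_def)
      then show ?thesis by (rule tendsto_eventually)
    qed (simp add: cutoff_def)
  qed simp
  moreover have "(\<integral>\<^sup>+\<omega>. ennreal (norm \<omega> powr - s) \<partial>disc_measure s) = \<infinity>"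
    by (simp add: disc_measure_moment)
  ultimately have "(\<lambda>i. ennreal (L (1 / real (Suc i)))) \<longlonglongrightarrow> \<infinity>"
    by (simp add: nn_integral_cutoff)
  moreover have "ennreal (L (1 / real (Suc i))) \<le> ennreal Q" for i
    using le[of "1 / real (Suc i)"] by (intro ennreal_leI) simp
  ultimately have "\<infinity> \<le> ennreal Q"
    by (intro LIMSEQ_le_const2[of "\<lambda>i. ennreal (L (1 / real (Suc i)))"]) auto
  then show False by (simp add: top_unique)
qed

lemma nn_integral_test:
  "(\<integral>\<^sup>+z. ennreal (norm (test \<epsilon> z) powr q) \<partial>M)
    = ennreal pi * (\<integral>\<^sup>+\<omega>. ennreal (norm \<omega> powr (2 * of_int n - q * (of_int n + s)) * indicator {\<epsilon><..} (norm \<omega>)) \<partial>disc_measure s)"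
proof -
  have "(\<integral>\<^sup>+z. ennreal (norm (test \<epsilon> z) powr q) \<partial>M)
      = (\<integral>\<^sup>+z. ennreal (norm (snd z) powr (- q * (of_int n + s)) * indicator {\<epsilon><..} (norm (snd z))) \<partial>M)"
  proof (rule nn_integral_cong)
    fix z assume "z \<in> space M"
    then have z: "snd z \<noteq> 0" using hartogs_triangleD by simp
    have "norm (test \<epsilon> z) = norm (snd z) powr (- (of_int n + s)) * indicator {\<epsilon><..} (norm (snd z))"
      using z by (simp add: test_def norm_mult norm_e cutoff_def abs_mult powr_add[symmetric])
    then have "norm (test \<epsilon> z) powr q = norm (snd z) powr (- q * (of_int n + s)) * indicator {\<epsilon><..} (norm (snd z))"
      by (simp add: indicator_def powr_powr algebra_simps)
    then show "ennreal (norm (test \<epsilon> z) powr q) = ennreal (norm (snd z) powr (- q * (of_int n + s)) * indicator {\<epsilon><..} (norm (snd z)))"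
      by simp
  qed
  also have "\<dots> = ennreal pi * (\<integral>\<^sup>+w. ennreal (norm w powr (- q * (of_int n + s)) * indicator {\<epsilon><..} (norm w)) * ennreal (norm w powr (2 * of_int n)) \<partial>disc_measure s)"
    by (rule nn_integral_M_snd) measurable
  also have "(\<lambda>w::complex. ennreal (norm w powr (- q * (of_int n + s)) * indicator {\<epsilon><..} (norm w)) * ennreal (norm w powr (2 * of_int n)))
      = (\<lambda>w. ennreal (norm w powr (2 * of_int n - q * (of_int n + s)) * indicator {\<epsilon><..} (norm w)))"
  proof
    fix w :: complex
    have "norm w powr (2 * of_int n - q * (of_int n + s)) = norm w powr (- q * (of_int n + s)) * norm w powr (2 * of_int n)"
      unfolding powr_add[symmetric] by simp
    then show "ennreal (norm w powr (- q * (of_int n + s)) * indicator {\<epsilon><..} (norm w)) * ennreal (norm w powr (2 * of_int n))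
       = ennreal (norm w powr (2 * of_int n - q * (of_int n + s)) * indicator {\<epsilon><..} (norm w))"
      by (simp add: ennreal_mult[symmetric] indicator_def)
  qed
  finally show ?thesis .
qed

lemma test_Lp: "0 < \<epsilon> \<Longrightarrow> test \<epsilon> \<in> Lp_space q M"
  unfolding Lp_space_iff nn_integral_test
  using nn_integral_truncated_finite[of \<epsilon> "2 * of_int n - q * (of_int n + s)"]
  by (auto simp: ennreal_mult_less_top test_def[abs_def] intro!: borel_measurable_M)

lemma norm_B_test:
  assumes "0 < \<epsilon>"
  shows "AE z in M. norm (B (test \<epsilon>) z) = s / (2 * pi) * L \<epsilon> * norm (e z)"
  using B_eq_P(3)[OF test_Lp[OF assms]] AE_space
proof eventually_elim
  case (elim z)
  have L0: "L \<epsilon> \<ge> 0" unfolding L_def by (intro Bochner_Integration.integral_nonneg) (simp add: cutoff_nonneg)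
  have "P (test \<epsilon>) z = e z * of_real (s / (2 * pi) * L \<epsilon>)"
    using P_radial[OF borel_measurable_cutoff integrable_cutoff[OF assms], of z] test_Lp[OF assms, of 2] elim
    by (simp add: test_def[abs_def] L_def)
  then have "norm (B (test \<epsilon>) z) = norm (e z) * \<bar>s / (2 * pi) * L \<epsilon>\<bar>"
    using elim(1) by (simp only: norm_mult norm_of_real)
  then show ?case using L0 s_pos by (simp add: mult.commute)
qed

text \<open>The image of \<open>test \<epsilon>\<close> is
  \<open>s / (2 * pi) * L \<epsilon>\<close> times \<open>e\<close> up to null sets. Either
  \<open>e\<close> is not p-integrable and one image violates boundedness, or the p-th power of the
  image norm grows like \<open>L \<epsilon> powr p\<close> against at most
  \<open>L \<epsilon> powr d\<close> for the test function, with \<open>d < p\<close>.\<close>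

lemma not_Lp_bounded:
  assumes p: "p \<ge> 1" and d: "0 \<le> d" "d < p" and A: "0 \<le> A"
    and bound: "s + 2 * of_int n \<le> p * of_int n \<or>
      (\<forall>\<epsilon>>0. (\<integral>\<^sup>+z. ennreal (norm (test \<epsilon> z) powr p) \<partial>M) \<le> ennreal (A * L \<epsilon> powr d))"
  shows "\<not> Lp_bounded p M B"
proof
  assume "Lp_bounded p M B"
  then obtain C where C: "\<And>f. f \<in> Lp_space p M \<Longrightarrow> f \<in> Lp_space 2 M \<Longrightarrow>
      B f \<in> Lp_space p M \<and> Lp_norm p M (B f) \<le> C * Lp_norm p M f"
    unfolding Lp_bounded_def by blast
  define X where "X = (\<integral>\<^sup>+z. ennreal (norm (e z) powr p) \<partial>M)"
  have Bnorm: "(\<integral>\<^sup>+z. ennreal (norm (B (test \<epsilon>) z) powr p) \<partial>M) = ennreal ((s / (2 * pi) * L \<epsilon>) powr p) * X"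
    if \<epsilon>: "\<epsilon> > 0" and L: "L \<epsilon> > 0" for \<epsilon>
  proof -
    have "(\<integral>\<^sup>+z. ennreal (norm (B (test \<epsilon>) z) powr p) \<partial>M)
        = (\<integral>\<^sup>+z. ennreal ((s / (2 * pi) * L \<epsilon>) powr p) * ennreal (norm (e z) powr p) \<partial>M)"
    proof (rule nn_integral_cong_AE)
      show "AE z in M. ennreal (norm (B (test \<epsilon>) z) powr p) = ennreal ((s / (2 * pi) * L \<epsilon>) powr p) * ennreal (norm (e z) powr p)"
        using norm_B_test[OF \<epsilon>]
      proof eventually_elim
        case (elim z)
        show ?case unfolding elim using s_pos L
          by (subst powr_mult) (auto simp: ennreal_mult)
      qed
    qed
    also have "\<dots> = ennreal ((s / (2 * pi) * L \<epsilon>) powr p) * X"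
      unfolding X_def by (rule nn_integral_cmult) measurable
    finally show ?thesis .
  qed
  \<comment> \<open>The image must be a nonzero multiple of \<open>e\<close> for its p-integrability
    to say anything about \<open>e\<close>.\<close>
  obtain \<epsilon>0 where \<epsilon>0: "\<epsilon>0 > 0" "L \<epsilon>0 > 0" using L_unbounded[of 0] by blast
  have c0: "(s / (2 * pi) * L \<epsilon>0) powr p > 0" using \<epsilon>0 s_pos by simp
  have "B (test \<epsilon>0) \<in> Lp_space p M" using C[OF test_Lp test_Lp] \<epsilon>0 by blast
  then have "ennreal ((s / (2 * pi) * L \<epsilon>0) powr p) * X < \<infinity>"
    unfolding Lp_space_iff Bnorm[OF \<epsilon>0] by simp
  then have X_fin: "X < \<infinity>"
    using c0 by (auto simp: ennreal_mult_less_top)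
  then have pos: "0 < s + 2 * of_int n - p * of_int n"
    unfolding X_def nn_integral_norm_e by (auto split: if_splits)
  define x where "x = pi * (2 * pi / (s + 2 * of_int n - p * of_int n))"
  have x: "x > 0" "X = ennreal x" using pos by (simp_all add: x_def X_def nn_integral_norm_e)
  from bound pos have bound: "(\<integral>\<^sup>+z. ennreal (norm (test \<epsilon> z) powr p) \<partial>M) \<le> ennreal (A * L \<epsilon> powr d)" if "\<epsilon> > 0" for \<epsilon>
    using that by auto
  define \<kappa> where "\<kappa> = (s / (2 * pi)) powr p * x"
  have \<kappa>: "\<kappa> > 0" using x s_pos by (simp add: \<kappa>_def)
  \<comment> \<open>Boundedness gives \<open>\<kappa> * L \<epsilon> powr p \<le> \<bar>C\<bar> powr
    p * A * L \<epsilon> powr d\<close>, so \<open>Q\<close> would bound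
    \<open>L \<epsilon> powr (p - d)\<close>. The absolute value is there because \<open>C\<close>
    carries no sign.\<close>
  define Q where "Q = \<bar>C\<bar> powr p * A / \<kappa>"
  have key: "L \<epsilon> powr (p - d) \<le> Q" if \<epsilon>: "\<epsilon> > 0" and L: "L \<epsilon> > 0" for \<epsilon>
  proof -
    have t: "test \<epsilon> \<in> Lp_space p M" "test \<epsilon> \<in> Lp_space 2 M" by (rule test_Lp[OF \<epsilon>])+
    have Bt: "B (test \<epsilon>) \<in> Lp_space p M" "Lp_norm p M (B (test \<epsilon>)) \<le> C * Lp_norm p M (test \<epsilon>)" using C[OF t] by auto
    have "C * Lp_norm p M (test \<epsilon>) \<le> \<bar>C\<bar> * Lp_norm p M (test \<epsilon>)" by (intro mult_right_mono) auto
    with Bt have "Lp_norm p M (B (test \<epsilon>)) powr p \<le> (\<bar>C\<bar> * Lp_norm p M (test \<epsilon>)) powr p"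
      using p by (intro powr_mono2) auto
    also have "\<dots> = \<bar>C\<bar> powr p * Lp_norm p M (test \<epsilon>) powr p" by (simp add: powr_mult)
    also have "\<dots> \<le> \<bar>C\<bar> powr p * (A * L \<epsilon> powr d)"
    proof (rule mult_left_mono)
      have "ennreal (Lp_norm p M (test \<epsilon>) powr p) \<le> ennreal (A * L \<epsilon> powr d)"
        using bound[OF \<epsilon>] nn_integral_Lp_norm[OF t(1)] p by simp
      then show "Lp_norm p M (test \<epsilon>) powr p \<le> A * L \<epsilon> powr d" using A by (simp add: ennreal_le_iff)
    qed simp
    finally have 1: "Lp_norm p M (B (test \<epsilon>)) powr p \<le> \<bar>C\<bar> powr p * (A * L \<epsilon> powr d)" .
    have "ennreal (Lp_norm p M (B (test \<epsilon>)) powr p) = ennreal ((s / (2 * pi) * L \<epsilon>) powr p) * ennreal x"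
      using Bnorm[OF \<epsilon> L] nn_integral_Lp_norm[OF Bt(1)] p x by simp
    also have "\<dots> = ennreal ((s / (2 * pi) * L \<epsilon>) powr p * x)" using x by (simp add: ennreal_mult)
    finally have "Lp_norm p M (B (test \<epsilon>)) powr p = (s / (2 * pi) * L \<epsilon>) powr p * x"
      using x by (subst (asm) ennreal_inj) auto
    also have "\<dots> = \<kappa> * L \<epsilon> powr p"
      unfolding \<kappa>_def using s_pos L by (subst powr_mult) auto
    finally have "\<kappa> * L \<epsilon> powr p \<le> \<bar>C\<bar> powr p * A * L \<epsilon> powr d" using 1 by simp
    then have "L \<epsilon> powr p / L \<epsilon> powr d \<le> \<bar>C\<bar> powr p * A / \<kappa>"
      using \<kappa> L by (simp add: field_simps)
    then show ?thesis by (simp add: powr_diff Q_def)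
  qed
  have Q0: "Q \<ge> 0" using A \<kappa> by (simp add: Q_def)
  obtain \<epsilon> where \<epsilon>: "\<epsilon> > 0" "L \<epsilon> > Q powr (1 / (p - d)) + 1" using L_unbounded by blast
  have "0 \<le> Q powr (1 / (p - d))" by simp
  with \<epsilon> have L: "L \<epsilon> > 0" "Q powr (1 / (p - d)) < L \<epsilon>" by linarith+
  have "Q = (Q powr (1 / (p - d))) powr (p - d)" using d Q0 by (simp add: powr_powr)
  also have "\<dots> < L \<epsilon> powr (p - d)" using L d by (intro powr_less_mono2) auto
  finally show False using key[OF \<epsilon>(1) L(1)] by simp
qed

text \<open>Here \<open>e\<close> is not p-integrable although every test function is.\<close>

lemma not_Lp_bounded_upper:
  assumes "p \<ge> 1" "s + 2 * of_int n \<le> p * of_int n"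
  shows "\<not> Lp_bounded p M B"
  using not_Lp_bounded[of p 0 0] assms by simp

text \<open>The hypothesis says \<open>2 * n - p * (n + s) \<ge> - s\<close>, so the p-th power of
  the norm of the test function is at most \<open>pi * L \<epsilon>\<close>: growth of degree 1,
  which suffices for \<open>p > 1\<close>. At \<open>p = 1\<close> the exponent is
  \<open>n - s\<close>, whose moment \<open>2 * pi / n\<close> is finite for \<open>n > 0\<close>,
  and degree 0 is available.\<close>

lemma not_Lp_bounded_lower:
  assumes p: "p \<ge> 1" and le: "p * (of_int n + s) \<le> s + 2 * of_int n" and pn: "p > 1 \<or> n > 0"
  shows "\<not> Lp_bounded p M B"
proof -
  let ?I = "\<lambda>\<epsilon>. \<integral>\<^sup>+\<omega>. ennreal (norm \<omega> powr (2 * of_int n - p * (of_int n + s)) * indicator {\<epsilon><..} (norm \<omega>)) \<partial>disc_measure s"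
  let ?T = "\<lambda>\<epsilon>. \<integral>\<^sup>+z. ennreal (norm (test \<epsilon> z) powr p) \<partial>M"
  show ?thesis
  proof (cases "p > 1")
  case True
  have "?T \<epsilon> \<le> ennreal (pi * L \<epsilon> powr 1)" if \<epsilon>: "\<epsilon> > 0" for \<epsilon>
  proof -
    have L0: "L \<epsilon> \<ge> 0" unfolding L_def by (intro Bochner_Integration.integral_nonneg) (simp add: cutoff_nonneg)
    have "?I \<epsilon>
      \<le> (\<integral>\<^sup>+\<omega>. ennreal (cutoff \<epsilon> (norm \<omega>)) \<partial>disc_measure s)"
    proof (rule nn_integral_mono_AE)
      show "AE \<omega> in disc_measure s. ennreal (norm \<omega> powr (2 * of_int n - p * (of_int n + s)) * indicator {\<epsilon><..} (norm \<omega>))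
          \<le> ennreal (cutoff \<epsilon> (norm \<omega>))"
        using AE_disc_measure
      proof eventually_elim
        case (elim \<omega>)
        have "norm \<omega> powr (2 * of_int n - p * (of_int n + s)) \<le> norm \<omega> powr - s"
          using elim le by (intro powr_mono') auto
        then show ?case unfolding cutoff_def by (intro ennreal_leI mult_right_mono) auto
      qed
    qed
    also have "\<dots> = ennreal (L \<epsilon>)" by (rule nn_integral_cutoff[OF \<epsilon>])
    finally have "ennreal pi * ?I \<epsilon>
      \<le> ennreal pi * ennreal (L \<epsilon>)" by (rule mult_left_mono) simp
    then show ?thesis unfolding nn_integral_test using L0 by (simp add: ennreal_mult)
  qed
  then show ?thesis using not_Lp_bounded[of p 1 pi] True by simp
next
  case False
  then have p1: "p = 1" and n: "n > 0" using p pn by auto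
  have "?T \<epsilon> \<le> ennreal (pi * (2 * pi / of_int n) * L \<epsilon> powr 0)"
    if \<epsilon>: "L \<epsilon> \<noteq> 0" for \<epsilon>
  proof -
    have "?I \<epsilon>
      \<le> (\<integral>\<^sup>+\<omega>. ennreal (norm \<omega> powr (of_int n - s)) \<partial>disc_measure s)"
      unfolding p1 by (intro nn_integral_mono ennreal_leI) (auto simp: indicator_def algebra_simps)
    also have "\<dots> = ennreal (2 * pi / of_int n)" using n by (simp add: disc_measure_moment)
    finally have "ennreal pi * ?I \<epsilon>
      \<le> ennreal pi * ennreal (2 * pi / of_int n)" by (rule mult_left_mono) simp
    also have "\<dots> = ennreal (pi * (2 * pi / of_int n) * L \<epsilon> powr 0)"
      using \<epsilon> n by (simp add: ennreal_mult'[symmetric])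
    finally show ?thesis unfolding nn_integral_test .
  qed
  \<comment> \<open>For \<open>L \<epsilon> = 0\<close> the factor
    \<open>L \<epsilon> powr 0\<close> is 0 and not 1; the bound survives because the test function
    then vanishes almost everywhere.\<close>
  moreover have "L \<epsilon> \<noteq> 0 \<or> ?T \<epsilon> = 0" if \<epsilon>: "\<epsilon> > 0" for \<epsilon>
  proof (rule disjCI)
    assume "\<not> ?T \<epsilon> = 0"
    then have "?I \<epsilon> \<noteq> 0"
      unfolding nn_integral_test by auto
    moreover have "?I \<epsilon> = 0"
      if "L \<epsilon> = 0"
    proof -
      have "(\<integral>\<^sup>+\<omega>. ennreal (cutoff \<epsilon> (norm \<omega>)) \<partial>disc_measure s) = 0"
        using nn_integral_cutoff[OF \<epsilon>] that by simp
      then have "AE \<omega> in disc_measure s. ennreal (cutoff \<epsilon> (norm \<omega>)) = 0"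
        by (subst (asm) nn_integral_0_iff_AE) auto
      then have "AE \<omega> in disc_measure s. ennreal (norm \<omega> powr (2 * of_int n - p * (of_int n + s)) * indicator {\<epsilon><..} (norm \<omega>)) = 0"
        using AE_disc_measure by eventually_elim (auto simp: cutoff_def indicator_def)
      then show ?thesis by (subst nn_integral_0_iff_AE) auto
    qed
    ultimately show "L \<epsilon> \<noteq> 0" by blast
  qed
  ultimately have "\<forall>\<epsilon>>0. ?T \<epsilon> \<le> ennreal (pi * (2 * pi / of_int n) * L \<epsilon> powr 0)"
    by (metis zero_le)
  then show ?thesis using not_Lp_bounded[of p 0 "pi * (2 * pi / of_int n)"] n p1 by simp
  qed
qed

text \<open>The second assumption leaves out \<open>p = 1\<close> with
  \<open>n \<le> 0 < s + n\<close>. As \<open>s \<le> 2\<close>, this means \<open>n = 0\<close>, or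
  \<open>n = -1\<close> with \<open>s > 1\<close>; then \<open>s + 2 * n - 4\<close> lies between -5
  and -2.\<close>

theorem Lp_bounded_iff:
  assumes "p \<ge> 1" and "p > 1 \<or> n > 0 \<or> s + of_int n \<le> 0"
  shows "Lp_bounded p M B \<longleftrightarrow>
    1 < p \<and> p * of_int n < s + 2 * of_int n \<and> s + 2 * of_int n < p * (of_int n + s)"
proof
  assume bdd: "Lp_bounded p M B"
  have 1: "p * of_int n < s + 2 * of_int n" using not_Lp_bounded_upper[of p] assms bdd by force
  \<comment> \<open>At \<open>p = 1\<close> the first inequality reads \<open>0 < s + n\<close>,
    which rules out the last alternative of the assumption.\<close>
  have pn: "p > 1 \<or> n > 0"
  proof (cases "p > 1")
    case False
    then have "p = 1" using assms by simp
    with assms 1 show ?thesis by auto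
  qed simp
  then have 2: "s + 2 * of_int n < p * (of_int n + s)" using not_Lp_bounded_lower[of p] assms bdd by force
  have "p \<noteq> 1" using pn 2 by auto
  with 1 2 assms show "1 < p \<and> p * of_int n < s + 2 * of_int n \<and> s + 2 * of_int n < p * (of_int n + s)" by auto
qed (use B_Lp_bounded in blast)

end

section \<open>The five ranges of the exponent\<close>

theorem theorem1p3:
  fixes s' s p :: real and k :: int
  assumes "s' = s + 2 * of_int k" and "0 < s" and "s \<le> 2"
    and "1 \<le> p"
  shows
    "(s' \<in> {-2<..} \<longrightarrow>
        (hartogs_projection_bounded s' p \<longleftrightarrow>
           p \<in> {(s + 2 * of_int k + 4) / (s + of_int k + 2) <..< (s + 2 * of_int k + 4) / (of_int k + 2)}))
   \<and> (s' \<in> {-5..-2} \<longrightarrow> p \<in> {1<..} \<longrightarrow> hartogs_projection_bounded s' p)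
   \<and> (s' \<in> {-6<..<-5} \<longrightarrow>
        k = -3 \<and> s \<in> {0<..<1} \<and>
        (hartogs_projection_bounded s' p \<longleftrightarrow> p \<in> {2 - s <..< (2 - s) / (1 - s)}))
   \<and> (s' = -6 \<longrightarrow> p \<in> {1<..} \<longrightarrow> hartogs_projection_bounded s' p)
   \<and> (s' \<in> {..<-6} \<longrightarrow>
        (hartogs_projection_bounded s' p \<longleftrightarrow>
           p \<in> {(s + 2 * of_int k + 4) / (of_int k + 2) <..< (s + 2 * of_int k + 4) / (s + of_int k + 2)}))"
proof -
  interpret H: hartogs_weighted s "k + 2" by standard (use assms in auto)
  define n :: real where "n = of_int (k + 2)"
  have k: "of_int k = n - 2" by (simp add: n_def)
  have s': "s' = s + 2 * n - 4" using assms(1) by (simp add: k)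
  have bdd: "hartogs_projection_bounded s' p \<longleftrightarrow> Lp_bounded p H.M H.B"
    by (simp add: hartogs_projection_bounded_def H.M_def H.B_def s' n_def)
  have iff: "hartogs_projection_bounded s' p \<longleftrightarrow> 1 < p \<and> p * n < s + 2 * n \<and> s + 2 * n < p * (n + s)"
    if "p > 1 \<or> n > 0 \<or> s + n \<le> 0"
    unfolding bdd n_def by (rule H.Lp_bounded_iff) (use that assms in \<open>auto simp: n_def\<close>)
  \<comment> \<open>Integrality of \<open>n\<close> as a dichotomy between reals; together with
    \<open>0 < s \<le> 2\<close> it lets linear arithmetic find \<open>n\<close> from the range of
    \<open>s'\<close>.\<close>
  have n_int: "n \<le> of_int j \<or> n \<ge> of_int j + 1" for j :: int
  proof -
    have "k + 2 \<le> j \<or> j + 1 \<le> k + 2" by linarith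
    then show ?thesis unfolding n_def by (metis of_int_1 of_int_add of_int_le_iff)
  qed
  \<comment> \<open>Here \<open>n \<ge> 1\<close>, so both denominators are positive. At
    \<open>p = 1\<close> the lower inequality would say \<open>n < 0\<close>, hence the interval
    already forces \<open>p > 1\<close>.\<close>
  have case1: "hartogs_projection_bounded s' p \<longleftrightarrow> p \<in> {(s + 2 * n) / (s + n) <..< (s + 2 * n) / n}" if "s' > -2"
  proof -
    have n: "n \<ge> 1" using that n_int[of 0] assms(3) unfolding s' by simp
    then have "(s + 2 * n) / (s + n) < p \<longleftrightarrow> s + 2 * n < p * (n + s)" "p < (s + 2 * n) / n \<longleftrightarrow> p * n < s + 2 * n"
      using assms(2) by (simp_all add: divide_less_eq less_divide_eq add.commute)
    moreover have "1 < p" if "s + 2 * n < p * (n + s)"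
    proof (rule ccontr)
      assume "\<not> 1 < p"
      then have "p = 1" using assms(4) by simp
      with that n show False by simp
    qed
    ultimately show ?thesis using iff n by auto
  qed
  \<comment> \<open>The range leaves \<open>n = 0\<close>, or \<open>n = -1\<close> with
    \<open>s \<ge> 1\<close>; in both cases the two inequalities hold for every
    \<open>p > 1\<close>.\<close>
  have case2: "hartogs_projection_bounded s' p" if s'_range: "-5 \<le> s'" "s' \<le> -2" and p: "1 < p"
  proof -
    have "-1 \<le> n" "n \<le> 0"
      using s'_range n_int[of "-2"] n_int[of 0] assms(2,3) unfolding s' by simp_all
    then consider "n = 0" | "n = -1" "s \<ge> 1"
      using s'_range n_int[of "-1"] unfolding s' by fastforce
    then show ?thesis
    proof cases
      case 1
      then show ?thesis using iff p assms(2) by simp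
    next
      case 2
      have "1 * (s - 1) \<le> p * (s - 1)" using 2 p by (intro mult_right_mono) auto
      then show ?thesis using iff p 2 by (simp add: algebra_simps)
    qed
  qed
  have case3: "k = -3 \<and> 0 < s \<and> s < 1 \<and> (hartogs_projection_bounded s' p \<longleftrightarrow> p \<in> {2 - s <..< (2 - s) / (1 - s)})"
    if "-6 < s'" "s' < -5"
  proof -
    have n: "n = -1"
      using that n_int[of "-2"] n_int[of "-1"] assms(2,3) unfolding s' by fastforce
    have s1: "s < 1" using that n unfolding s' by simp
    have "k = -3" using n by (simp add: n_def)
    moreover have "p < (2 - s) / (1 - s) \<longleftrightarrow> s - 2 < p * (-1 + s)"
      using s1 by (simp add: less_divide_eq algebra_simps)
    moreover have "2 - s < p \<Longrightarrow> 1 < p" using s1 by simp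
    ultimately show ?thesis using iff n s1 assms(2) by auto
  qed
  \<comment> \<open>The isolated value \<open>n = -2\<close>, \<open>s = 2\<close>: as
    \<open>s + n = 0\<close>, the second inequality reads \<open>-2 < 0\<close>, and the first says
    \<open>p > 1\<close>.\<close>
  have case4: "hartogs_projection_bounded s' p" if "s' = -6" "1 < p"
  proof -
    have "n = -2" "s = 2"
      using that n_int[of "-3"] n_int[of "-2"] assms(2,3) unfolding s' by fastforce+
    then show ?thesis using iff that by simp
  qed
  \<comment> \<open>Now \<open>n\<close> and \<open>s + n\<close> are both negative; dividing by
    them reverses the inequalities, which is why the endpoints trade places compared with the first
    range.\<close>
  have case5: "hartogs_projection_bounded s' p \<longleftrightarrow> p \<in> {(s + 2 * n) / n <..< (s + 2 * n) / (s + n)}" if "s' < -6"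
  proof -
    have n: "n \<le> -2" using that n_int[of "-2"] assms(2) unfolding s' by simp
    have sn: "s + n < 0" using that n assms(3) unfolding s' by linarith
    then have "(s + 2 * n) / n < p \<longleftrightarrow> p * n < s + 2 * n" "p < (s + 2 * n) / (s + n) \<longleftrightarrow> s + 2 * n < p * (n + s)"
      using n by (simp_all add: divide_less_eq less_divide_eq add.commute)
    moreover have "1 < p" if "p * n < s + 2 * n"
    proof (rule ccontr)
      assume "\<not> 1 < p"
      then have "p = 1" using assms(4) by simp
      with that sn show False by simp
    qed
    ultimately show ?thesis using iff sn by auto
  qed
  have eqs: "s + 2 * of_int k + 4 = s + 2 * n" "s + of_int k + 2 = s + n" "of_int k + 2 = n"
    by (simp_all add: k)
  show ?thesis
    unfolding eqs using case1 case2 case3 case4 case5 by auto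
qed

end
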